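(* Let $\mathbb X$ be a virtual equipment. Let $j\colon B\to D$, $\ell'\colon A\to B$, $j'\colon A\to E$, $r'\colon D\to E$ be tight-cells with a relative adjunction $(j\ell')\dashv_{j'}r'$, and let $T=(t,\dagger,\eta)$ be a $j$-relative monad. Then $r't\ell'\colon A\to E$ may be equipped with the structure of a $j'$-relative monad, denoted $\ell';T;r'$, for which $r'\eta\ell'\colon r'j\ell'\Rightarrow r't\ell'$ is a morphism of $j'$-relative monads from the $j'$-relative monad $\ell';j;r'$ (with carrier $r'j\ell'$, induced by $(j\ell')\dashv_{j'}r'$) to $\ell';T;r'$. Furthermore, this assignment extends to a functor $(\ell';-;r')\colon\mathbf{RMnd}(j)\to\mathbf{RMnd}(j')$ such that $$(\ell';-;r')\circ\Lambda^L_j=\Lambda^L_{j'}\circ(\ell';-;r')^{\mathrm{op}}\colon\mathbf{RAdj}_L(j)^{\mathrm{op}}\to\mathbf{RMnd}(j'),\qquad(\ell';-;r')\circ\Lambda^R_j=\Lambda^R_{j'}\circ(\ell';-;r')\colon\mathbf{RAdj}_R(j)\to\mathbf{RMnd}(j'),$$ where $\Lambda^L$ and $\Lambda^R$ are the functors sending a relative adjunction to its induced relative monad, and $(\ell';-;r')$ on relative adjunctions sends $\ell\dashv_j r$ to $(\ell\ell')\dashv_{j'}(r'r)$.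
   Context: Virtual equipments. A virtual double category has objects; a category of tight-cells $f\colon A\to B$ (the composite of $f\colon A\to B$ and $g\colon B\to C$ is $gf$); loose-cells $p\colon A\nrightarrow B$; and 2-cells, each having as frame a chain of loose-cells $p_1\colon A_1\nrightarrow A_0,\dots,p_n\colon A_n\nrightarrow A_{n-1}$ ($n\ge 0$; chains are always listed in this order), a loose-cell $q\colon B_n\nrightarrow B_0$, and tight-cells $f_0\colon A_0\to B_0$ (left) and $f_n\colon A_n\to B_n$ (right); 2-cells have identities and associative unital multicategory-style composition. $\phi\colon p_1,\dots,p_n\Rightarrow q$ denotes a 2-cell whose tight-cells are identities; $(\phi_1,\dots,\phi_n)$ denotes juxtaposition. A 2-cell $q_1,\dots,q_m\Rightarrow q$ is opcartesian if every 2-cell (with any tight-cells) with domain $p_1,\dots,p_l,q_1,\dots,q_m,r_1,\dots,r_n$ factors uniquely through it; then $q$ is the loose-composite $q_1\odot\cdots\odot q_m$ (the loose-identity $A(1,1)\colon A\nrightarrow A$ if $m=0$). A unary 2-cell from $p$ to $q$ with left $f$ and right $g$ is cartesian if every 2-cell into $q$ with left $ff'$ and right $gg'$ factors uniquely through it via a 2-cell with left $f'$ and right $g'$; then $p$ is the restriction $q(f,g)$. A virtual equipment has all loose-identities and restrictions. Write $E(f,g):=E(1,1)(f,g)$; for $f\colon D\to E$, $g\colon A\to E$ it is a loose-cell $A\nrightarrow D$. The canonical isomorphisms $q(f,g)\cong C(f,1)\odot q\odot B(1,g)$ are used implicitly. A 2-cell $f\Rightarrow g$ between tight-cells $A\to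 B$ is equivalently a 2-cell $B(1,f)\Rightarrow B(1,g)$, or $B(g,1)\Rightarrow B(f,1)$, or $()\Rightarrow B(f,g)$; objects, tight-cells and these 2-cells form a 2-category. Restriction is functorial in 2-cells (contravariantly in the first argument, covariantly in the second). For $f\colon A\to B$, $\frown_f\colon ()\Rightarrow B(f,f)$ (corresponding to $1_f$) and $\smile_f\colon B(1,f),B(f,1)\Rightarrow B(1,1)$ are the canonical 2-cells. $\phi(f,g)$ denotes the 2-cell obtained from $\phi$ by restricting along $f$ on the left and $g$ on the right; e.g. $\smile_t(x,y)\colon D(x,t),D(t,y)\Rightarrow D(x,y)$ is composition and $\frown_c(x,y)\colon C(x,y)\Rightarrow C'(cx,cy)$ is the action of $c\colon C\to C'$. Relative monads. For $j\colon B\to D$, a $j$-relative monad $(t,\dagger,\eta)$ comprises a tight-cell $t\colon B\to D$, a 2-cell $\dagger\colon D(j,t)\Rightarrow D(t,t)$ and a 2-cell $\eta\colon j\Rightarrow t$ such that: (i) $D(\eta,t)\circ\dagger=1$; (ii) $\dagger\circ D(j,\eta)\circ\frown_j=\frown_t$; (iii) the 2-cells $D(j,t),D(j,t)\Rightarrow D(t,t)$ given by $(\dagger,\dagger)$ followed by $\smile_t(t,t)$, and by $(1,\dagger)$ followed by $\smile_t(j,t)$ followed by $\dagger$, are equal. A morphism is a 2-cell $\tau\colon t\Rightarrow t'$ with $\tau\circ\eta=\eta'$ and $D(t,\tau)\circ\dagger=D(\tau,t')\circ\dagger'\circ D(j,\tau)$. These form $\mathbf{RMnd}(j)$. Relative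 adjunctions. A $j$-relative adjunction $\ell\dashv_j r$ consists of tight-cells $\ell\colon B\to C$, $r\colon C\to D$ and an isomorphism $\sharp\colon C(\ell,1)\cong D(j,r):\flat$; its unit $\eta\colon j\Rightarrow r\ell$ corresponds to $\sharp(1,\ell)\circ\frown_\ell$. A left-morphism from $\ell_1\dashv_j r_1$ to $\ell_2\dashv_j r_2$ is a pair $(c\colon C_1\to C_2,\lambda\colon\ell_2\Rightarrow c\ell_1)$ with $r_1=r_2c$ and $\sharp_1=\sharp_2(1,c)\circ C_2(\lambda,c)\circ\frown_c(\ell_1,1)$. A right-morphism is a pair $(c\colon C_1\to C_2,\rho\colon r_1\Rightarrow r_2c)$ with $c\ell_1=\ell_2$ and $D(j,\rho)\circ\sharp_1=\sharp_2(1,c)\circ\frown_c(\ell_1,1)$. These give categories $\mathbf{RAdj}_L(j)$, $\mathbf{RAdj}_R(j)$. Induced relative monads. $\ell\dashv_j r$ induces the $j$-relative monad with carrier $r\ell$, unit $\eta$, and extension operator $D(j,r\ell)\xrightarrow{\flat(1,\ell)}C(\ell,\ell)\xrightarrow{\frown_r(\ell,\ell)}D(r\ell,r\ell)$. This extends to functors $\Lambda^L_j\colon\mathbf{RAdj}_L(j)^{\mathrm{op}}\to\mathbf{RMnd}(j)$, $(c,\lambda)\mapsto r_2\lambda$, and $\Lambda^R_j\colon\mathbf{RAdj}_R(j)\to\mathbf{RMnd}(j)$, $(c,\rho)\mapsto\rho\ell_1$. Composition of relative adjunctions. Given $(j\ell')\dashv_{j'}r'$, the functors $(\ell';-;r')\colon\mathbf{RAdj}_L(j)\to\mathbf{RAdj}_L(j')$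 and $\mathbf{RAdj}_R(j)\to\mathbf{RAdj}_R(j')$ send $\ell\dashv_j r$ to $(\ell\ell')\dashv_{j'}(r'r)$, with isomorphism $C(\ell\ell',1)\cong D(j\ell',r)\cong E(j',r'r)$, and send $(c,\lambda)$ to $(c,\lambda\ell')$ and $(c,\rho)$ to $(c,r'\rho)$. *)

theory Defs
  imports Main
begin

section \<open>Categories and functors\<close>

text \<open>Hom-families are not required to be disjoint: a morphism is always considered together with
  its source and target, so composition, identities and the action of functors on morphisms
  take the objects as arguments.\<close>

record ('x, 'm) category_data =
  Ob  :: "'x set"
  Hom :: "'x \<Rightarrow> 'x \<Rightarrow> 'm set"
  Idn :: "'x \<Rightarrow> 'm"
  Cmp :: "'x \<Rightarrow> 'x \<Rightarrow> 'x \<Rightarrow> 'm \<Rightarrow> 'm \<Rightarrow> 'm" \<comment> \<open>\<open>Cmp x y z g f\<close> is \<open>g \<circ> f\<close> for \<open>f : x \<rightarrow> y\<close>, \<open>g : y \<rightarrow> z\<close>\<close>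

locale category =
  fixes C :: "('x, 'm) category_data"
  assumes idn_in_hom: "x \<in> Ob C \<Longrightarrow> Idn C x \<in> Hom C x x"
    and cmp_in_hom: "\<lbrakk>x \<in> Ob C; y \<in> Ob C; z \<in> Ob C; f \<in> Hom C x y; g \<in> Hom C y z\<rbrakk>
        \<Longrightarrow> Cmp C x y z g f \<in> Hom C x z"
    and cmp_idn_right: "\<lbrakk>x \<in> Ob C; y \<in> Ob C; f \<in> Hom C x y\<rbrakk> \<Longrightarrow> Cmp C x x y f (Idn C x) = f"
    and cmp_idn_left: "\<lbrakk>x \<in> Ob C; y \<in> Ob C; f \<in> Hom C x y\<rbrakk> \<Longrightarrow> Cmp C x y y (Idn C y) f = f"
    and cmp_assoc: "\<lbrakk>w \<in> Ob C; x \<in> Ob C; y \<in> Ob C; z \<in> Ob C;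
          f \<in> Hom C w x; g \<in> Hom C x y; h \<in> Hom C y z\<rbrakk>
        \<Longrightarrow> Cmp C w x z (Cmp C x y z h g) f = Cmp C w y z h (Cmp C w x y g f)"

definition op_category :: "('x, 'm) category_data \<Rightarrow> ('x, 'm) category_data" where
  "op_category C = \<lparr>Ob = Ob C, Hom = (\<lambda>x y. Hom C y x), Idn = Idn C,
     Cmp = (\<lambda>x y z g f. Cmp C z y x f g)\<rparr>"

record ('x, 'm, 'y, 'n) functor_data =
  FOb  :: "'x \<Rightarrow> 'y"
  FHom :: "'x \<Rightarrow> 'x \<Rightarrow> 'm \<Rightarrow> 'n"

locale category_functor = dom: category C + cod: category D
  for C :: "('x, 'm) category_data" and D :: "('y, 'n) category_data" +
  fixes F :: "('x, 'm, 'y, 'n) functor_data"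
  assumes ob: "x \<in> Ob C \<Longrightarrow> FOb F x \<in> Ob D"
    and hom: "\<lbrakk>x \<in> Ob C; y \<in> Ob C; f \<in> Hom C x y\<rbrakk> \<Longrightarrow> FHom F x y f \<in> Hom D (FOb F x) (FOb F y)"
    and idn: "x \<in> Ob C \<Longrightarrow> FHom F x x (Idn C x) = Idn D (FOb F x)"
    and cmp: "\<lbrakk>x \<in> Ob C; y \<in> Ob C; z \<in> Ob C; f \<in> Hom C x y; g \<in> Hom C y z\<rbrakk>
        \<Longrightarrow> FHom F x z (Cmp C x y z g f)
            = Cmp D (FOb F x) (FOb F y) (FOb F z) (FHom F y z g) (FHom F x y f)"

definition functor_comp ::
  "('y, 'n, 'z, 'k) functor_data \<Rightarrow> ('x, 'm, 'y, 'n) functor_data \<Rightarrow> ('x, 'm, 'z, 'k) functor_data"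
  where
  "functor_comp G F = \<lparr>FOb = (\<lambda>x. FOb G (FOb F x)),
     FHom = (\<lambda>x y f. FHom G (FOb F x) (FOb F y) (FHom F x y f))\<rparr>"

definition op_functor :: "('x, 'm, 'y, 'n) functor_data \<Rightarrow> ('x, 'm, 'y, 'n) functor_data" where
  "op_functor F = \<lparr>FOb = FOb F, FHom = (\<lambda>x y. FHom F y x)\<rparr>"

text \<open>Equality of functors with domain \<open>C\<close>.\<close>

definition functors_equal ::
  "('x, 'm) category_data \<Rightarrow> ('x, 'm, 'y, 'n) functor_data \<Rightarrow> ('x, 'm, 'y, 'n) functor_data \<Rightarrow> bool"
  where
  "functors_equal C F G \<longleftrightarrow>
     (\<forall>x\<in>Ob C. FOb F x = FOb G x) \<and>
     (\<forall>x\<in>Ob C. \<forall>y\<in>Ob C. \<forall>f\<in>Hom C x y. FHom F x y f = FHom G x y f)"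


section \<open>Virtual double categories\<close>

text \<open>A loose-cell \<open>p\<close> from \<open>A\<close> to \<open>B\<close> has \<open>lsrc p = A\<close> and \<open>ltgt p = B\<close>. A 2-cell has domain \<open>cdom\<close>
  (a list of loose-cells), codomain \<open>ccod\<close>, and left and right tight-cells \<open>cleft\<close>, \<open>cright\<close>.
  In \<open>ccomp X \<phi> h \<phi>s\<close> the 2-cell \<open>\<phi>\<close> is composed with the juxtaposition of \<open>\<phi>s\<close>; the tight-cell \<open>h\<close>
  is the left tight-cell of this juxtaposition, and it carries information only if \<open>\<phi>s\<close> is empty.\<close>

record ('o, 't, 'l, 'c) vdc_data =
  Obj    :: "'o set"
  Tight  :: "'t set"
  tdom   :: "'t \<Rightarrow> 'o"
  tcod   :: "'t \<Rightarrow> 'o"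
  tid    :: "'o \<Rightarrow> 't"
  tcomp  :: "'t \<Rightarrow> 't \<Rightarrow> 't" (infixl "\<cdot>\<index>" 75) \<comment> \<open>\<open>g \<cdot> f\<close> is the composite of \<open>f : A \<rightarrow> B\<close> and \<open>g : B \<rightarrow> C\<close>\<close>
  Loose  :: "'l set"
  lsrc   :: "'l \<Rightarrow> 'o"
  ltgt   :: "'l \<Rightarrow> 'o"
  Cell   :: "'c set"
  cdom   :: "'c \<Rightarrow> 'l list"
  ccod   :: "'c \<Rightarrow> 'l"
  cleft  :: "'c \<Rightarrow> 't"
  cright :: "'c \<Rightarrow> 't"
  cid    :: "'l \<Rightarrow> 'c"
  ccomp  :: "'c \<Rightarrow> 't \<Rightarrow> 'c list \<Rightarrow> 'c"

definition tight :: "('o, 't, 'l, 'c) vdc_data \<Rightarrow> 't \<Rightarrow> 'o \<Rightarrow> 'o \<Rightarrow> bool" where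
  "tight X f A B \<longleftrightarrow> f \<in> Tight X \<and> tdom X f = A \<and> tcod X f = B"

text \<open>\<open>loose_chain X A\<^sub>0 [p\<^sub>1, \<dots>, p\<^sub>n] A\<^sub>n\<close> for \<open>p\<^sub>i\<close> from \<open>A\<^sub>i\<close> to \<open>A\<^sub>i\<^sub>-\<^sub>1\<close>.\<close>

fun loose_chain :: "('o, 't, 'l, 'c) vdc_data \<Rightarrow> 'o \<Rightarrow> 'l list \<Rightarrow> 'o \<Rightarrow> bool" where
  "loose_chain X A [] A' \<longleftrightarrow> A \<in> Obj X \<and> A = A'"
| "loose_chain X A (p # ps) A' \<longleftrightarrow> p \<in> Loose X \<and> ltgt X p = A \<and> loose_chain X (lsrc X p) ps A'"

text \<open>\<open>cell_chain X h \<phi>s k\<close>: the 2-cells \<open>\<phi>s\<close> are juxtaposable, with outer tight-cells \<open>h\<close> and \<open>k\<close>.\<close>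

fun cell_chain :: "('o, 't, 'l, 'c) vdc_data \<Rightarrow> 't \<Rightarrow> 'c list \<Rightarrow> 't \<Rightarrow> bool" where
  "cell_chain X h [] k \<longleftrightarrow> h \<in> Tight X \<and> h = k"
| "cell_chain X h (\<phi> # \<phi>s) k \<longleftrightarrow> \<phi> \<in> Cell X \<and> cleft X \<phi> = h \<and> cell_chain X (cright X \<phi>) \<phi>s k"

text \<open>Composition of a chain \<open>[\<phi>\<^sub>1, \<dots>, \<phi>\<^sub>n]\<close> with chains \<open>\<psi>s\<^sub>1, \<dots>, \<psi>s\<^sub>n\<close>, the first of which starts
  at \<open>h\<close>; each chain starts where the previous one ends.\<close>

fun ccomps :: "('o, 't, 'l, 'c) vdc_data \<Rightarrow> 't \<Rightarrow> 'c list \<Rightarrow> 'c list list \<Rightarrow> 'c list" where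
  "ccomps X h (\<phi> # \<phi>s) (\<psi>s # \<psi>ss) =
     ccomp X \<phi> h \<psi>s # ccomps X (if \<psi>s = [] then h else cright X (last \<psi>s)) \<phi>s \<psi>ss"
| "ccomps X h _ _ = []"

definition is_cell :: "('o, 't, 'l, 'c) vdc_data \<Rightarrow> 'c \<Rightarrow> 't \<Rightarrow> 'l list \<Rightarrow> 'l \<Rightarrow> 't \<Rightarrow> bool" where
  "is_cell X \<phi> f ps q g \<longleftrightarrow>
     \<phi> \<in> Cell X \<and> cleft X \<phi> = f \<and> cdom X \<phi> = ps \<and> ccod X \<phi> = q \<and> cright X \<phi> = g"

locale virtual_double_category =
  fixes X :: "('o, 't, 'l, 'c) vdc_data" (structure)
  assumes tdom_obj: "f \<in> Tight X \<Longrightarrow> tdom X f \<in> Obj X"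
    and tcod_obj: "f \<in> Tight X \<Longrightarrow> tcod X f \<in> Obj X"
    and tid_tight: "A \<in> Obj X \<Longrightarrow> tight X (tid X A) A A"
    and tcomp_tight: "\<lbrakk>tight X f A B; tight X g B C\<rbrakk> \<Longrightarrow> tight X (g \<cdot> f) A C"
    and tcomp_tid_right: "tight X f A B \<Longrightarrow> f \<cdot> tid X A = f"
    and tcomp_tid_left: "tight X f A B \<Longrightarrow> tid X B \<cdot> f = f"
    and tcomp_assoc: "\<lbrakk>tight X f A B; tight X g B C; tight X h C D\<rbrakk> \<Longrightarrow> (h \<cdot> g) \<cdot> f = h \<cdot> (g \<cdot> f)"
    and lsrc_obj: "p \<in> Loose X \<Longrightarrow> lsrc X p \<in> Obj X"
    and ltgt_obj: "p \<in> Loose X \<Longrightarrow> ltgt X p \<in> Obj X"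
    and cell_frame: "\<phi> \<in> Cell X \<Longrightarrow>
          ccod X \<phi> \<in> Loose X \<and>
          loose_chain X (tdom X (cleft X \<phi>)) (cdom X \<phi>) (tdom X (cright X \<phi>)) \<and>
          cleft X \<phi> \<in> Tight X \<and> tcod X (cleft X \<phi>) = ltgt X (ccod X \<phi>) \<and>
          cright X \<phi> \<in> Tight X \<and> tcod X (cright X \<phi>) = lsrc X (ccod X \<phi>)"
    and cid_cell: "p \<in> Loose X \<Longrightarrow> is_cell X (cid X p) (tid X (ltgt X p)) [p] p (tid X (lsrc X p))"
    and ccomp_cell: "\<lbrakk>\<phi> \<in> Cell X; cell_chain X h \<phi>s k; tcod X h = tdom X (cleft X \<phi>);
          map (ccod X) \<phi>s = cdom X \<phi>\<rbrakk>
        \<Longrightarrow> is_cell X (ccomp X \<phi> h \<phi>s) (cleft X \<phi> \<cdot> h) (concat (map (cdom X) \<phi>s)) (ccod X \<phi>)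
              (cright X \<phi> \<cdot> k)"
    and ccomp_cid_left: "\<phi> \<in> Cell X \<Longrightarrow> ccomp X (cid X (ccod X \<phi>)) (cleft X \<phi>) [\<phi>] = \<phi>"
    and ccomp_cid_right: "\<phi> \<in> Cell X \<Longrightarrow>
          ccomp X \<phi> (tid X (tdom X (cleft X \<phi>))) (map (cid X) (cdom X \<phi>)) = \<phi>"
    and ccomp_assoc: "\<lbrakk>\<phi> \<in> Cell X; cell_chain X h \<phi>s k; tcod X h = tdom X (cleft X \<phi>);
          map (ccod X) \<phi>s = cdom X \<phi>;
          cell_chain X h' (concat \<psi>ss) k'; tcod X h' = tdom X h;
          list_all2 (\<lambda>\<phi>\<^sub>i \<psi>s. map (ccod X) \<psi>s = cdom X \<phi>\<^sub>i) \<phi>s \<psi>ss\<rbrakk>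
        \<Longrightarrow> ccomp X (ccomp X \<phi> h \<phi>s) h' (concat \<psi>ss) = ccomp X \<phi> (h \<cdot> h') (ccomps X h' \<phi>s \<psi>ss)"
begin

text \<open>2-cells whose tight-cells are identities.\<close>

definition globular :: "'c \<Rightarrow> 'l list \<Rightarrow> 'l \<Rightarrow> bool" where
  "globular \<phi> ps q \<longleftrightarrow> is_cell X \<phi> (tid X (ltgt X q)) ps q (tid X (lsrc X q))"

text \<open>The chain condition is implied by \<open>cdom X \<psi> = ps @ cdom X \<phi> @ rs\<close> unless \<open>cdom X \<phi>\<close> is empty; in
  that case it says that \<open>\<phi>\<close> lives on the object at which the domain of \<open>\<psi>\<close> is split.\<close>

definition opcartesian :: "'c \<Rightarrow> bool" where
  "opcartesian \<phi> \<longleftrightarrow>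
     globular \<phi> (cdom X \<phi>) (ccod X \<phi>) \<and>
     (\<forall>ps rs \<psi>. \<psi> \<in> Cell X \<and> cdom X \<psi> = ps @ cdom X \<phi> @ rs \<and>
        loose_chain X (tdom X (cleft X \<psi>)) (ps @ [ccod X \<phi>] @ rs) (tdom X (cright X \<psi>)) \<longrightarrow>
        (\<exists>!\<psi>'. is_cell X \<psi>' (cleft X \<psi>) (ps @ [ccod X \<phi>] @ rs) (ccod X \<psi>) (cright X \<psi>) \<and>
               \<psi> = ccomp X \<psi>' (tid X (tdom X (cleft X \<psi>))) (map (cid X) ps @ [\<phi>] @ map (cid X) rs)))"

text \<open>\<open>cartesian \<chi> q f g\<close>: \<open>\<chi>\<close> exhibits its domain as the restriction \<open>q(f,g)\<close>.\<close>

definition cartesian :: "'c \<Rightarrow> 'l \<Rightarrow> 't \<Rightarrow> 't \<Rightarrow> bool" where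
  "cartesian \<chi> q f g \<longleftrightarrow>
     (\<exists>p. is_cell X \<chi> f [p] q g \<and>
        (\<forall>\<psi> f' g'. tight X f' (tdom X f') (tdom X f) \<and> tight X g' (tdom X g') (tdom X g) \<and>
             is_cell X \<psi> (f \<cdot> f') (cdom X \<psi>) q (g \<cdot> g') \<longrightarrow>
             (\<exists>!\<phi>. is_cell X \<phi> f' (cdom X \<psi>) p g' \<and> \<psi> = ccomp X \<chi> f' [\<phi>])))"

end

locale virtual_equipment = virtual_double_category X
  for X :: "('o, 't, 'l, 'c) vdc_data" (structure) +
  assumes loose_identities:
      "A \<in> Obj X \<Longrightarrow> \<exists>\<upsilon>. \<upsilon> \<in> Cell X \<and> cdom X \<upsilon> = [] \<and> cleft X \<upsilon> = tid X A \<and> cright X \<upsilon> = tid X A \<and> opcartesian \<upsilon>"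
    and restrictions:
      "\<lbrakk>q \<in> Loose X; f \<in> Tight X; g \<in> Tight X; tcod X f = ltgt X q; tcod X g = lsrc X q\<rbrakk>
        \<Longrightarrow> \<exists>\<chi>. cartesian \<chi> q f g"
begin

section \<open>Calculus of virtual equipments\<close>

text \<open>\<open>\<phi> \<bullet> [\<phi>\<^sub>1, \<dots>, \<phi>\<^sub>n]\<close> is composition with a nonempty juxtaposition; composition of
  a nullary 2-cell with a tight-cell \<open>h\<close> is \<open>\<phi> \<lhd> h\<close>.\<close>

abbreviation vert (infixl "\<bullet>" 70) where
  "\<phi> \<bullet> \<phi>s \<equiv> ccomp X \<phi> (cleft X (hd \<phi>s)) \<phi>s"

abbreviation pre_tight (infixl "\<lhd>" 72) where
  "\<phi> \<lhd> h \<equiv> ccomp X \<phi> h []"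

text \<open>A choice of loose-identities \<open>A(1,1)\<close> with their opcartesian 2-cells, and
  of restrictions \<open>q(f,g)\<close> with their cartesian 2-cells.\<close>

definition unit_cell :: "'o \<Rightarrow> 'c" where
  "unit_cell A = (SOME \<upsilon>. \<upsilon> \<in> Cell X \<and> cdom X \<upsilon> = [] \<and> cleft X \<upsilon> = tid X A \<and> cright X \<upsilon> = tid X A \<and> opcartesian \<upsilon>)"

definition lid :: "'o \<Rightarrow> 'l" where
  "lid A = ccod X (unit_cell A)"

definition restr_cell :: "'l \<Rightarrow> 't \<Rightarrow> 't \<Rightarrow> 'c" where
  "restr_cell q f g = (SOME \<chi>. cartesian \<chi> q f g)"

definition restr :: "'l \<Rightarrow> 't \<Rightarrow> 't \<Rightarrow> 'l" where
  "restr q f g = hd (cdom X (restr_cell q f g))"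

text \<open>The factorisation of \<open>\<psi>\<close>, with tight-cells \<open>f \<cdot> f'\<close> and \<open>g \<cdot> g'\<close>, through \<open>restr_cell q f g\<close>.\<close>

definition lift :: "'l \<Rightarrow> 't \<Rightarrow> 't \<Rightarrow> 't \<Rightarrow> 't \<Rightarrow> 'c \<Rightarrow> 'c" where
  "lift q f g f' g' \<psi> =
     (THE \<phi>. is_cell X \<phi> f' (cdom X \<psi>) (restr q f g) g' \<and> \<psi> = ccomp X (restr_cell q f g) f' [\<phi>])"

text \<open>\<open>hom f g\<close> is \<open>E(f,g) = E(1,1)(f,g)\<close>, for \<open>f : D \<rightarrow> E\<close> and \<open>g : A \<rightarrow> E\<close>.\<close>

abbreviation hom_cell :: "'t \<Rightarrow> 't \<Rightarrow> 'c" where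
  "hom_cell f g \<equiv> restr_cell (lid (tcod X f)) f g"

abbreviation hom :: "'t \<Rightarrow> 't \<Rightarrow> 'l" where
  "hom f g \<equiv> restr (lid (tcod X f)) f g"

text \<open>The 2-cell into \<open>E(f,g)\<close> with identity tight-cells corresponding to a 2-cell \<open>\<psi>\<close> into \<open>E(1,1)\<close>
  with left \<open>f\<close> and right \<open>g\<close>.\<close>

definition hom_lift :: "'t \<Rightarrow> 't \<Rightarrow> 'c \<Rightarrow> 'c" where
  "hom_lift f g \<psi> = lift (lid (tcod X f)) f g (tid X (tdom X f)) (tid X (tdom X g)) \<psi>"

text \<open>The canonical 2-cell \<open>A(1,1), A(1,1) \<Rightarrow> A(1,1)\<close>, and, for \<open>f : A \<rightarrow> B\<close>, the canonical 2-cell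
  \<open>A(1,1) \<Rightarrow> B(1,1)\<close> with left and right \<open>f\<close>. Both are defined through the universal
  property of the loose-identity.\<close>

definition lid_mult :: "'o \<Rightarrow> 'c" where
  "lid_mult A = (THE \<mu>. globular \<mu> [lid A, lid A] (lid A) \<and>
     \<mu> \<bullet> [unit_cell A, cid X (lid A)] = cid X (lid A))"

definition lid_map :: "'t \<Rightarrow> 'c" where
  "lid_map f = (THE \<kappa>. is_cell X \<kappa> f [lid (tdom X f)] (lid (tcod X f)) f \<and>
     \<kappa> \<bullet> [unit_cell (tdom X f)] = unit_cell (tcod X f) \<lhd> f)"

subsection \<open>2-cells between tight-cells\<close>

text \<open>A 2-cell \<open>f \<Rightarrow> g\<close> between tight-cells \<open>A \<rightarrow> B\<close> is represented by a nullary 2-cell into \<open>B(1,1)\<close> with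
  left \<open>f\<close> and right \<open>g\<close>; by the universal property of the restriction \<open>B(f,g)\<close>, this is the
  same as a 2-cell \<open>() \<Rightarrow> B(f,g)\<close> (see \<open>bij_betw_tcell\<close> below).\<close>

definition tcell :: "'c \<Rightarrow> 't \<Rightarrow> 't \<Rightarrow> bool" where
  "tcell \<phi> f g \<longleftrightarrow> f \<in> Tight X \<and> g \<in> Tight X \<and> tdom X f = tdom X g \<and> tcod X f = tcod X g \<and>
     is_cell X \<phi> f [] (lid (tcod X f)) g"

definition tcell_id :: "'t \<Rightarrow> 'c" where
  "tcell_id f = unit_cell (tcod X f) \<lhd> f"

definition tcell_comp :: "'c \<Rightarrow> 'c \<Rightarrow> 'c" where
  "tcell_comp \<psi> \<phi> = lid_mult (tcod X (cleft X \<phi>)) \<bullet> [\<phi>, \<psi>]"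

text \<open>The whiskerings \<open>k\<phi>\<close> and \<open>\<phi>h\<close>.\<close>

definition whisker_left :: "'t \<Rightarrow> 'c \<Rightarrow> 'c" where
  "whisker_left k \<phi> = lid_map k \<bullet> [\<phi>]"

definition whisker_right :: "'c \<Rightarrow> 't \<Rightarrow> 'c" where
  "whisker_right \<phi> h = \<phi> \<lhd> h"

subsection \<open>2-cells between the loose-cells \<open>E(f,g)\<close>\<close>

text \<open>For \<open>\<phi> : f \<Rightarrow> f'\<close>, the 2-cell \<open>E(\<phi>,g) : E(f',g) \<Rightarrow> E(f,g)\<close>.\<close>

definition hom_pre :: "'c \<Rightarrow> 't \<Rightarrow> 'c" where
  "hom_pre \<phi> g = hom_lift (cleft X \<phi>) g
     (lid_mult (tcod X g) \<bullet> [\<phi>, hom_cell (cright X \<phi>) g])"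

text \<open>For \<open>\<phi> : g \<Rightarrow> g'\<close>, the 2-cell \<open>E(f,\<phi>) : E(f,g) \<Rightarrow> E(f,g')\<close>.\<close>

definition hom_post :: "'t \<Rightarrow> 'c \<Rightarrow> 'c" where
  "hom_post f \<phi> = hom_lift f (cright X \<phi>)
     (lid_mult (tcod X f) \<bullet> [hom_cell f (cleft X \<phi>), \<phi>])"

text \<open>\<open>\<frown>\<^sub>f : () \<Rightarrow> B(f,f)\<close>, \<open>\<smile>\<^sub>t(x,y) : D(x,t), D(t,y) \<Rightarrow> D(x,y)\<close>, and
  \<open>\<frown>\<^sub>c(x,y) : C(x,y) \<Rightarrow> C'(cx,cy)\<close>.\<close>

definition cap :: "'t \<Rightarrow> 'c" where
  "cap f = hom_lift f f (tcell_id f)"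

definition cup_at :: "'t \<Rightarrow> 't \<Rightarrow> 't \<Rightarrow> 'c" where
  "cup_at t x y = hom_lift x y (lid_mult (tcod X t) \<bullet> [hom_cell x t, hom_cell t y])"

definition cap_at :: "'t \<Rightarrow> 't \<Rightarrow> 't \<Rightarrow> 'c" where
  "cap_at c x y = hom_lift (c \<cdot> x) (c \<cdot> y) (lid_map c \<bullet> [hom_cell x y])"

text \<open>For \<open>\<phi> : E(a,b) \<Rightarrow> E'(a',b')\<close> with identity tight-cells, the 2-cell
  \<open>\<phi>(f,g) : E(af,bg) \<Rightarrow> E'(a'f,b'g)\<close>. The canonical isomorphisms \<open>E(a,b)(f,g) \<cong> E(af,bg)\<close> are
  built in: the inner \<open>lift\<close> is the cartesian 2-cell from \<open>E(af,bg)\<close> to \<open>E(a,b)\<close>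
  with left \<open>f\<close> and right \<open>g\<close>.\<close>

definition hom_restr :: "'c \<Rightarrow> 't \<Rightarrow> 't \<Rightarrow> 't \<Rightarrow> 't \<Rightarrow> 't \<Rightarrow> 't \<Rightarrow> 'c" where
  "hom_restr \<phi> a b a' b' f g =
     hom_lift (a' \<cdot> f) (b' \<cdot> g)
       (hom_cell a' b' \<bullet> [\<phi> \<bullet> [lift (lid (tcod X a)) a b f g (hom_cell (a \<cdot> f) (b \<cdot> g))]])"

subsection \<open>The chosen and canonical 2-cells are well-defined\<close>

lemma unit_cell_props:
  assumes "A \<in> Obj X"
  shows "is_cell X (unit_cell A) (tid X A) [] (lid A) (tid X A)" "opcartesian (unit_cell A)"
    "lid A \<in> Loose X" "ltgt X (lid A) = A" "lsrc X (lid A) = A"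
proof -
  have *: "unit_cell A \<in> Cell X \<and> cdom X (unit_cell A) = [] \<and> cleft X (unit_cell A) = tid X A \<and>
      cright X (unit_cell A) = tid X A \<and> opcartesian (unit_cell A)"
    unfolding unit_cell_def by (rule someI_ex[OF loose_identities[OF assms]])
  then show "is_cell X (unit_cell A) (tid X A) [] (lid A) (tid X A)" "opcartesian (unit_cell A)"
    by (auto simp: is_cell_def lid_def)
  from * cell_frame[of "unit_cell A"] tid_tight[OF assms]
  show "lid A \<in> Loose X" "ltgt X (lid A) = A" "lsrc X (lid A) = A"
    by (auto simp: lid_def tight_def)
qed

lemma hom_cell_props:
  assumes "f \<in> Tight X" "g \<in> Tight X" "tcod X f = tcod X g"
  shows "is_cell X (hom_cell f g) f [hom f g] (lid (tcod X f)) g"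
    "cartesian (hom_cell f g) (lid (tcod X f)) f g"
    "hom f g \<in> Loose X" "ltgt X (hom f g) = tdom X f" "lsrc X (hom f g) = tdom X g"
proof -
  note u = unit_cell_props[OF tcod_obj[OF assms(1)]]
  have "\<exists>\<chi>. cartesian \<chi> (lid (tcod X f)) f g"
    by (rule restrictions) (use u assms in auto)
  then show c: "cartesian (hom_cell f g) (lid (tcod X f)) f g"
    unfolding restr_cell_def by (rule someI_ex)
  then obtain p where p: "is_cell X (hom_cell f g) f [p] (lid (tcod X f)) g"
    by (auto simp: cartesian_def)
  then show "is_cell X (hom_cell f g) f [hom f g] (lid (tcod X f)) g"
    by (auto simp: restr_def is_cell_def)
  with cell_frame[of "hom_cell f g"]
  show "hom f g \<in> Loose X" "ltgt X (hom f g) = tdom X f" "lsrc X (hom f g) = tdom X g"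
    by (auto simp: is_cell_def)
qed

lemma hom_lift_props:
  assumes "f \<in> Tight X" "g \<in> Tight X" "tcod X f = tcod X g"
    and "is_cell X \<psi> f ps (lid (tcod X f)) g"
  shows "globular (hom_lift f g \<psi>) ps (hom f g)" "hom_cell f g \<bullet> [hom_lift f g \<psi>] = \<psi>"
    "globular \<phi> ps (hom f g) \<Longrightarrow> hom_cell f g \<bullet> [\<phi>] = \<psi> \<Longrightarrow> \<phi> = hom_lift f g \<psi>"
proof -
  note h = hom_cell_props[OF assms(1-3)]
  let ?P = "\<lambda>\<phi>. is_cell X \<phi> (tid X (tdom X f)) (cdom X \<psi>) (hom f g) (tid X (tdom X g))
     \<and> \<psi> = ccomp X (hom_cell f g) (tid X (tdom X f)) [\<phi>]"
  from h(2) obtain p where p: "is_cell X (hom_cell f g) f [p] (lid (tcod X f)) g"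
    and u: "\<And>\<psi> f' g'. \<lbrakk>tight X f' (tdom X f') (tdom X f); tight X g' (tdom X g') (tdom X g);
             is_cell X \<psi> (f \<cdot> f') (cdom X \<psi>) (lid (tcod X f)) (g \<cdot> g')\<rbrakk> \<Longrightarrow>
             (\<exists>!\<phi>. is_cell X \<phi> f' (cdom X \<psi>) p g' \<and> \<psi> = ccomp X (hom_cell f g) f' [\<phi>])"
    unfolding cartesian_def by metis
  have pe: "p = hom f g" using p h(1) by (simp add: is_cell_def)
  have t: "tight X (tid X (tdom X f)) (tdom X f) (tdom X f)" "tight X (tid X (tdom X g)) (tdom X g) (tdom X g)"
    using assms tid_tight tdom_obj by auto
  have e: "\<exists>!\<phi>. ?P \<phi>" unfolding pe[symmetric]
    by (rule u) (use t assms tcomp_tid_right[of f] tcomp_tid_right[of g] in \<open>auto simp: tight_def is_cell_def\<close>)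
  have "?P (THE \<phi>. ?P \<phi>)" by (rule theI'[OF e])
  then have l: "?P (hom_lift f g \<psi>)" unfolding hom_lift_def lift_def .
  then show "globular (hom_lift f g \<psi>) ps (hom f g)" "hom_cell f g \<bullet> [hom_lift f g \<psi>] = \<psi>"
    using assms h by (auto simp: globular_def is_cell_def)
  show "\<phi> = hom_lift f g \<psi>" if "globular \<phi> ps (hom f g)" "hom_cell f g \<bullet> [\<phi>] = \<psi>"
    using e l that assms(4) h by (auto simp: globular_def is_cell_def)
qed

lemma bij_betw_tcell:
  assumes "f \<in> Tight X" "g \<in> Tight X" "tdom X f = tdom X g" "tcod X f = tcod X g"
  shows "bij_betw (hom_lift f g) {\<phi>. tcell \<phi> f g} {\<psi>. globular \<psi> [] (hom f g)}"
proof (rule bij_betw_byWitness[where f' = "\<lambda>\<psi>. hom_cell f g \<bullet> [\<psi>]"])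
  note h = hom_cell_props[OF assms(1,2,4)] and l = hom_lift_props[OF assms(1,2,4)]
  show "\<forall>\<phi>\<in>{\<phi>. tcell \<phi> f g}. hom_cell f g \<bullet> [hom_lift f g \<phi>] = \<phi>"
    using l(2) by (auto simp: tcell_def)
  have c: "is_cell X (hom_cell f g \<bullet> [\<psi>]) f [] (lid (tcod X f)) g" if "globular \<psi> [] (hom f g)" for \<psi>
    using ccomp_cell[of "hom_cell f g" "cleft X \<psi>" "[\<psi>]" "cright X \<psi>"] that h
      cell_frame[of \<psi>] tcomp_tid_right[of f] tcomp_tid_right[of g] assms(1,2)
    by (auto simp: is_cell_def globular_def tight_def)
  show "\<forall>\<psi>\<in>{\<psi>. globular \<psi> [] (hom f g)}. hom_lift f g (hom_cell f g \<bullet> [\<psi>]) = \<psi>"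
    using l(3)[OF c] by fastforce
  show "hom_lift f g ` {\<phi>. tcell \<phi> f g} \<subseteq> {\<psi>. globular \<psi> [] (hom f g)}"
    using l(1) by (auto simp: tcell_def)
  show "(\<lambda>\<psi>. hom_cell f g \<bullet> [\<psi>]) ` {\<psi>. globular \<psi> [] (hom f g)} \<subseteq> {\<phi>. tcell \<phi> f g}"
    using c assms by (auto simp: tcell_def)
qed

lemma lid_mult_props:
  assumes A: "A \<in> Obj X"
  shows "globular (lid_mult A) [lid A, lid A] (lid A)"
    "lid_mult A \<bullet> [unit_cell A, cid X (lid A)] = cid X (lid A)"
proof -
  note u = unit_cell_props[OF A]
  let ?P = "\<lambda>\<mu>. globular \<mu> [lid A, lid A] (lid A) \<and> \<mu> \<bullet> [unit_cell A, cid X (lid A)] = cid X (lid A)"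
  have ci: "is_cell X (cid X (lid A)) (tid X A) [lid A] (lid A) (tid X A)"
    using cid_cell[OF u(3)] u by simp
  have t: "tdom X (tid X A) = A" using tid_tight[OF A] by (simp add: tight_def)
  note op = u(2)[unfolded opcartesian_def, THEN conjunct2]
  have "\<exists>!\<psi>'. is_cell X \<psi>' (cleft X (cid X (lid A))) ([] @ [ccod X (unit_cell A)] @ [lid A]) (ccod X (cid X (lid A))) (cright X (cid X (lid A))) \<and>
               cid X (lid A) = ccomp X \<psi>' (tid X (tdom X (cleft X (cid X (lid A))))) (map (cid X) [] @ [unit_cell A] @ map (cid X) [lid A])"
  proof (rule op[rule_format])
    show "cid X (lid A) \<in> Cell X \<and> cdom X (cid X (lid A)) = [] @ cdom X (unit_cell A) @ [lid A] \<and>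
        loose_chain X (tdom X (cleft X (cid X (lid A)))) ([] @ [ccod X (unit_cell A)] @ [lid A])
          (tdom X (cright X (cid X (lid A))))"
      using ci u A t by (simp add: is_cell_def)
  qed
  then have e: "\<exists>!\<mu>. ?P \<mu>"
    using ci u(1,4,5) t by (simp add: globular_def is_cell_def eq_commute[of "cid X (lid A)"])
  have "?P (THE \<mu>. ?P \<mu>)" by (rule theI'[OF e])
  then show "globular (lid_mult A) [lid A, lid A] (lid A)"
    "lid_mult A \<bullet> [unit_cell A, cid X (lid A)] = cid X (lid A)"
    unfolding lid_mult_def by auto
qed

lemma lid_map_props:
  assumes f: "f \<in> Tight X"
  shows "is_cell X (lid_map f) f [lid (tdom X f)] (lid (tcod X f)) f"
    "lid_map f \<bullet> [unit_cell (tdom X f)] = unit_cell (tcod X f) \<lhd> f"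
proof -
  let ?A = "tdom X f" and ?B = "tcod X f"
  have A: "?A \<in> Obj X" and B: "?B \<in> Obj X" using f tdom_obj tcod_obj by auto
  note u = unit_cell_props[OF A] and v = unit_cell_props[OF B]
  let ?P = "\<lambda>\<kappa>. is_cell X \<kappa> f [lid ?A] (lid ?B) f \<and> \<kappa> \<bullet> [unit_cell ?A] = unit_cell ?B \<lhd> f"
  have c: "is_cell X (unit_cell ?B \<lhd> f) f [] (lid ?B) f"
    using ccomp_cell[of "unit_cell ?B" f "[]" f] v f tid_tight[OF B] tcomp_tid_left[of f]
    by (auto simp: is_cell_def tight_def)
  note op = u(2)[unfolded opcartesian_def, THEN conjunct2]
  have "\<exists>!\<psi>'. is_cell X \<psi>' (cleft X (unit_cell ?B \<lhd> f)) ([] @ [ccod X (unit_cell ?A)] @ []) (ccod X (unit_cell ?B \<lhd> f)) (cright X (unit_cell ?B \<lhd> f)) \<and>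
               unit_cell ?B \<lhd> f = ccomp X \<psi>' (tid X (tdom X (cleft X (unit_cell ?B \<lhd> f)))) (map (cid X) [] @ [unit_cell ?A] @ map (cid X) [])"
  proof (rule op[rule_format])
    show "unit_cell ?B \<lhd> f \<in> Cell X \<and> cdom X (unit_cell ?B \<lhd> f) = [] @ cdom X (unit_cell ?A) @ [] \<and>
        loose_chain X (tdom X (cleft X (unit_cell ?B \<lhd> f))) ([] @ [ccod X (unit_cell ?A)] @ [])
          (tdom X (cright X (unit_cell ?B \<lhd> f)))"
      using c u A by (simp add: is_cell_def)
  qed
  then have e: "\<exists>!\<mu>. ?P \<mu>"
    using c u(1) by (simp add: is_cell_def eq_commute[of "unit_cell ?B \<lhd> f"])
  have "?P (THE \<mu>. ?P \<mu>)" by (rule theI'[OF e])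
  then show "is_cell X (lid_map f) f [lid (tdom X f)] (lid (tcod X f)) f"
    "lid_map f \<bullet> [unit_cell (tdom X f)] = unit_cell (tcod X f) \<lhd> f"
    unfolding lid_map_def by auto
qed

end


section \<open>Relative monads\<close>

record ('t, 'c) rmonad =
  carrier :: 't
  extension :: 'c
  runit :: 'c

record ('t, 'c) radjunction =
  ladj :: 't
  radj :: 't
  sharp :: 'c
  flat :: 'c

context virtual_equipment
begin

definition relative_monad :: "'t \<Rightarrow> ('t, 'c) rmonad \<Rightarrow> bool" where
  "relative_monad j T \<longleftrightarrow>
     j \<in> Tight X \<and> tight X (carrier T) (tdom X j) (tcod X j) \<and>
     globular (extension T) [hom j (carrier T)] (hom (carrier T) (carrier T)) \<and>
     tcell (runit T) j (carrier T) \<and>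
     hom_pre (runit T) (carrier T) \<bullet> [extension T] = cid X (hom j (carrier T)) \<and>
     extension T \<bullet> [hom_post j (runit T) \<bullet> [cap j]] = cap (carrier T) \<and>
     cup_at (carrier T) (carrier T) (carrier T) \<bullet> [extension T, extension T]
       = extension T \<bullet> [cup_at (carrier T) j (carrier T) \<bullet>
           [cid X (hom j (carrier T)), extension T]]"

definition rmonad_morphism :: "'t \<Rightarrow> ('t, 'c) rmonad \<Rightarrow> ('t, 'c) rmonad \<Rightarrow> 'c \<Rightarrow> bool" where
  "rmonad_morphism j T T' \<tau> \<longleftrightarrow>
     tcell \<tau> (carrier T) (carrier T') \<and>
     tcell_comp \<tau> (runit T) = runit T' \<and>
     hom_post (carrier T) \<tau> \<bullet> [extension T]
       = hom_pre \<tau> (carrier T') \<bullet> [extension T' \<bullet> [hom_post j \<tau>]]"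

definition RMnd :: "'t \<Rightarrow> (('t, 'c) rmonad, 'c) category_data" where
  "RMnd j = \<lparr>Ob = {T. relative_monad j T},
     Hom = (\<lambda>T T'. {\<tau>. rmonad_morphism j T T' \<tau>}),
     Idn = (\<lambda>T. tcell_id (carrier T)),
     Cmp = (\<lambda>_ _ _ \<sigma> \<tau>. tcell_comp \<sigma> \<tau>)\<rparr>"


section \<open>Relative adjunctions\<close>

text \<open>\<open>relative_adjunction j a\<close>: the data \<open>a\<close> form a \<open>j\<close>-relative adjunction \<open>\<ell> \<stileturn>\<^sub>j r\<close>, where
  \<open>sharp a : C(\<ell>,1) \<cong> D(j,r) : flat a\<close>.\<close>

definition relative_adjunction :: "'t \<Rightarrow> ('t, 'c) radjunction \<Rightarrow> bool" where
  "relative_adjunction j a \<longleftrightarrow>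
     (let C = tcod X (ladj a); h = hom (ladj a) (tid X C); k = hom j (radj a) in
      j \<in> Tight X \<and> tight X (ladj a) (tdom X j) C \<and> tight X (radj a) C (tcod X j) \<and>
      globular (sharp a) [h] k \<and> globular (flat a) [k] h \<and>
      flat a \<bullet> [sharp a] = cid X h \<and> sharp a \<bullet> [flat a] = cid X k)"

text \<open>\<open>\<sharp>(f,g) : C(\<ell>f,g) \<Rightarrow> D(jf,rg)\<close> and its inverse \<open>\<flat>(f,g)\<close>.\<close>

definition sharp_at :: "'t \<Rightarrow> ('t, 'c) radjunction \<Rightarrow> 't \<Rightarrow> 't \<Rightarrow> 'c" where
  "sharp_at j a f g = hom_restr (sharp a) (ladj a) (tid X (tcod X (ladj a))) j (radj a) f g"

definition flat_at :: "'t \<Rightarrow> ('t, 'c) radjunction \<Rightarrow> 't \<Rightarrow> 't \<Rightarrow> 'c" where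
  "flat_at j a f g = hom_restr (flat a) j (radj a) (ladj a) (tid X (tcod X (ladj a))) f g"

definition left_morphism ::
  "'t \<Rightarrow> ('t, 'c) radjunction \<Rightarrow> ('t, 'c) radjunction \<Rightarrow> 't \<times> 'c \<Rightarrow> bool" where
  "left_morphism j a\<^sub>1 a\<^sub>2 = (\<lambda>(c, \<alpha>).
     tight X c (tcod X (ladj a\<^sub>1)) (tcod X (ladj a\<^sub>2)) \<and> tcell \<alpha> (ladj a\<^sub>2) (c \<cdot> ladj a\<^sub>1) \<and>
     radj a\<^sub>1 = radj a\<^sub>2 \<cdot> c \<and>
     sharp a\<^sub>1 = sharp_at j a\<^sub>2 (tid X (tdom X j)) c \<bullet>
       [hom_pre \<alpha> c \<bullet> [cap_at c (ladj a\<^sub>1) (tid X (tcod X (ladj a\<^sub>1)))]])"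

definition right_morphism ::
  "'t \<Rightarrow> ('t, 'c) radjunction \<Rightarrow> ('t, 'c) radjunction \<Rightarrow> 't \<times> 'c \<Rightarrow> bool" where
  "right_morphism j a\<^sub>1 a\<^sub>2 = (\<lambda>(c, \<rho>).
     tight X c (tcod X (ladj a\<^sub>1)) (tcod X (ladj a\<^sub>2)) \<and> tcell \<rho> (radj a\<^sub>1) (radj a\<^sub>2 \<cdot> c) \<and>
     c \<cdot> ladj a\<^sub>1 = ladj a\<^sub>2 \<and>
     hom_post j \<rho> \<bullet> [sharp a\<^sub>1] = sharp_at j a\<^sub>2 (tid X (tdom X j)) c \<bullet>
       [cap_at c (ladj a\<^sub>1) (tid X (tcod X (ladj a\<^sub>1)))])"

definition RAdj_L :: "'t \<Rightarrow> (('t, 'c) radjunction, 't \<times> 'c) category_data" where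
  "RAdj_L j = \<lparr>Ob = {a. relative_adjunction j a},
     Hom = (\<lambda>a\<^sub>1 a\<^sub>2. {m. left_morphism j a\<^sub>1 a\<^sub>2 m}),
     Idn = (\<lambda>a. (tid X (tcod X (ladj a)), tcell_id (ladj a))),
     Cmp = (\<lambda>_ _ _ (c', \<alpha>') (c, \<alpha>). (c' \<cdot> c, tcell_comp (whisker_left c' \<alpha>) \<alpha>'))\<rparr>"

definition RAdj_R :: "'t \<Rightarrow> (('t, 'c) radjunction, 't \<times> 'c) category_data" where
  "RAdj_R j = \<lparr>Ob = {a. relative_adjunction j a},
     Hom = (\<lambda>a\<^sub>1 a\<^sub>2. {m. right_morphism j a\<^sub>1 a\<^sub>2 m}),
     Idn = (\<lambda>a. (tid X (tcod X (ladj a)), tcell_id (radj a))),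
     Cmp = (\<lambda>_ _ _ (c', \<rho>') (c, \<rho>). (c' \<cdot> c, tcell_comp (whisker_right \<rho>' c) \<rho>))\<rparr>"

subsection \<open>Induced relative monads\<close>

definition induced_rmonad :: "'t \<Rightarrow> ('t, 'c) radjunction \<Rightarrow> ('t, 'c) rmonad" where
  "induced_rmonad j a =
     (let B = tdom X j; l = ladj a; r = radj a in
      \<lparr>carrier = r \<cdot> l,
       extension = cap_at r l l \<bullet> [flat_at j a (tid X B) l],
       runit = hom_cell j (r \<cdot> l) \<bullet> [sharp_at j a (tid X B) l \<bullet> [cap l]]\<rparr>)"

definition Lambda_L ::
  "'t \<Rightarrow> (('t, 'c) radjunction, 't \<times> 'c, ('t, 'c) rmonad, 'c) functor_data" where
  "Lambda_L j = \<lparr>FOb = induced_rmonad j,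
     FHom = (\<lambda>a\<^sub>2 a\<^sub>1 (c, \<alpha>). whisker_left (radj a\<^sub>2) \<alpha>)\<rparr>" \<comment> \<open>for \<open>(c, \<alpha>)\<close> from \<open>a\<^sub>1\<close> to \<open>a\<^sub>2\<close>, as the domain is \<open>op_category (RAdj_L j)\<close>\<close>

definition Lambda_R ::
  "'t \<Rightarrow> (('t, 'c) radjunction, 't \<times> 'c, ('t, 'c) rmonad, 'c) functor_data" where
  "Lambda_R j = \<lparr>FOb = induced_rmonad j,
     FHom = (\<lambda>a\<^sub>1 a\<^sub>2 (c, \<rho>). whisker_right \<rho> (ladj a\<^sub>1))\<rparr>"

subsection \<open>Composition of relative adjunctions\<close>

text \<open>For a relative adjunction \<open>a'\<close> given by \<open>j\<ell>' \<stileturn>\<^sub>j\<^sub>' r'\<close> and \<open>a\<close> given by \<open>\<ell> \<stileturn>\<^sub>j r\<close>.\<close>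

definition radj_comp ::
  "'t \<Rightarrow> 't \<Rightarrow> 't \<Rightarrow> ('t, 'c) radjunction \<Rightarrow> ('t, 'c) radjunction \<Rightarrow> ('t, 'c) radjunction" where
  "radj_comp j l' j' a' a =
     (let A = tdom X j'; C = tcod X (ladj a) in
      \<lparr>ladj = ladj a \<cdot> l',
       radj = radj a' \<cdot> radj a,
       sharp = sharp_at j' a' (tid X A) (radj a) \<bullet> [sharp_at j a l' (tid X C)],
       flat = flat_at j a l' (tid X C) \<bullet> [flat_at j' a' (tid X A) (radj a)]\<rparr>)"

definition radj_comp_L :: "'t \<Rightarrow> 't \<Rightarrow> 't \<Rightarrow> ('t, 'c) radjunction \<Rightarrow>
    (('t, 'c) radjunction, 't \<times> 'c, ('t, 'c) radjunction, 't \<times> 'c) functor_data" where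
  "radj_comp_L j l' j' a' = \<lparr>FOb = radj_comp j l' j' a',
     FHom = (\<lambda>_ _ (c, \<alpha>). (c, whisker_right \<alpha> l'))\<rparr>"

definition radj_comp_R :: "'t \<Rightarrow> 't \<Rightarrow> 't \<Rightarrow> ('t, 'c) radjunction \<Rightarrow>
    (('t, 'c) radjunction, 't \<times> 'c, ('t, 'c) radjunction, 't \<times> 'c) functor_data" where
  "radj_comp_R j l' j' a' = \<lparr>FOb = radj_comp j l' j' a',
     FHom = (\<lambda>_ _ (c, \<rho>). (c, whisker_left (radj a') \<rho>))\<rparr>"

end

end

theory Submission
  imports Defs
begin

text \<open>
  A 2-cell into \<open>E(f,g)\<close> is the same as an element: a 2-cell into \<open>E(1,1)\<close> with left \<open>f\<close> and
  right \<open>g\<close>. Elements compose associatively, so that by the universal properties of restrictions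
  and loose-identities all structure can be described by operations on elements. An extension
  operator becomes \<open>\<alpha> \<mapsto> \<alpha>\<^sup>\<dagger>\<close>, taking \<open>jx \<rightarrow> ty\<close> to \<open>tx \<rightarrow> ty\<close>, with \<open>\<eta> \<star> \<alpha>\<^sup>\<dagger> = \<alpha>\<close>, \<open>\<eta>\<^sup>\<dagger> = 1\<close>
  and \<open>\<alpha>\<^sup>\<dagger> \<star> \<beta>\<^sup>\<dagger> = (\<alpha> \<star> \<beta>\<^sup>\<dagger>)\<^sup>\<dagger>\<close>, where \<open>\<star>\<close> is composition in diagrammatic order. An adjunction
  becomes a bijection \<open>\<sharp> : (\<ell>x \<rightarrow> y) \<cong> (jx \<rightarrow> ry) : \<flat>\<close> with \<open>\<sharp>(\<alpha> \<star> \<gamma>) = \<sharp>\<alpha> \<star> r\<gamma>\<close>. The transported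
  monad on \<open>r't\<ell>'\<close> has the unit \<open>\<sharp>'(\<eta>\<ell>')\<close> and the extension operator \<open>\<beta> \<mapsto> r'((\<flat>'\<beta>)\<^sup>\<dagger>)\<close>, and every
  claim is a short computation with these equations.
\<close>

section \<open>Juxtaposition and composition\<close>

text \<open>The formulas for the transported monad come from the case in which \<open>T\<close> is
  induced by \<ell> \<stileturn> r: the composite adjunction has the unit \<sharp>'(\<sharp>(1)) and
  the operator \<beta> \<mapsto> r'r\<flat>\<flat>'\<beta>, and replacing \<sharp>(1) by
  \<eta>\<ell>' and r\<flat> by the extension operator leaves only data of \<open>T\<close>. No
  adjunction inducing \<open>T\<close> is assumed to exist, so the laws have to be verified
  directly. Elements are taken at arbitrary stages because 2-cells between tight-cells, the elements
  at the empty stage, do not determine a 2-cell out of D(j,t). At the stage [D(j,t)] there is a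
  generic element, the cartesian 2-cell \<open>hom_cell j t\<close>, and each law of the definitions
  is an equation about generic elements. Laws for all elements follow by substitution, which
  commutes with factorisation through cartesian 2-cells because such factorisations are unique. The
  remaining coherence, such as associativity and naturality, concerns 2-cells out of
  loose-identities and is checked on the unit.\<close>

context virtual_double_category
begin

lemma tid_simps [simp]:
  assumes "A \<in> Obj X"
  shows "tid X A \<in> Tight X" "tdom X (tid X A) = A" "tcod X (tid X A) = A"
  using tid_tight[OF assms] by (auto simp: tight_def)

lemma tcomp_simps [simp]:
  assumes "f \<in> Tight X" "g \<in> Tight X" "tcod X f = tdom X g"
  shows "g \<cdot> f \<in> Tight X" "tdom X (g \<cdot> f) = tdom X f" "tcod X (g \<cdot> f) = tcod X g"
  using tcomp_tight[of f "tdom X f" "tcod X f" g "tcod X g"] assms by (auto simp: tight_def)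

lemma tcomp_tid [simp]:
  assumes "f \<in> Tight X"
  shows "tdom X f = A \<Longrightarrow> f \<cdot> tid X A = f" "tcod X f = A \<Longrightarrow> tid X A \<cdot> f = f"
  using tcomp_tid_right[of f "tdom X f" "tcod X f"] tcomp_tid_left[of f "tdom X f" "tcod X f"] assms
  by (auto simp: tight_def)

lemma tcomp_assoc':
  assumes "f \<in> Tight X" "g \<in> Tight X" "h \<in> Tight X" "tcod X f = tdom X g" "tcod X g = tdom X h"
  shows "(h \<cdot> g) \<cdot> f = h \<cdot> (g \<cdot> f)"
  using tcomp_assoc[of f "tdom X f" "tcod X f" g "tcod X g" h "tcod X h"] assms
  by (auto simp: tight_def)

lemma tdom_tcod_obj [simp]: "f \<in> Tight X \<Longrightarrow> tdom X f \<in> Obj X" "f \<in> Tight X \<Longrightarrow> tcod X f \<in> Obj X"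
  using tdom_obj tcod_obj by auto

lemma is_cell_frame:
  assumes "is_cell X \<phi> f ps q g"
  shows "f \<in> Tight X" "g \<in> Tight X" "tcod X f = ltgt X q" "tcod X g = lsrc X q" "q \<in> Loose X"
    "loose_chain X (tdom X f) ps (tdom X g)"
  using cell_frame[of \<phi>] assms by (auto simp: is_cell_def)

lemma is_cell_simps:
  assumes "is_cell X \<phi> f ps q g"
  shows "\<phi> \<in> Cell X" "cleft X \<phi> = f" "cright X \<phi> = g" "cdom X \<phi> = ps" "ccod X \<phi> = q"
  using assms by (auto simp: is_cell_def)

text \<open>The frame of a juxtaposition. Both outer tight-cells are recorded because the empty
  juxtaposition is a single tight-cell, which the list alone does not show.\<close>

definition chain :: "'t \<Rightarrow> 'c list \<Rightarrow> 't \<Rightarrow> 'l list \<Rightarrow> 'l list \<Rightarrow> bool" where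
  "chain h \<phi>s k ps qs \<longleftrightarrow>
     cell_chain X h \<phi>s k \<and> map (ccod X) \<phi>s = ps \<and> concat (map (cdom X) \<phi>s) = qs"

lemma cell_chain_append:
  "cell_chain X h (\<phi>s @ \<psi>s) k \<longleftrightarrow> (\<exists>m. cell_chain X h \<phi>s m \<and> cell_chain X m \<psi>s k)"
proof (induction \<phi>s arbitrary: h)
  case Nil
  then show ?case
    by (cases \<psi>s) (use cell_frame in \<open>auto\<close>)
qed auto

lemma cell_chain_tight: "cell_chain X h \<phi>s k \<Longrightarrow> h \<in> Tight X \<and> k \<in> Tight X"
  by (induction \<phi>s arbitrary: h) (use cell_frame in auto)

lemma chain_tight: "chain h \<phi>s k ps qs \<Longrightarrow> h \<in> Tight X" "chain h \<phi>s k ps qs \<Longrightarrow> k \<in> Tight X"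
  using cell_chain_tight by (auto simp: chain_def)

lemma cell_chain_last:
  "cell_chain X h \<phi>s k \<Longrightarrow> (if \<phi>s = [] then h else cright X (last \<phi>s)) = k"
  by (induction \<phi>s arbitrary: h) (auto split: if_splits)

lemma chain_Nil: "h \<in> Tight X \<Longrightarrow> chain h [] h [] []"
  by (simp add: chain_def)

lemma chain_single: "is_cell X \<phi> h ps p k \<Longrightarrow> chain h [\<phi>] k [p] ps"
  using is_cell_frame[of \<phi> h ps p k] by (auto simp: chain_def is_cell_def)

lemma chain_append:
  "chain h \<phi>s m ps qs \<Longrightarrow> chain m \<psi>s k rs ss \<Longrightarrow> chain h (\<phi>s @ \<psi>s) k (ps @ rs) (qs @ ss)"
  by (auto simp: chain_def cell_chain_append)

lemma chain_pair:
  "is_cell X \<phi> h ps p m \<Longrightarrow> is_cell X \<psi> m qs q k \<Longrightarrow> chain h [\<phi>, \<psi>] k [p, q] (ps @ qs)"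
  using chain_append[OF chain_single chain_single] by fastforce

lemma chain_tcod:
  assumes "chain h \<phi>s k ps qs" "loose_chain X A ps A'" "tcod X h = A"
  shows "tcod X k = A'"
proof -
  have "cell_chain X h \<phi>s k \<Longrightarrow> loose_chain X A (map (ccod X) \<phi>s) A' \<Longrightarrow> tcod X h = A \<Longrightarrow> tcod X k = A'"
    by (induction \<phi>s arbitrary: h A) (use cell_frame in auto)
  then show ?thesis using assms by (auto simp: chain_def)
qed

lemma ccomp_is_cell:
  assumes "is_cell X \<phi> f ps q g" "chain h \<phi>s k ps qs" "tcod X h = tdom X f"
  shows "is_cell X (ccomp X \<phi> h \<phi>s) (f \<cdot> h) qs q (g \<cdot> k)"
  using ccomp_cell[of \<phi> h \<phi>s k] assms by (auto simp: chain_def is_cell_def)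

lemma ccomp1_is_cell:
  assumes "is_cell X \<phi> f [p] q g" "is_cell X \<chi> h ps p k"
  shows "is_cell X (ccomp X \<phi> h [\<chi>]) (f \<cdot> h) ps q (g \<cdot> k)"
  using ccomp_is_cell[OF assms(1) chain_single[OF assms(2)]] is_cell_frame[OF assms(1)]
    is_cell_frame[OF assms(2)] by auto

lemma ccomp2_is_cell:
  assumes "is_cell X \<phi> f [p, q] r g" "is_cell X \<chi> h ps p m" "is_cell X \<psi> m qs q k"
  shows "is_cell X (ccomp X \<phi> h [\<chi>, \<psi>]) (f \<cdot> h) (ps @ qs) r (g \<cdot> k)"
  using ccomp_is_cell[OF assms(1) chain_pair[OF assms(2,3)]] is_cell_frame[OF assms(1)]
    is_cell_frame[OF assms(2)] by auto

lemma ccomp_cid_left':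
  "is_cell X \<phi> f ps q g \<Longrightarrow> ccomp X (cid X q) f [\<phi>] = \<phi>"
  using ccomp_cid_left[of \<phi>] by (auto simp: is_cell_def)

lemma ccomp_cid_right':
  "is_cell X \<phi> f ps q g \<Longrightarrow> ccomp X \<phi> (tid X (tdom X f)) (map (cid X) ps) = \<phi>"
  using ccomp_cid_right[of \<phi>] by (auto simp: is_cell_def)

lemma ccomp_assoc0:
  assumes "is_cell X \<phi> f [] q g" "h \<in> Tight X" "tcod X h = tdom X f" "h' \<in> Tight X"
    "tcod X h' = tdom X h"
  shows "ccomp X (ccomp X \<phi> h []) h' [] = ccomp X \<phi> (h \<cdot> h') []"
  using ccomp_assoc[of \<phi> h "[]" h h' "[]" h'] assms by (auto simp: is_cell_def)

lemma ccomp_assoc1: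
  assumes "is_cell X \<phi> f [p] q g" "is_cell X \<chi> h ps p k" "chain h' \<psi>s k' ps rs"
    "tcod X h' = tdom X h"
  shows "ccomp X (ccomp X \<phi> h [\<chi>]) h' \<psi>s = ccomp X \<phi> (h \<cdot> h') [ccomp X \<chi> h' \<psi>s]"
  using ccomp_assoc[of \<phi> h "[\<chi>]" k h' "[\<psi>s]" k'] assms is_cell_frame[OF assms(1)]
    is_cell_frame[OF assms(2)]
  by (auto simp: is_cell_def chain_def)

lemma ccomp_assoc2:
  assumes "is_cell X \<phi> f [p, q] r g" "is_cell X \<chi> h ps p m" "is_cell X \<chi>' m qs q k"
    and "chain h' \<psi>s m' ps rs" "chain m' \<psi>s' k' qs ss" "tcod X h' = tdom X h"
  shows "ccomp X (ccomp X \<phi> h [\<chi>, \<chi>']) h' (\<psi>s @ \<psi>s')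
    = ccomp X \<phi> (h \<cdot> h') [ccomp X \<chi> h' \<psi>s, ccomp X \<chi>' m' \<psi>s']"
proof -
  \<comment> \<open>This is the tight-cell at which \<open>ccomps\<close> starts the second block:
    the end of the first block, or \<open>h'\<close> if that block is empty.\<close>
  have "(if \<psi>s = [] then h' else cright X (last \<psi>s)) = m'"
    using assms(4) cell_chain_last by (simp add: chain_def)
  then show ?thesis
    using ccomp_assoc[of \<phi> h "[\<chi>, \<chi>']" k h' "[\<psi>s, \<psi>s']" k'] assms is_cell_frame[OF assms(1)]
      is_cell_frame[OF assms(2)] is_cell_frame[OF assms(3)]
    by (auto simp: is_cell_def chain_def cell_chain_append)
qed

text \<open>Both cells factorise their common composite with the padded \<upsilon>, and such a
  factorisation is unique. Every later comparison of cells out of a loose-identity rests on this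
  cancellation.\<close>

lemma opcartesian_eqI:
  assumes "opcartesian \<upsilon>" "globular \<upsilon> qs p"
    and "is_cell X \<psi> f (ps @ [p] @ rs) q g" "is_cell X \<psi>' f (ps @ [p] @ rs) q g"
    and "ccomp X \<psi> (tid X (tdom X f)) (map (cid X) ps @ [\<upsilon>] @ map (cid X) rs)
       = ccomp X \<psi>' (tid X (tdom X f)) (map (cid X) ps @ [\<upsilon>] @ map (cid X) rs)"
  shows "\<psi> = \<psi>'"
proof -
  let ?i = "tid X (tdom X f)" and ?\<upsilon>s = "map (cid X) ps @ [\<upsilon>] @ map (cid X) rs"
  let ?\<chi> = "ccomp X \<psi> ?i ?\<upsilon>s"
  note \<psi> = is_cell_frame[OF assms(3)]
  have ids: "chain (tid X A) (map (cid X) ss) (tid X A') ss ss" if "loose_chain X A ss A'"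
    for A A' ss
    using that
  proof (induction ss arbitrary: A)
    case Nil
    then show ?case using tid_simps by (auto intro: chain_Nil)
  next
    case (Cons s ss)
    then have "is_cell X (cid X s) (tid X A) [s] s (tid X (lsrc X s))" using cid_cell[of s] by simp
    with chain_append[OF chain_single Cons.IH, of _ _ _ _ "lsrc X s"] Cons.prems show ?case
      by fastforce
  qed
  have split: "loose_chain X A (ss @ ts) A' \<Longrightarrow> \<exists>M. loose_chain X A ss M \<and> loose_chain X M ts A'"
    for A A' ss ts
    by (induction ss arbitrary: A) (use lsrc_obj ltgt_obj in \<open>auto, cases ts, auto\<close>)
  obtain M where 1: "loose_chain X (tdom X f) ps M" "loose_chain X M ([p] @ rs) (tdom X g)"
    using split[OF \<psi>(6)] by blast
  have u: "chain (tid X (ltgt X p)) [\<upsilon>] (tid X (lsrc X p)) [p] qs"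
    using assms(2) chain_single unfolding globular_def by blast
  have l: "chain ?i (map (cid X) ps) (tid X (ltgt X p)) ps ps"
    and r: "chain (tid X (lsrc X p)) (map (cid X) rs) (tid X (tdom X g)) rs rs"
    using ids[OF 1(1)] ids[of "lsrc X p" rs "tdom X g"] 1(2) by simp_all
  have c: "chain ?i ?\<upsilon>s (tid X (tdom X g)) (ps @ [p] @ rs) (ps @ qs @ rs)"
    by (rule chain_append[OF l chain_append[OF u r]])
  have "is_cell X ?\<chi> (f \<cdot> ?i) (ps @ qs @ rs) q (g \<cdot> tid X (tdom X g))"
    by (rule ccomp_is_cell[OF assms(3) c]) (use \<psi> in simp)
  then have \<chi>: "is_cell X ?\<chi> f (ps @ qs @ rs) q g" using \<psi> by simp
  define \<chi>' where "\<chi>' = ?\<chi>"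
  note \<chi>' = \<chi>[folded \<chi>'_def]
  have "\<exists>!\<psi>'. is_cell X \<psi>' (cleft X \<chi>') (ps @ [ccod X \<upsilon>] @ rs) (ccod X \<chi>') (cright X \<chi>') \<and>
      \<chi>' = ccomp X \<psi>' (tid X (tdom X (cleft X \<chi>'))) ?\<upsilon>s"
    by (rule assms(1)[unfolded opcartesian_def, THEN conjunct2, rule_format])
      (use assms(2) \<chi>' \<psi>(6) in \<open>auto simp: globular_def is_cell_def\<close>)
  then have "\<exists>!\<psi>'. is_cell X \<psi>' f (ps @ [p] @ rs) q g \<and> \<chi>' = ccomp X \<psi>' ?i ?\<upsilon>s"
    using assms(2) by (simp only: is_cell_simps[OF \<chi>'] globular_def is_cell_def)
  then show ?thesis using assms(3,4,5) \<chi>'_def by blast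
qed

end

section \<open>Elements\<close>

context virtual_equipment
begin

text \<open>\<open>elt \<alpha> f ps g\<close> reads: \<open>\<alpha> : f \<rightarrow> g\<close> is an element of \<open>E(f,g)\<close> at the stage \<open>ps\<close>, where \<open>E\<close> is
  the codomain of \<open>f\<close>. The elements at the empty stage are the 2-cells \<open>f \<Rightarrow> g\<close> between
  tight-cells, and the formula for their composite makes sense at all stages.\<close>

definition elt :: "'c \<Rightarrow> 't \<Rightarrow> 'l list \<Rightarrow> 't \<Rightarrow> bool" where
  "elt \<alpha> f ps g \<longleftrightarrow> is_cell X \<alpha> f ps (lid (tcod X f)) g"

abbreviation star (infixl "\<star>" 65) where
  "\<alpha> \<star> \<beta> \<equiv> tcell_comp \<beta> \<alpha>"

lemma lid_simps [simp]:
  assumes "A \<in> Obj X"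
  shows "lid A \<in> Loose X" "ltgt X (lid A) = A" "lsrc X (lid A) = A"
  using unit_cell_props[OF assms] by auto

lemma elt_frame:
  assumes "elt \<alpha> f ps g"
  shows "f \<in> Tight X" "g \<in> Tight X" "tcod X g = tcod X f" "loose_chain X (tdom X f) ps (tdom X g)"
  using is_cell_frame[OF assms[unfolded elt_def]] by auto

lemma elt_frame0: "elt \<alpha> f [] g \<Longrightarrow> tdom X g = tdom X f"
  using elt_frame(4) by fastforce

lemma tcell_iff_elt: "tcell \<phi> f g \<longleftrightarrow> elt \<phi> f [] g"
  using elt_frame[of \<phi> f "[]" g] elt_frame0[of \<phi> f g] by (auto simp: tcell_def elt_def)

lemma elt_unit_cell: "A \<in> Obj X \<Longrightarrow> elt (unit_cell A) (tid X A) [] (tid X A)"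
  using unit_cell_props[of A] by (simp add: elt_def)

lemma elt_cid: "A \<in> Obj X \<Longrightarrow> elt (cid X (lid A)) (tid X A) [lid A] (tid X A)"
  using cid_cell[of "lid A"] by (simp add: elt_def)

lemma elt_lid_mult: "A \<in> Obj X \<Longrightarrow> elt (lid_mult A) (tid X A) [lid A, lid A] (tid X A)"
  using lid_mult_props(1)[of A] by (simp add: elt_def globular_def)

lemma elt_lid_map: "k \<in> Tight X \<Longrightarrow> elt (lid_map k) k [lid (tdom X k)] k"
  using lid_map_props(1)[of k] by (simp add: elt_def)

lemma elt_subst:
  assumes "elt \<alpha> f ps g" "chain h \<phi>s k ps qs" "tcod X h = tdom X f"
  shows "elt (ccomp X \<alpha> h \<phi>s) (f \<cdot> h) qs (g \<cdot> k)"
  using ccomp_is_cell[OF assms(1)[unfolded elt_def] assms(2,3)] elt_frame[OF assms(1)]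
    chain_tight[OF assms(2)] assms(3) by (simp add: elt_def)

lemma elt_subst0:
  assumes "elt \<alpha> f [] g" "h \<in> Tight X" "tcod X h = tdom X f"
  shows "elt (\<alpha> \<lhd> h) (f \<cdot> h) [] (g \<cdot> h)"
  using elt_subst[OF assms(1) chain_Nil] assms by simp

lemma elt_subst1:
  assumes "elt \<alpha> f [p] g" "is_cell X \<chi> h ps p k"
  shows "elt (ccomp X \<alpha> h [\<chi>]) (f \<cdot> h) ps (g \<cdot> k)"
  using elt_subst[OF assms(1) chain_single[OF assms(2)]] elt_frame[OF assms(1)]
      is_cell_frame[OF assms(2)]
  by simp

lemma elt_tcell_id: "f \<in> Tight X \<Longrightarrow> elt (tcell_id f) f [] f"
  using elt_subst0[OF elt_unit_cell[of "tcod X f"], of f] by (simp add: tcell_id_def)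

lemma chain_elt: "elt \<alpha> f ps g \<Longrightarrow> tcod X f = A \<Longrightarrow> chain f [\<alpha>] g [lid A] ps"
  unfolding elt_def by (auto intro: chain_single)

lemma star_eq:
  assumes "elt \<alpha> f ps g"
  shows "\<alpha> \<star> \<beta> = ccomp X (lid_mult (tcod X f)) f [\<alpha>, \<beta>]"
  using assms by (simp add: tcell_comp_def elt_def is_cell_def)

lemma elt_star:
  assumes "elt \<alpha> f ps g" "elt \<beta> g qs h"
  shows "elt (\<alpha> \<star> \<beta>) f (ps @ qs) h"
proof -
  note f = elt_frame[OF assms(1)] and g = elt_frame[OF assms(2)]
  have "chain f [\<alpha>, \<beta>] h [lid (tcod X f), lid (tcod X f)] (ps @ qs)"
    using chain_append[OF chain_elt[OF assms(1)] chain_elt[OF assms(2)]] f by simp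
  from elt_subst[OF elt_lid_mult this] f g show ?thesis
    by (simp add: star_eq[OF assms(1)])
qed

text \<open>Associativity of 2-cell composition at the binary cell \<open>lid_mult\<close>. The
  tight-cell \<open>h'\<close> is where the substituted chain is cut into the parts for \<alpha> and
  for \<beta>.\<close>

lemma star_subst:
  assumes "elt \<alpha> f ps g" "elt \<beta> g qs k" "chain h \<phi>s h' ps rs" "chain h' \<psi>s h'' qs ss"
    and "tcod X h = tdom X f"
  shows "ccomp X (\<alpha> \<star> \<beta>) h (\<phi>s @ \<psi>s) = ccomp X \<alpha> h \<phi>s \<star> ccomp X \<beta> h' \<psi>s"
proof -
  let ?E = "tcod X f"
  note f = elt_frame[OF assms(1)] and g = elt_frame[OF assms(2)]
  have c: "tcod X h' = tdom X g" using chain_tcod[OF assms(3) f(4) assms(5)] .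
  have "ccomp X (\<alpha> \<star> \<beta>) h (\<phi>s @ \<psi>s)
    = ccomp X (lid_mult ?E) (f \<cdot> h) [ccomp X \<alpha> h \<phi>s, ccomp X \<beta> h' \<psi>s]"
    unfolding star_eq[OF assms(1)]
    by (rule ccomp_assoc2[OF _ _ _ assms(3,4,5)])
      (use assms(1,2) elt_lid_mult[of ?E] f in \<open>auto simp: elt_def\<close>)
  also have "\<dots> = ccomp X \<alpha> h \<phi>s \<star> ccomp X \<beta> h' \<psi>s"
    using star_eq[OF elt_subst[OF assms(1,3,5)]] f chain_tight[OF assms(3)] assms(5) by simp
  finally show ?thesis .
qed

text \<open>A factor at the empty stage receives only a tight-cell: the right end \<open>h'\<close>
  of the chain if it comes last, as here, and the left end \<open>h\<close> if it comes
  first.\<close>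

lemma star_subst_left:
  assumes "elt \<alpha> f ps g" "elt \<beta> g [] k" "chain h \<phi>s h' ps rs" "tcod X h = tdom X f"
  shows "ccomp X (\<alpha> \<star> \<beta>) h \<phi>s = ccomp X \<alpha> h \<phi>s \<star> (\<beta> \<lhd> h')"
  using star_subst[OF assms(1-3) chain_Nil assms(4)] chain_tight[OF assms(3)] by simp

lemma star_subst_right:
  assumes "elt \<alpha> f [] g" "elt \<beta> g qs k" "chain h \<phi>s h' qs rs" "tcod X h = tdom X f"
  shows "ccomp X (\<alpha> \<star> \<beta>) h \<phi>s = (\<alpha> \<lhd> h) \<star> ccomp X \<beta> h \<phi>s"
  using star_subst[OF assms(1,2) chain_Nil assms(3,4)] chain_tight[OF assms(3)] by simp

lemma star_subst0:
  assumes "elt \<alpha> f [] g" "elt \<beta> g [] k" "h \<in> Tight X" "tcod X h = tdom X f"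
  shows "(\<alpha> \<star> \<beta>) \<lhd> h = (\<alpha> \<lhd> h) \<star> (\<beta> \<lhd> h)"
  using star_subst_left[OF assms(1,2) chain_Nil] assms by simp

section \<open>Unit and associativity laws for the composition of elements\<close>

text \<open>The unit of A(1,1) is opcartesian, so a cell out of A(1,1) is determined by its value on
  the unit. The two variants that follow allow further loose-cells to the right, or one to the
  left.\<close>

lemma lid_cell_eqI:
  assumes "elt \<phi> f [lid A] g" "elt \<psi> f [lid A] g" "A \<in> Obj X"
    and "ccomp X \<phi> (tid X A) [unit_cell A] = ccomp X \<psi> (tid X A) [unit_cell A]"
  shows "\<phi> = \<psi>"
proof -
  have "tdom X f = A" using elt_frame[OF assms(1)] assms(3) by simp
  then show ?thesis
    using opcartesian_eqI[of "unit_cell A" "[]" "lid A" \<phi> f "[]" "[]" _ g \<psi>] assms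
        unit_cell_props[of A]
    by (simp add: elt_def globular_def)
qed

lemma lid_cell_eqI_left:
  assumes "elt \<phi> f (lid A # ps) g" "elt \<psi> f (lid A # ps) g" "A \<in> Obj X"
    and "ccomp X \<phi> (tid X A) (unit_cell A # map (cid X) ps) = ccomp X \<psi> (tid X A)
      (unit_cell A # map (cid X) ps)"
  shows "\<phi> = \<psi>"
proof -
  have "tdom X f = A" using elt_frame[OF assms(1)] assms(3) by simp
  then show ?thesis
    using opcartesian_eqI[of "unit_cell A" "[]" "lid A" \<phi> f "[]" "ps" _ g \<psi>] assms
        unit_cell_props[of A]
    by (simp add: elt_def globular_def)
qed

lemma lid_cell_eqI_right:
  assumes "elt \<phi> f [p, lid A] g" "elt \<psi> f [p, lid A] g" "A \<in> Obj X"
    and "ccomp X \<phi> (tid X (ltgt X p)) [cid X p, unit_cell A] = ccomp X \<psi> (tid X (ltgt X p))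
      [cid X p, unit_cell A]"
  shows "\<phi> = \<psi>"
proof -
  have "tdom X f = ltgt X p" using elt_frame[OF assms(1)] by simp
  then show ?thesis
    using opcartesian_eqI[of "unit_cell A" "[]" "lid A" \<phi> f "[p]" "[]" _ g \<psi>] assms
        unit_cell_props[of A]
    by (simp add: elt_def globular_def)
qed

text \<open>\<open>lid_mult\<close> is characterised by its left unit law alone, which is the first
  equation. The right unit law follows by cancelling the unit: evaluated there, both one-sided
  products become \<open>unit_cell A \<star> unit_cell A\<close>.\<close>

lemma star_cid_unit:
  assumes "A \<in> Obj X"
  shows "unit_cell A \<star> cid X (lid A) = cid X (lid A)" "cid X (lid A) \<star> unit_cell A = cid X (lid A)"
    "cid X (lid A) \<star> cid X (lid A) = lid_mult A"
proof -
  note A = assms tid_simps[OF assms]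
  note u = elt_unit_cell[OF assms] and i = elt_cid[OF assms]
  show 1: "unit_cell A \<star> cid X (lid A) = cid X (lid A)"
    using lid_mult_props(2)[OF assms] star_eq[OF u] u A by (simp add: elt_def is_cell_def)
  show "cid X (lid A) \<star> cid X (lid A) = lid_mult A"
    using ccomp_cid_right'[OF elt_lid_mult[OF assms, unfolded elt_def]] star_eq[OF i] A by simp
  have iu: "ccomp X (cid X (lid A)) (tid X A) [unit_cell A] = unit_cell A"
    using ccomp_cid_left' u A by (simp add: elt_def)
  have U: "chain (tid X A) [unit_cell A] (tid X A) [lid A] []"
    using chain_elt[OF u] A by simp
  have uu: "unit_cell A \<lhd> tid X A = unit_cell A"
    using ccomp_cid_right'[OF u[unfolded elt_def]] A by simp
  have "ccomp X (cid X (lid A) \<star> unit_cell A) (tid X A) [unit_cell A] = unit_cell A \<star> unit_cell A"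
    using star_subst_left[OF i u U] A iu uu by simp
  also have "\<dots> = ccomp X (unit_cell A \<star> cid X (lid A)) (tid X A) [unit_cell A]"
    using star_subst_right[OF u i U] A iu uu by simp
  also have "\<dots> = ccomp X (cid X (lid A)) (tid X A) [unit_cell A]" by (simp add: 1)
  finally show "cid X (lid A) \<star> unit_cell A = cid X (lid A)"
    using lid_cell_eqI elt_star[OF i u] i assms by auto
qed

lemma cid_subst: "elt \<alpha> f ps g \<Longrightarrow> tcod X f = A \<Longrightarrow> ccomp X (cid X (lid A)) f [\<alpha>] = \<alpha>"
  using ccomp_cid_left' by (simp add: elt_def)

text \<open>The identity 2-cell of E(1,1) is the generic element, for which
  \<open>star_cid_unit\<close> gives both laws; substituting \<alpha> into it gives the general
  case.\<close>

lemma star_one [simp]: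
  assumes "elt \<alpha> f ps g"
  shows "tcell_id f \<star> \<alpha> = \<alpha>" "\<alpha> \<star> tcell_id g = \<alpha>"
proof -
  let ?E = "tcod X f"
  note f = elt_frame[OF assms]
  have E: "?E \<in> Obj X" using f by simp
  note c = chain_elt[OF assms refl] and u = elt_unit_cell[OF E] and i = elt_cid[OF E]
  show "tcell_id f \<star> \<alpha> = \<alpha>"
    using star_subst_right[OF u i c] star_cid_unit(1)[OF E] cid_subst[OF assms] E
    by (simp add: tcell_id_def)
  show "\<alpha> \<star> tcell_id g = \<alpha>"
    using star_subst_left[OF i u c] star_cid_unit(2)[OF E] cid_subst[OF assms] E f
    by (simp add: tcell_id_def)
qed

text \<open>With the unit in the first of the three positions, both sides collapse to
  \<open>lid_mult A\<close> by the left unit law.\<close>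

lemma lid_mult_assoc:
  assumes A: "A \<in> Obj X"
  shows "lid_mult A \<star> cid X (lid A) = cid X (lid A) \<star> lid_mult A"
proof (rule lid_cell_eqI_left[where A = A and ps = "[lid A, lid A]" and f = "tid X A" and
      g = "tid X A"])
  note u = elt_unit_cell[OF A] and i = elt_cid[OF A] and m = elt_lid_mult[OF A]
  let ?i = "cid X (lid A)"
  show "elt (lid_mult A \<star> ?i) (tid X A) [lid A, lid A, lid A] (tid X A)"
    "elt (?i \<star> lid_mult A) (tid X A) [lid A, lid A, lid A] (tid X A)"
    using elt_star[OF m i] elt_star[OF i m] by auto
  have ci: "chain (tid X A) [?i] (tid X A) [lid A] [lid A]"
    and cu: "chain (tid X A) [unit_cell A] (tid X A) [lid A] []"
    using chain_elt[OF i] chain_elt[OF u] A by auto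
  have "ccomp X (lid_mult A \<star> ?i) (tid X A) [unit_cell A, ?i, ?i] = (unit_cell A \<star> ?i) \<star> ?i"
    using star_subst[OF m i chain_append[OF cu ci, simplified] ci] A cid_subst[OF i] star_eq[OF u]
        by simp
  also have "\<dots> = unit_cell A \<star> (?i \<star> ?i)"
    using star_one(1)[OF m] A star_cid_unit(1,3)[OF A] ccomp_cid_right'[OF u[unfolded elt_def]]
    by (simp add: tcell_id_def)
  also have "\<dots> = ccomp X (?i \<star> lid_mult A) (tid X A) [unit_cell A, ?i, ?i]"
    using star_subst[OF i m cu chain_append[OF ci ci, simplified]] A cid_subst[OF u] star_eq[OF i]
        by simp
  finally show "ccomp X (lid_mult A \<star> ?i) (tid X A) (unit_cell A # map (cid X) [lid A, lid A])
      = ccomp X (?i \<star> lid_mult A) (tid X A) (unit_cell A # map (cid X) [lid A, lid A])" by simp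
qed (rule A)

text \<open>Substitution of \<alpha>, \<beta>, \<gamma> into the generic case
  \<open>lid_mult_assoc\<close>.\<close>

lemma star_assoc:
  assumes "elt \<alpha> f ps g" "elt \<beta> g qs h" "elt \<gamma> h rs k"
  shows "(\<alpha> \<star> \<beta>) \<star> \<gamma> = \<alpha> \<star> (\<beta> \<star> \<gamma>)"
proof -
  let ?E = "tcod X f"
  note fr = elt_frame[OF assms(1)] elt_frame[OF assms(2)] elt_frame[OF assms(3)]
  have E: "?E \<in> Obj X" using fr by simp
  note i = elt_cid[OF E] and m = elt_lid_mult[OF E]
  have c: "chain f [\<alpha>] g [lid ?E] ps" "chain g [\<beta>] h [lid ?E] qs" "chain h [\<gamma>] k [lid ?E] rs"
    using chain_elt assms fr by auto
  have "ccomp X (lid_mult ?E \<star> cid X (lid ?E)) f [\<alpha>, \<beta>, \<gamma>] = (\<alpha> \<star> \<beta>) \<star> \<gamma>"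
    using star_subst[OF m i chain_append[OF c(1,2), simplified] c(3)] E fr cid_subst[OF assms(3)]
        star_eq[OF assms(1)] by simp
  moreover have "ccomp X (cid X (lid ?E) \<star> lid_mult ?E) f [\<alpha>, \<beta>, \<gamma>] = \<alpha> \<star> (\<beta> \<star> \<gamma>)"
    using star_subst[OF i m c(1) chain_append[OF c(2,3), simplified]] E fr cid_subst[OF assms(1)]
        star_eq[OF assms(2)] by simp
  ultimately show ?thesis using lid_mult_assoc[OF E] by simp
qed

section \<open>Whiskering\<close>

lemma whisker_left_eq:
  "elt \<alpha> f ps g \<Longrightarrow> whisker_left k \<alpha> = ccomp X (lid_map k) f [\<alpha>]"
  by (simp add: whisker_left_def elt_def is_cell_def)

lemma elt_whisker_left:
  assumes "elt \<alpha> f ps g" "k \<in> Tight X" "tdom X k = tcod X f"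
  shows "elt (whisker_left k \<alpha>) (k \<cdot> f) ps (k \<cdot> g)"
  using elt_subst1[OF elt_lid_map[OF assms(2)]] assms by (simp add: whisker_left_eq elt_def)

lemma whisker_left_subst:
  assumes "elt \<alpha> f ps g" "k \<in> Tight X" "tdom X k = tcod X f" "chain h \<phi>s h' ps qs"
    "tcod X h = tdom X f"
  shows "ccomp X (whisker_left k \<alpha>) h \<phi>s = whisker_left k (ccomp X \<alpha> h \<phi>s)"
  using ccomp_assoc1[OF elt_lid_map[OF assms(2), unfolded elt_def] _ assms(4,5)] assms
    whisker_left_eq[OF elt_subst[OF assms(1,4,5)]]
  by (simp add: whisker_left_eq elt_def)

lemma whisker_left_tcell_id:
  assumes "f \<in> Tight X" "k \<in> Tight X" "tdom X k = tcod X f"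
  shows "whisker_left k (tcell_id f) = tcell_id (k \<cdot> f)"
proof -
  let ?A = "tcod X f" and ?B = "tcod X k"
  have A: "?A \<in> Obj X" and B: "?B \<in> Obj X" using assms by auto
  have 1: "whisker_left k (unit_cell ?A) = unit_cell ?B \<lhd> k"
    using lid_map_props(2)[OF assms(2)] assms by (simp add: whisker_left_def)
  have "whisker_left k (tcell_id f) = whisker_left k (unit_cell ?A) \<lhd> f"
    unfolding tcell_id_def
    using whisker_left_subst[OF elt_unit_cell[OF A], of k f "[]" f "[]"] assms A chain_Nil by simp
  also have "\<dots> = tcell_id (k \<cdot> f)"
    unfolding 1 tcell_id_def
    using ccomp_assoc0[OF elt_unit_cell[OF B, unfolded elt_def], of k f] assms B by simp
  finally show ?thesis .
qed

lemma whisker_left_star: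
  assumes "elt \<alpha> f ps g" "elt \<beta> g qs h" "k \<in> Tight X" "tdom X k = tcod X f"
  shows "whisker_left k (\<alpha> \<star> \<beta>) = whisker_left k \<alpha> \<star> whisker_left k \<beta>"
proof -
  let ?A = "tdom X k" and ?m = "lid_map k"
  let ?i = "cid X (lid ?A)"
  have A: "?A \<in> Obj X" using assms(3) tdom_obj by auto
  note fr = elt_frame[OF assms(1)] elt_frame[OF assms(2)]
  note u = elt_unit_cell[OF A] and i = elt_cid[OF A] and m = elt_lid_mult[OF A] and
    k = elt_lid_map[OF assms(3)]
  have tA: "tdom X k = tcod X (tid X ?A)" and tf: "tcod X f = tdom X (tid X ?A)" using A assms(4)
      by auto
  have c: "chain f [\<alpha>] g [lid ?A] ps" "chain g [\<beta>] h [lid ?A] qs"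
    using chain_elt assms fr by auto
  have ci: "chain (tid X ?A) [?i] (tid X ?A) [lid ?A] [lid ?A]"
    and cu: "chain (tid X ?A) [unit_cell ?A] (tid X ?A) [lid ?A] []"
    using chain_elt[OF i] chain_elt[OF u] A by auto
  have ki: "ccomp X ?m (tid X ?A) [?i] = ?m"
    using ccomp_cid_right'[OF k[unfolded elt_def]] by simp
  \<comment> \<open>The generic case, with the identity of A(1,1) for both \<alpha> and \<beta>: on
    the unit in the first position both sides become \<open>lid_map k\<close>. Substituting \<alpha>
    and \<beta> afterwards gives the claim.\<close>
  have "whisker_left k (lid_mult ?A) = ?m \<star> ?m"
  proof (rule lid_cell_eqI_left[where A = ?A and ps = "[lid ?A]" and f = k and g = k])
    show "elt (whisker_left k (lid_mult ?A)) k [lid ?A, lid ?A] k"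
        "elt (?m \<star> ?m) k [lid ?A, lid ?A] k"
      using elt_whisker_left[OF m] elt_star[OF k k] A assms by auto
    have "ccomp X (whisker_left k (lid_mult ?A)) (tid X ?A) [unit_cell ?A, ?i] = whisker_left k ?i"
      using whisker_left_subst[OF m assms(3) tA chain_append[OF cu ci, simplified]] A
          star_cid_unit(1)[OF A] star_eq[OF u] by simp
    also have "\<dots> = ?m" using whisker_left_eq[OF i] ki by simp
    also have "\<dots> = tcell_id k \<star> ?m" using star_one[OF k] by simp
    also have "tcell_id k = ccomp X ?m (tid X ?A) [unit_cell ?A]"
      using lid_map_props(2)[OF assms(3)] u by (simp add: tcell_id_def elt_def is_cell_def)
    also have "\<dots> \<star> ?m = ccomp X (?m \<star> ?m) (tid X ?A) [unit_cell ?A, ?i]"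
      using star_subst[OF k k cu ci] A ki by simp
    finally show "ccomp X (whisker_left k (lid_mult ?A)) (tid X ?A)
        (unit_cell ?A # map (cid X) [lid ?A])
      = ccomp X (?m \<star> ?m) (tid X ?A) (unit_cell ?A # map (cid X) [lid ?A])" by simp
  qed (rule A)
  moreover have "ccomp X (whisker_left k (lid_mult ?A)) f [\<alpha>, \<beta>] = whisker_left k (\<alpha> \<star> \<beta>)"
    using whisker_left_subst[OF m assms(3) tA chain_append[OF c, simplified] tf]
        star_eq[OF assms(1)] assms(4) by simp
  moreover have "ccomp X (?m \<star> ?m) f [\<alpha>, \<beta>] = whisker_left k \<alpha> \<star> whisker_left k \<beta>"
    using star_subst[OF k k c] fr assms(4) whisker_left_eq[OF assms(1)]
        whisker_left_eq[OF assms(2)] by simp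
  ultimately show ?thesis by simp
qed

text \<open>On the unit, \<open>lid_map (k' \<cdot> k)\<close> and the whiskering of
  \<open>lid_map k\<close> by \<open>k'\<close> both give the identity of
  \<open>k' \<cdot> k\<close>, hence they are equal; then \<alpha> is substituted.\<close>

lemma whisker_left_tcomp:
  assumes "elt \<alpha> f ps g" "k \<in> Tight X" "tdom X k = tcod X f" "k' \<in> Tight X" "tdom X k' = tcod X k"
  shows "whisker_left (k' \<cdot> k) \<alpha> = whisker_left k' (whisker_left k \<alpha>)"
proof -
  let ?A = "tdom X k"
  have A: "?A \<in> Obj X" and B: "tdom X k' \<in> Obj X" using assms(2,4) tdom_obj by auto
  note u = elt_unit_cell[OF A] and k = elt_lid_map[OF assms(2)]
  have kk: "k' \<cdot> k \<in> Tight X" "tdom X (k' \<cdot> k) = ?A" "tcod X (k' \<cdot> k) = tcod X k'" using assms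
      by auto
  have cu: "chain (tid X ?A) [unit_cell ?A] (tid X ?A) [lid ?A] []"
    using chain_elt[OF u] A by auto
  have 1: "ccomp X (lid_map k) (tid X ?A) [unit_cell ?A] = tcell_id k" if "k \<in> Tight X"
      "tdom X k = ?A" for k
    using lid_map_props(2)[OF that(1)] that u by (simp add: tcell_id_def elt_def is_cell_def)
  have "lid_map (k' \<cdot> k) = whisker_left k' (lid_map k)"
  proof (rule lid_cell_eqI[where A = ?A and f = "k' \<cdot> k" and g = "k' \<cdot> k"])
    show "elt (lid_map (k' \<cdot> k)) (k' \<cdot> k) [lid ?A] (k' \<cdot> k)" using elt_lid_map[OF kk(1)] kk by simp
    show "elt (whisker_left k' (lid_map k)) (k' \<cdot> k) [lid ?A] (k' \<cdot> k)"
      using elt_whisker_left[OF k assms(4,5)] .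
    show "ccomp X (lid_map (k' \<cdot> k)) (tid X ?A) [unit_cell ?A] = ccomp X
        (whisker_left k' (lid_map k)) (tid X ?A) [unit_cell ?A]"
      using whisker_left_subst[OF k assms(4,5) cu] 1[OF kk(1,2)] 1[OF assms(2)] A
          whisker_left_tcell_id[OF assms(2,4,5)]
      by simp
  qed (rule A)
  then show ?thesis
    using whisker_left_subst[OF k assms(4,5) chain_elt[OF assms(1) assms(3)[symmetric]]
        assms(3)[symmetric]] whisker_left_eq[OF assms(1)] by simp
qed

section \<open>Transposes\<close>

definition cospan :: "'t \<Rightarrow> 't \<Rightarrow> bool" where
  [simp]: "cospan f g \<longleftrightarrow> f \<in> Tight X \<and> g \<in> Tight X \<and> tcod X g = tcod X f"

text \<open>\<open>transpose f g\<close> turns a globular 2-cell into \<open>E(f,g)\<close> into an element. If \<open>\<psi>\<close> is the transpose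
  of a 2-cell from \<open>E(a,b)\<close> to \<open>E'(a',b')\<close>, then \<open>act a b \<psi> x y\<close> is the operation induced by this
  2-cell, which takes elements \<open>ax \<rightarrow> by\<close> to elements \<open>a'x \<rightarrow> b'y\<close>.\<close>

definition transpose :: "'t \<Rightarrow> 't \<Rightarrow> 'c \<Rightarrow> 'c" where
  "transpose f g \<phi> = ccomp X (hom_cell f g) (tid X (tdom X f)) [\<phi>]"

definition act :: "'t \<Rightarrow> 't \<Rightarrow> 'c \<Rightarrow> 't \<Rightarrow> 't \<Rightarrow> 'c \<Rightarrow> 'c" where
  "act a b \<psi> x y \<alpha> = ccomp X \<psi> x [lift (lid (tcod X a)) a b x y \<alpha>]"

lemma elt_cospan: "elt \<alpha> f ps g \<Longrightarrow> cospan f g"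
  using elt_frame by (auto simp: cospan_def)

lemma globular_hom:
  "cospan f g \<Longrightarrow> globular \<phi> ps (hom f g)
    \<longleftrightarrow> is_cell X \<phi> (tid X (tdom X f)) ps (hom f g) (tid X (tdom X g))"
  using hom_cell_props[of f g] by (simp add: cospan_def globular_def)

lemma elt_hom_cell: "cospan f g \<Longrightarrow> elt (hom_cell f g) f [hom f g] g"
  using hom_cell_props(1)[of f g] by (simp add: cospan_def elt_def)

text \<open>The full cartesian property of E(f,g), over arbitrary tight-cells \<open>x\<close> and
  \<open>y\<close>. The case of identities does not suffice, since operations are to act on elements
  between \<open>f \<cdot> x\<close> and \<open>g \<cdot> y\<close>.\<close>

lemma lift_props:
  assumes "cospan f g" "x \<in> Tight X" "y \<in> Tight X" "tcod X x = tdom X f" "tcod X y = tdom X g"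
    and "elt \<psi> (f \<cdot> x) ps (g \<cdot> y)"
  shows "is_cell X (lift (lid (tcod X f)) f g x y \<psi>) x ps (hom f g) y"
    "ccomp X (hom_cell f g) x [lift (lid (tcod X f)) f g x y \<psi>] = \<psi>"
    "is_cell X \<phi> x ps (hom f g) y \<Longrightarrow> ccomp X (hom_cell f g) x [\<phi>] = \<psi> \<Longrightarrow> lift (lid (tcod X f)) f g x
      y \<psi> = \<phi>"
proof -
  let ?P = "\<lambda>\<phi>. is_cell X \<phi> x (cdom X \<psi>) (hom f g) y \<and> \<psi> = ccomp X (hom_cell f g) x [\<phi>]"
  have h: "is_cell X (hom_cell f g) f [hom f g] (lid (tcod X f)) g"
    and c: "cartesian (hom_cell f g) (lid (tcod X f)) f g"
    using hom_cell_props[of f g] assms(1) by (auto simp: cospan_def)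
  have \<psi>: "is_cell X \<psi> (f \<cdot> x) ps (lid (tcod X f)) (g \<cdot> y)"
    using assms by (simp add: elt_def)
  have ps: "cdom X \<psi> = ps" using is_cell_simps(4)[OF \<psi>] .
  from c obtain p where p: "is_cell X (hom_cell f g) f [p] (lid (tcod X f)) g"
    and u: "\<And>\<psi> f' g'. \<lbrakk>tight X f' (tdom X f') (tdom X f); tight X g' (tdom X g') (tdom X g);
             is_cell X \<psi> (f \<cdot> f') (cdom X \<psi>) (lid (tcod X f)) (g \<cdot> g')\<rbrakk> \<Longrightarrow>
             (\<exists>!\<phi>. is_cell X \<phi> f' (cdom X \<psi>) p g' \<and> \<psi> = ccomp X (hom_cell f g) f' [\<phi>])"
    unfolding cartesian_def by metis
  have pe: "p = hom f g" using p h by (simp add: is_cell_def)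
  have e: "\<exists>!\<phi>. ?P \<phi>" unfolding pe[symmetric]
    by (rule u) (use assms \<psi> ps in \<open>auto simp: tight_def\<close>)
  have "?P (THE \<phi>. ?P \<phi>)" by (rule theI'[OF e])
  then have l: "?P (lift (lid (tcod X f)) f g x y \<psi>)" unfolding lift_def .
  then show "is_cell X (lift (lid (tcod X f)) f g x y \<psi>) x ps (hom f g) y"
    "ccomp X (hom_cell f g) x [lift (lid (tcod X f)) f g x y \<psi>] = \<psi>"
    using ps by auto
  show "lift (lid (tcod X f)) f g x y \<psi> = \<phi>"
    if "is_cell X \<phi> x ps (hom f g) y" "ccomp X (hom_cell f g) x [\<phi>] = \<psi>"
  proof -
    have "?P \<phi>" using that ps by simp
    from the1_equality[OF e this] show ?thesis unfolding lift_def .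
  qed
qed

lemma elt_tr:
  assumes "cospan f g" "globular \<phi> ps (hom f g)"
  shows "elt (transpose f g \<phi>) f ps g"
  using elt_subst1[OF elt_hom_cell[OF assms(1)] assms(2)[unfolded globular_hom[OF assms(1)]]]
      assms(1)
  by (simp add: transpose_def)

lemma transpose_hom_lift:
  assumes "elt \<psi> f ps g"
  shows "globular (hom_lift f g \<psi>) ps (hom f g)" "transpose f g (hom_lift f g \<psi>) = \<psi>"
proof -
  note p = elt_cospan[OF assms]
  show 1: "globular (hom_lift f g \<psi>) ps (hom f g)"
    using hom_lift_props(1)[of f g \<psi> ps] assms p by (auto simp: cospan_def elt_def)
  show "transpose f g (hom_lift f g \<psi>) = \<psi>"
    using hom_lift_props(2)[of f g \<psi> ps] assms p is_cell_simps(2)[OF 1[unfolded globular_hom[OF p]]]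
    by (auto simp: cospan_def elt_def transpose_def)
qed

text \<open>Both cells factorise the same element through the cartesian 2-cell. Hence the equations
  between globular 2-cells in the definitions may be replaced by equations between their
  transposes.\<close>

lemma transpose_inj:
  assumes "cospan f g" "globular \<phi> ps (hom f g)" "globular \<phi>' ps (hom f g)"
    "transpose f g \<phi> = transpose f g \<phi>'"
  shows "\<phi> = \<phi>'"
proof -
  have "\<phi> = hom_lift f g (transpose f g \<phi>')" if "globular \<phi> ps (hom f g)"
      "transpose f g \<phi> = transpose f g \<phi>'" for \<phi>
    using hom_lift_props(3)[of f g "transpose f g \<phi>'" ps \<phi>] that
        is_cell_simps(2)[OF that(1)[unfolded globular_hom[OF assms(1)]]]
      elt_tr[OF assms(1,3)] assms(1)
    by (auto simp: elt_def cospan_def transpose_def)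
  from this[OF assms(2,4)] this[OF assms(3) refl] show ?thesis by simp
qed

lemma transpose_cid:
  assumes "cospan f g"
  shows "globular (cid X (hom f g)) [hom f g] (hom f g)"
    "transpose f g (cid X (hom f g)) = hom_cell f g"
  using ccomp_cid_right'[OF elt_hom_cell[OF assms, unfolded elt_def]] cid_cell[of "hom f g"]
    hom_cell_props(3-5)[of f g] assms
  by (simp_all add: transpose_def globular_def cospan_def)

section \<open>The action of transposes on elements\<close>

lemma elt_act:
  assumes "cospan a b" "elt \<psi> a' [hom a b] b'" "elt \<alpha> (a \<cdot> x) ps (b \<cdot> y)"
    and "x \<in> Tight X" "y \<in> Tight X" "tcod X x = tdom X a" "tcod X y = tdom X b"
  shows "elt (act a b \<psi> x y \<alpha>) (a' \<cdot> x) ps (b' \<cdot> y)"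
  unfolding act_def by (rule elt_subst1[OF assms(2) lift_props(1)]) (use assms in auto)

lemma hom_cell_frame:
  assumes "cospan a b" "elt \<psi> a' [hom a b] b'"
  shows "tdom X a' = tdom X a" "tdom X b' = tdom X b"
  using elt_frame[OF assms(2)] hom_cell_props(3-5)[of a b] assms(1) by (auto simp: cospan_def)

text \<open>By uniqueness of lifts, the lift of a substituted element is the substituted lift. This
  is naturality of the operation in the stage.\<close>

lemma act_subst:
  assumes "cospan a b" "elt \<psi> a' [hom a b] b'" "elt \<alpha> (a \<cdot> x) ps (b \<cdot> y)"
    and "x \<in> Tight X" "y \<in> Tight X" "tcod X x = tdom X a" "tcod X y = tdom X b"
    and "chain h \<phi>s k ps qs" "tcod X h = tdom X x"
  shows "ccomp X (act a b \<psi> x y \<alpha>) h \<phi>s = act a b \<psi> (x \<cdot> h) (y \<cdot> k) (ccomp X \<alpha> h \<phi>s)"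
proof -
  let ?l = "lift (lid (tcod X a)) a b x y \<alpha>"
  have h: "h \<in> Tight X" "k \<in> Tight X" using chain_tight[OF assms(8)] by auto
  have k: "tcod X k = tdom X y"
    using chain_tcod[OF assms(8) elt_frame(4)[OF assms(3)]] assms h by simp
  have l: "is_cell X ?l x ps (hom a b) y" "ccomp X (hom_cell a b) x [?l] = \<alpha>"
    by (rule lift_props; use assms in simp)+
  have e: "elt (ccomp X \<alpha> h \<phi>s) (a \<cdot> (x \<cdot> h)) qs (b \<cdot> (y \<cdot> k))"
    using elt_subst[OF assms(3,8)] assms h k tcomp_assoc'[of h x a] tcomp_assoc'[of k y b] by simp
  have "lift (lid (tcod X a)) a b (x \<cdot> h) (y \<cdot> k) (ccomp X \<alpha> h \<phi>s) = ccomp X ?l h \<phi>s"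
  proof (rule lift_props(3)[OF assms(1) _ _ _ _ e])
    show "is_cell X (ccomp X ?l h \<phi>s) (x \<cdot> h) qs (hom a b) (y \<cdot> k)"
      by (rule ccomp_is_cell[OF l(1) assms(8,9)])
    show "ccomp X (hom_cell a b) (x \<cdot> h) [ccomp X ?l h \<phi>s] = ccomp X \<alpha> h \<phi>s"
      using ccomp_assoc1[OF elt_hom_cell[OF assms(1), unfolded elt_def] l(1) assms(8,9)] l(2)
      by simp
  qed (use assms h k in auto)
  then show ?thesis
    unfolding act_def using ccomp_assoc1[OF assms(2)[unfolded elt_def] l(1) assms(8,9)] by simp
qed

lemma act_tr:
  assumes "cospan a b" "elt \<psi> a' [hom a b] b'" "globular \<chi> ps (hom a b)"
  shows "act a b \<psi> (tid X (tdom X a)) (tid X (tdom X b)) (transpose a b \<chi>) = ccomp X \<psi>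
    (tid X (tdom X a)) [\<chi>]"
proof -
  have "lift (lid (tcod X a)) a b (tid X (tdom X a)) (tid X (tdom X b)) (transpose a b \<chi>) = \<chi>"
    by (rule lift_props(3)[where ps = ps])
      (use assms elt_tr[OF assms(1,3)] globular_hom[OF assms(1)] in \<open>auto simp: transpose_def\<close>)
  then show ?thesis by (simp add: act_def)
qed

text \<open>A form of the Yoneda lemma: the generic element lifts to an identity, so an operation
  returns its defining 2-cell there.\<close>

lemma act_generic:
  assumes "cospan a b" "elt \<psi> a' [hom a b] b'"
  shows "act a b \<psi> (tid X (tdom X a)) (tid X (tdom X b)) (hom_cell a b) = \<psi>"
  using act_tr[OF assms transpose_cid(1)[OF assms(1)]] transpose_cid(2)[OF assms(1)]
      hom_cell_frame[OF assms]
    ccomp_cid_right'[OF assms(2)[unfolded elt_def]] by simp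

lemma act_hom_cell:
  assumes "cospan a b" "elt \<alpha> (a \<cdot> x) ps (b \<cdot> y)"
    and "x \<in> Tight X" "y \<in> Tight X" "tcod X x = tdom X a" "tcod X y = tdom X b"
  shows "act a b (hom_cell a b) x y \<alpha> = \<alpha>"
  unfolding act_def by (rule lift_props(2)) (use assms in auto)

lemma chain_lift:
  assumes "cospan a b" "elt \<alpha> (a \<cdot> x) ps (b \<cdot> y)"
    and "x \<in> Tight X" "y \<in> Tight X" "tcod X x = tdom X a" "tcod X y = tdom X b"
  shows "chain x [lift (lid (tcod X a)) a b x y \<alpha>] y [hom a b] ps"
  by (rule chain_single, rule lift_props) (use assms in auto)

text \<open>An instance of \<open>act_subst\<close> along the lift of \<alpha>. It is used to move
  an evaluation past an operation, so that nested operations are evaluated from the inside.\<close>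

lemma act_act:
  assumes "cospan a b" "elt \<psi> a' [hom a b] b'" "elt \<theta> (a \<cdot> f) [hom c d] (b \<cdot> g)"
    and "f \<in> Tight X" "g \<in> Tight X" "tcod X f = tdom X a" "tcod X g = tdom X b"
    and "cospan c d" "elt \<alpha> (c \<cdot> x) ps (d \<cdot> y)"
    and "x \<in> Tight X" "y \<in> Tight X" "tcod X x = tdom X c" "tcod X y = tdom X d"
  shows "act c d (act a b \<psi> f g \<theta>) x y \<alpha> = act a b \<psi> (f \<cdot> x) (g \<cdot> y) (act c d \<theta> x y \<alpha>)"
proof -
  have "tcod X x = tdom X f"
    using hom_cell_frame[OF assms(8,3)] assms by simp
  then show ?thesis
    using act_subst[OF assms(1-7) chain_lift[OF assms(8-13)]] by (simp add: act_def)
qed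

lemma act_star_tcell:
  assumes "cospan a b" "elt \<psi> a' [hom a b] b'" "elt \<beta> b' [] b''" "elt \<alpha> (a \<cdot> x) ps (b \<cdot> y)"
    and "x \<in> Tight X" "y \<in> Tight X" "tcod X x = tdom X a" "tcod X y = tdom X b"
  shows "act a b (\<psi> \<star> \<beta>) x y \<alpha> = act a b \<psi> x y \<alpha> \<star> (\<beta> \<lhd> y)"
  using star_subst_left[OF assms(2,3) chain_lift[OF assms(1,4-8)]] hom_cell_frame[OF assms(1,2)]
      assms(7)
  by (simp add: act_def)

lemma act_tcell_star:
  assumes "cospan a b" "elt \<psi> a' [hom a b] b'" "elt \<beta> a'' [] a'" "elt \<alpha> (a \<cdot> x) ps (b \<cdot> y)"
    and "x \<in> Tight X" "y \<in> Tight X" "tcod X x = tdom X a" "tcod X y = tdom X b"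
  shows "act a b (\<beta> \<star> \<psi>) x y \<alpha> = (\<beta> \<lhd> x) \<star> act a b \<psi> x y \<alpha>"
  using star_subst_right[OF assms(3,2) chain_lift[OF assms(1,4-8)]] hom_cell_frame[OF assms(1,2)]
      assms(7)
    elt_frame0[OF assms(3)]
  by (simp add: act_def)

lemma act_whisker_left:
  assumes "cospan a b" "elt \<psi> a' [hom a b] b'" "k \<in> Tight X" "tdom X k = tcod X a'"
    "elt \<alpha> (a \<cdot> x) ps (b \<cdot> y)"
    and "x \<in> Tight X" "y \<in> Tight X" "tcod X x = tdom X a" "tcod X y = tdom X b"
  shows "act a b (whisker_left k \<psi>) x y \<alpha> = whisker_left k (act a b \<psi> x y \<alpha>)"
  using whisker_left_subst[OF assms(2-4) chain_lift[OF assms(1,5-9)]] hom_cell_frame[OF assms(1,2)]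
      assms(8)
  by (simp add: act_def)

text \<open>Naturality is automatic: by opcartesianness of the loose-identity, it suffices to compare the
  two sides on the unit, where both reduce to \<open>\<psi>\<close>.\<close>

lemma act_star:
  assumes "cospan a b" "elt \<psi> a' [hom a b] b'" "elt \<alpha> (a \<cdot> x) ps (b \<cdot> y)" "elt \<delta> y qs z"
    and "x \<in> Tight X" "tcod X x = tdom X a" "tcod X y = tdom X b"
  shows "act a b \<psi> x y \<alpha> \<star> whisker_left b' \<delta> = act a b \<psi> x z (\<alpha> \<star> whisker_left b \<delta>)"
proof -
  let ?A = "tdom X a" and ?B = "tdom X b" and ?h = "hom_cell a b" and ?p = "hom a b"
  let ?i = "tid X ?A" and ?i' = "tid X ?B"
  note fr = elt_frame[OF assms(2)] elt_frame[OF assms(3)] elt_frame[OF assms(4)]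
  note d = hom_cell_frame[OF assms(1,2)]
  note h = elt_hom_cell[OF assms(1)]
  have b: "a \<in> Tight X" "b \<in> Tight X" "tcod X b = tcod X a" using assms(1) by auto
  have A: "?A \<in> Obj X" and B: "?B \<in> Obj X" using assms(1) tdom_obj by auto
  have kb: "elt (lid_map b) b [lid ?B] b" and kb': "elt (lid_map b') b' [lid ?B] b'"
    using elt_lid_map[of b] elt_lid_map[of b'] b fr d by auto
  have p: "ltgt X ?p = ?A" "chain ?i [cid X ?p] ?i' [?p] [?p]"
    using hom_cell_props(3-5)[of a b] chain_single[OF cid_cell[of ?p]] b by auto
  have u: "chain ?i' [unit_cell ?B] ?i' [lid ?B] []"
    using chain_elt[OF elt_unit_cell[OF B]] B by simp
  have one: "ccomp X (lid_map k) ?i' [unit_cell ?B] = tcell_id k" if "k \<in> Tight X" "tdom X k = ?B"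
      for k
    using lid_map_props(2)[OF that(1)] that elt_unit_cell[OF B] by
        (simp add: tcell_id_def elt_def is_cell_def)
  have pid: "ccomp X \<phi> ?i [cid X ?p] = \<phi>" if "elt \<phi> f [?p] g" "tdom X f = ?A" for \<phi> f g
    using ccomp_cid_right'[OF that(1)[unfolded elt_def]] that(2) by simp
  have hk: "elt (?h \<star> lid_map b) (a \<cdot> ?i) [?p, lid ?B] (b \<cdot> ?i')" using elt_star[OF h kb] b by simp
  have ii: "?i \<in> Tight X" "?i' \<in> Tight X" "tcod X ?i = ?A" "tcod X ?i' = ?B" using A B by auto
  \<comment> \<open>The generic instance: \<alpha> is \<open>hom_cell a b\<close> and \<delta> is
    the identity of the loose-identity on the domain of \<open>b\<close>, so whiskering \<delta>
    yields \<open>lid_map\<close>. The identities \<open>?i\<close> and \<open>?i'\<close> only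
    supply the form required by \<open>act\<close>. Substituting the lift of \<alpha> together with
    \<delta> gives the statement.\<close>
  have "\<psi> \<star> lid_map b' = act a b \<psi> ?i ?i' (?h \<star> lid_map b)"
  proof (rule lid_cell_eqI_right[where A = ?B])
    show "elt (\<psi> \<star> lid_map b') a' [?p, lid ?B] b'" using elt_star[OF assms(2) kb'] by simp
    show "elt (act a b \<psi> ?i ?i' (?h \<star> lid_map b)) a' [?p, lid ?B] b'"
      using elt_act[OF assms(1,2) hk ii] fr d by simp
    have "ccomp X (\<psi> \<star> lid_map b') ?i [cid X ?p, unit_cell ?B] = \<psi> \<star> tcell_id b'"
      using star_subst[OF assms(2) kb' p(2) u] A one fr d pid[OF assms(2)] by simp
    also have "\<dots> = act a b \<psi> ?i ?i' (?h \<star> tcell_id b)"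
      using star_one(2)[OF assms(2)] star_one(2)[OF h] act_generic[OF assms(1,2)] by simp
    also have "\<dots> = ccomp X (act a b \<psi> ?i ?i' (?h \<star> lid_map b)) ?i [cid X ?p, unit_cell ?B]"
      using act_subst[OF assms(1,2) hk ii chain_append[OF p(2) u, simplified]] A B
        star_subst[OF h kb p(2) u] one b pid[OF h] by simp
    finally show "ccomp X (\<psi> \<star> lid_map b') (tid X (ltgt X ?p)) [cid X ?p, unit_cell ?B] =
      ccomp X (act a b \<psi> ?i ?i' (?h \<star> lid_map b)) (tid X (ltgt X ?p)) [cid X ?p, unit_cell ?B]"
      using p by simp
  qed (rule B)
  moreover let ?l = "lift (lid (tcod X a)) a b x y \<alpha>"
  have l: "is_cell X ?l x ps (hom a b) y" "ccomp X ?h x [?l] = \<alpha>"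
    by (rule lift_props; use assms fr in simp)+
  have c: "chain x [?l] y [?p] ps" "chain y [\<delta>] z [lid ?B] qs"
    using chain_single[OF l(1)] chain_elt[OF assms(4,7)] by auto
  have "ccomp X (\<psi> \<star> lid_map b') x [?l, \<delta>] = act a b \<psi> x y \<alpha> \<star> whisker_left b' \<delta>"
    using star_subst[OF assms(2) kb' c] assms(6) d whisker_left_eq[OF assms(4)] by
        (simp add: act_def)
  moreover have "ccomp X (act a b \<psi> ?i ?i' (?h \<star> lid_map b)) x [?l, \<delta>]
      = act a b \<psi> x z (\<alpha> \<star> whisker_left b \<delta>)"
    using act_subst[OF assms(1,2) hk ii chain_append[OF c, simplified]] A B fr assms(5-7)
      star_subst[OF h kb c] l(2) whisker_left_eq[OF assms(4)] by simp
  ultimately show ?thesis by simp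
qed

section \<open>Transposes of the canonical 2-cells\<close>

text \<open>The lift of the transpose of \<chi> is \<chi> itself, so by associativity composing with
  \<chi> amounts to applying the operation of \<phi> to the transpose of \<chi>.\<close>

lemma transpose_comp:
  assumes "cospan a b" "cospan f g" "globular \<phi> [hom a b] (hom f g)" "globular \<chi> ps (hom a b)"
  shows "globular (\<phi> \<bullet> [\<chi>]) ps (hom f g)"
    "transpose f g (\<phi> \<bullet> [\<chi>]) = act a b (transpose f g \<phi>) (tid X (tdom X a)) (tid X (tdom X b))
      (transpose a b \<chi>)"
proof -
  note e = elt_tr[OF assms(2,3)]
  note d = hom_cell_frame[OF assms(1) e]
  note \<phi> = assms(3)[unfolded globular_hom[OF assms(2)]] and \<chi>
      = assms(4)[unfolded globular_hom[OF assms(1)]]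
  have A: "tdom X a \<in> Obj X" "tdom X b \<in> Obj X" using assms(1) tdom_obj by auto
  have v: "\<phi> \<bullet> [\<chi>] = ccomp X \<phi> (tid X (tdom X a)) [\<chi>]" using is_cell_simps(2)[OF \<chi>] by simp
  show "globular (\<phi> \<bullet> [\<chi>]) ps (hom f g)"
    unfolding v globular_hom[OF assms(2)] using ccomp1_is_cell[OF \<phi> \<chi>] d A by simp
  show "transpose f g (\<phi> \<bullet> [\<chi>]) = act a b (transpose f g \<phi>) (tid X (tdom X a)) (tid X (tdom X b))
      (transpose a b \<chi>)"
    unfolding v act_tr[OF assms(1) e assms(4)]
    using ccomp_assoc1[OF elt_hom_cell[OF assms(2), unfolded elt_def] \<phi> chain_single[OF \<chi>]] d A
    by (simp add: transpose_def)
qed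

lemma transpose_hom_pre:
  assumes "elt \<phi> f [] f'" "cospan f g"
  shows "globular (hom_pre \<phi> g) [hom f' g] (hom f g)"
    "transpose f g (hom_pre \<phi> g) = \<phi> \<star> hom_cell f' g"
proof -
  have p: "cospan f' g" using elt_frame[OF assms(1)] assms(2) by (simp add: cospan_def)
  have "hom_pre \<phi> g = hom_lift f g (\<phi> \<star> hom_cell f' g)"
    using star_eq[OF assms(1)] assms by (simp add: hom_pre_def elt_def is_cell_def)
  with elt_star[OF assms(1) elt_hom_cell[OF p]]
  show "globular (hom_pre \<phi> g) [hom f' g] (hom f g)"
      "transpose f g (hom_pre \<phi> g) = \<phi> \<star> hom_cell f' g"
    using transpose_hom_lift by auto
qed

lemma transpose_hom_post:
  assumes "elt \<phi> g [] g'" "cospan f g"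
  shows "globular (hom_post f \<phi>) [hom f g] (hom f g')"
    "transpose f g' (hom_post f \<phi>) = hom_cell f g \<star> \<phi>"
proof -
  have "hom_post f \<phi> = hom_lift f g' (hom_cell f g \<star> \<phi>)"
    using star_eq[OF elt_hom_cell[OF assms(2)]] assms elt_hom_cell[OF assms(2)]
    by (simp add: hom_post_def elt_def is_cell_def)
  with elt_star[OF elt_hom_cell[OF assms(2)] assms(1)]
  show "globular (hom_post f \<phi>) [hom f g] (hom f g')"
      "transpose f g' (hom_post f \<phi>) = hom_cell f g \<star> \<phi>"
    using transpose_hom_lift by auto
qed

lemma transpose_cap:
  assumes "f \<in> Tight X"
  shows "globular (cap f) [] (hom f f)" "transpose f f (cap f) = tcell_id f"
  using transpose_hom_lift[OF elt_tcell_id[OF assms]] by (auto simp: cap_def)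

lemma transpose_cap_at:
  assumes "cospan x y" "c \<in> Tight X" "tdom X c = tcod X x"
  shows "globular (cap_at c x y) [hom x y] (hom (c \<cdot> x) (c \<cdot> y))"
    "transpose (c \<cdot> x) (c \<cdot> y) (cap_at c x y) = whisker_left c (hom_cell x y)"
proof -
  have "cap_at c x y = hom_lift (c \<cdot> x) (c \<cdot> y) (whisker_left c (hom_cell x y))"
    by (simp add: cap_at_def whisker_left_def)
  with elt_whisker_left[OF elt_hom_cell[OF assms(1)] assms(2,3)]
  show "globular (cap_at c x y) [hom x y] (hom (c \<cdot> x) (c \<cdot> y))"
    "transpose (c \<cdot> x) (c \<cdot> y) (cap_at c x y) = whisker_left c (hom_cell x y)"
    using transpose_hom_lift by auto
qed

lemma transpose_cup_at:
  assumes "cospan x t" "cospan t y" "globular \<chi> ps (hom x t)" "globular \<chi>' qs (hom t y)"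
  shows "globular (cup_at t x y \<bullet> [\<chi>, \<chi>']) (ps @ qs) (hom x y)"
    "transpose x y (cup_at t x y \<bullet> [\<chi>, \<chi>']) = transpose x t \<chi> \<star> transpose t y \<chi>'"
proof -
  let ?h = "hom_cell x t \<star> hom_cell t y"
  have p: "cospan x y" using assms(1,2) by (simp add: cospan_def)
  note e = elt_star[OF elt_hom_cell[OF assms(1)] elt_hom_cell[OF assms(2)]]
  note \<chi> = assms(3)[unfolded globular_hom[OF assms(1)]] and \<chi>'
      = assms(4)[unfolded globular_hom[OF assms(2)]]
  have A: "tdom X x \<in> Obj X" "tdom X t \<in> Obj X" "tdom X y \<in> Obj X" using assms(1,2) tdom_obj by auto
  have "tcod X t = tcod X x" using assms(1) by simp
  then have cu: "cup_at t x y = hom_lift x y ?h"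
    using star_eq[OF elt_hom_cell[OF assms(1)]] elt_hom_cell[OF assms(1)]
    by (simp add: cup_at_def elt_def is_cell_def)
  have g: "globular (cup_at t x y) [hom x t, hom t y] (hom x y)" "transpose x y (cup_at t x y) = ?h"
    using transpose_hom_lift[OF e] cu by auto
  note g' = g(1)[unfolded globular_hom[OF p]]
  have v: "cup_at t x y \<bullet> [\<chi>, \<chi>'] = ccomp X (cup_at t x y) (tid X (tdom X x)) [\<chi>, \<chi>']"
    using is_cell_simps(2)[OF \<chi>] by simp
  show "globular (cup_at t x y \<bullet> [\<chi>, \<chi>']) (ps @ qs) (hom x y)"
    unfolding v globular_hom[OF p] using ccomp2_is_cell[OF g' \<chi> \<chi>'] A by simp
  have "transpose x y (cup_at t x y \<bullet> [\<chi>, \<chi>']) = ccomp X ?h (tid X (tdom X x)) [\<chi>, \<chi>']"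
    unfolding v using ccomp_assoc1[OF elt_hom_cell[OF p, unfolded elt_def] g' chain_pair[OF \<chi> \<chi>']]
        g(2) A
    by (simp add: transpose_def)
  also have "\<dots> = transpose x t \<chi> \<star> transpose t y \<chi>'"
    using star_subst[OF elt_hom_cell[OF assms(1)] elt_hom_cell[OF assms(2)] chain_single[OF \<chi>]
        chain_single[OF \<chi>']] A
    by (simp add: transpose_def)
  finally show "transpose x y (cup_at t x y \<bullet> [\<chi>, \<chi>']) = transpose x t \<chi> \<star> transpose t y \<chi>'" .
qed

text \<open>Restriction evaluates the operation of \<phi> at the generic element of E(af,bg). The
  lift inside \<open>hom_restr\<close>, which carries the canonical isomorphisms, is exactly the one
  inside \<open>act\<close>.\<close>

lemma transpose_hom_restr:
  assumes "cospan a b" "cospan a' b'" "globular \<phi> [hom a b] (hom a' b')"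
    and "f \<in> Tight X" "g \<in> Tight X" "tcod X f = tdom X a" "tcod X g = tdom X b"
  shows "globular (hom_restr \<phi> a b a' b' f g) [hom (a \<cdot> f) (b \<cdot> g)] (hom (a' \<cdot> f) (b' \<cdot> g))"
    "transpose (a' \<cdot> f) (b' \<cdot> g) (hom_restr \<phi> a b a' b' f g)
      = act a b (transpose a' b' \<phi>) f g (hom_cell (a \<cdot> f) (b \<cdot> g))"
proof -
  let ?l = "lift (lid (tcod X a)) a b f g (hom_cell (a \<cdot> f) (b \<cdot> g))"
  have p: "cospan (a \<cdot> f) (b \<cdot> g)" using assms by (auto simp: cospan_def)
  note h = elt_hom_cell[OF p]
  note e = elt_tr[OF assms(2,3)]
  note d = hom_cell_frame[OF assms(1) e]
  have l: "is_cell X ?l f [hom (a \<cdot> f) (b \<cdot> g)] (hom a b) g"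
    using lift_props(1)[OF assms(1,4-7) h] assms by simp
  have A: "tdom X a \<in> Obj X" "tdom X b \<in> Obj X" using assms(1) tdom_obj by auto
  note \<phi> = assms(3)[unfolded globular_hom[OF assms(2)]]
  have "is_cell X (ccomp X \<phi> f [?l]) f [hom (a \<cdot> f) (b \<cdot> g)] (hom a' b') g"
    using ccomp1_is_cell[OF \<phi> l] d assms(4-7) by simp
  then have "hom_cell a' b' \<bullet> [\<phi> \<bullet> [?l]] = ccomp X (hom_cell a' b') f [ccomp X \<phi> f [?l]]"
    using is_cell_simps(2)[OF l] by (simp add: is_cell_def)
  also have "\<dots> = act a b (transpose a' b' \<phi>) f g (hom_cell (a \<cdot> f) (b \<cdot> g))"
    unfolding act_def transpose_def
    using ccomp_assoc1[OF elt_hom_cell[OF assms(2), unfolded elt_def] \<phi> chain_single[OF l]] d A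
        assms(4-7) by simp
  finally have "hom_restr \<phi> a b a' b' f g
      = hom_lift (a' \<cdot> f) (b' \<cdot> g) (act a b (transpose a' b' \<phi>) f g (hom_cell (a \<cdot> f) (b \<cdot> g)))"
    by (simp add: hom_restr_def)
  with elt_act[OF assms(1) e h assms(4-7)]
  show "globular (hom_restr \<phi> a b a' b' f g) [hom (a \<cdot> f) (b \<cdot> g)] (hom (a' \<cdot> f) (b' \<cdot> g))"
    "transpose (a' \<cdot> f) (b' \<cdot> g) (hom_restr \<phi> a b a' b' f g)
      = act a b (transpose a' b' \<phi>) f g (hom_cell (a \<cdot> f) (b \<cdot> g))"
    using transpose_hom_lift by auto
qed

lemma transpose_eq_iff:
  "cospan f g \<Longrightarrow> globular \<phi> ps (hom f g) \<Longrightarrow> globular \<phi>' ps (hom f g) \<Longrightarrow> \<phi> = \<phi>' \<longleftrightarrow> transpose f g \<phi>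
    = transpose f g \<phi>'"
  using transpose_inj by blast

lemma transpose_vert:
  assumes "cospan f g" "globular \<phi> ps (hom f g)"
  shows "hom_cell f g \<bullet> [\<phi>] = transpose f g \<phi>"
  using is_cell_simps(2)[OF assms(2)[unfolded globular_hom[OF assms(1)]]] by
      (simp add: transpose_def)

lemma tcell_tid_right: "elt \<alpha> f [] g \<Longrightarrow> tdom X f = A \<Longrightarrow> \<alpha> \<lhd> tid X A = \<alpha>"
  using ccomp_cid_right'[of \<alpha> f "[]"] by (auto simp: elt_def)

lemma tcell_id_pre:
  assumes "f \<in> Tight X" "h \<in> Tight X" "tcod X h = tdom X f"
  shows "tcell_id f \<lhd> h = tcell_id (f \<cdot> h)"
  using ccomp_assoc0[OF elt_unit_cell[unfolded elt_def], of "tcod X f" f h] assms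
  by (simp add: tcell_id_def)

lemma pre_tight_pre:
  assumes "elt \<alpha> f [] g" "h \<in> Tight X" "tcod X h = tdom X f" "k \<in> Tight X" "tcod X k = tdom X h"
  shows "(\<alpha> \<lhd> h) \<lhd> k = \<alpha> \<lhd> (h \<cdot> k)"
  using ccomp_assoc0[OF assms(1)[unfolded elt_def]] assms by simp

lemma whisker_left_pre:
  assumes "elt \<alpha> f [] g" "k \<in> Tight X" "tdom X k = tcod X f" "h \<in> Tight X" "tcod X h = tdom X f"
  shows "whisker_left k \<alpha> \<lhd> h = whisker_left k (\<alpha> \<lhd> h)"
  using whisker_left_subst[OF assms(1-3) chain_Nil] assms by simp

lemma whisker_left_tid:
  assumes "elt \<alpha> f ps g" "tcod X f = A"
  shows "whisker_left (tid X A) \<alpha> = \<alpha>"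
proof -
  have A: "A \<in> Obj X" using elt_frame[OF assms(1)] assms(2) by auto
  note u = elt_unit_cell[OF A]
  have "lid_map (tid X A) = cid X (lid A)"
  proof (rule lid_cell_eqI[OF _ elt_cid[OF A] A])
    show "elt (lid_map (tid X A)) (tid X A) [lid A] (tid X A)" using elt_lid_map[of "tid X A"] A
      by simp
    show "ccomp X (lid_map (tid X A)) (tid X A) [unit_cell A] = ccomp X (cid X (lid A)) (tid X A)
        [unit_cell A]"
      using lid_map_props(2)[of "tid X A"] A u cid_subst[OF u]
          is_cell_simps(2)[OF u[unfolded elt_def]]
        tcell_tid_right[OF u]
      by simp
  qed
  then show ?thesis using whisker_left_eq[OF assms(1)] cid_subst[OF assms] by simp
qed

text \<open>The transpose of \<open>hom_pre \<phi> g\<close> is \<phi> composed with a generic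
  element, and generic elements act as identities; what remains is composition with \<phi>. The same
  argument serves \<open>hom_post\<close> and \<open>cap_at\<close> below.\<close>

lemma transpose_hom_pre_comp:
  assumes "elt \<phi> f [] f'" "cospan f' g" "globular \<chi> ps (hom f' g)"
  shows "globular (hom_pre \<phi> g \<bullet> [\<chi>]) ps (hom f g)"
    "transpose f g (hom_pre \<phi> g \<bullet> [\<chi>]) = \<phi> \<star> transpose f' g \<chi>"
proof -
  have p: "cospan f g" using elt_frame[OF assms(1)] assms(2) by simp
  have A: "tdom X f' \<in> Obj X" "tdom X g \<in> Obj X" using assms(2) by auto
  note h = transpose_hom_pre[OF assms(1) p] and c = elt_tr[OF assms(2,3)]
  show "globular (hom_pre \<phi> g \<bullet> [\<chi>]) ps (hom f g)" using transpose_comp(1)[OF assms(2) p h(1)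
      assms(3)] .
  show "transpose f g (hom_pre \<phi> g \<bullet> [\<chi>]) = \<phi> \<star> transpose f' g \<chi>"
    unfolding transpose_comp(2)[OF assms(2) p h(1) assms(3)] h(2)
    using act_tcell_star[OF assms(2) elt_hom_cell[OF assms(2)] assms(1), of "transpose f' g \<chi>"]
      act_hom_cell[OF assms(2), of "transpose f' g \<chi>"] c A assms(2) tcell_tid_right[OF assms(1)]
        elt_frame0[OF assms(1)]
    by simp
qed

lemma transpose_hom_post_comp:
  assumes "elt \<phi> g [] g'" "cospan f g" "globular \<chi> ps (hom f g)"
  shows "globular (hom_post f \<phi> \<bullet> [\<chi>]) ps (hom f g')"
    "transpose f g' (hom_post f \<phi> \<bullet> [\<chi>]) = transpose f g \<chi> \<star> \<phi>"
proof -
  have p: "cospan f g'" using elt_frame[OF assms(1)] assms(2) by simp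
  have A: "tdom X f \<in> Obj X" "tdom X g \<in> Obj X" using assms(2) by auto
  note h = transpose_hom_post[OF assms(1,2)] and c = elt_tr[OF assms(2,3)]
  show "globular (hom_post f \<phi> \<bullet> [\<chi>]) ps (hom f g')" using transpose_comp(1)[OF assms(2) p h(1)
      assms(3)] .
  show "transpose f g' (hom_post f \<phi> \<bullet> [\<chi>]) = transpose f g \<chi> \<star> \<phi>"
    unfolding transpose_comp(2)[OF assms(2) p h(1) assms(3)] h(2)
    using act_star_tcell[OF assms(2) elt_hom_cell[OF assms(2)] assms(1), of "transpose f g \<chi>"]
      act_hom_cell[OF assms(2), of "transpose f g \<chi>"] c A assms(2) tcell_tid_right[OF assms(1)]
    by simp
qed

lemma transpose_cap_at_comp:
  assumes "cospan x y" "c \<in> Tight X" "tdom X c = tcod X x" "globular \<chi> ps (hom x y)"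
  shows "globular (cap_at c x y \<bullet> [\<chi>]) ps (hom (c \<cdot> x) (c \<cdot> y))"
    "transpose (c \<cdot> x) (c \<cdot> y) (cap_at c x y \<bullet> [\<chi>]) = whisker_left c (transpose x y \<chi>)"
proof -
  have p: "cospan (c \<cdot> x) (c \<cdot> y)" using assms by simp
  have A: "tdom X x \<in> Obj X" "tdom X y \<in> Obj X" using assms(1) by auto
  note h = transpose_cap_at[OF assms(1-3)] and e = elt_tr[OF assms(1,4)]
  show "globular (cap_at c x y \<bullet> [\<chi>]) ps (hom (c \<cdot> x) (c \<cdot> y))" using
      transpose_comp(1)[OF assms(1) p h(1) assms(4)] .
  show "transpose (c \<cdot> x) (c \<cdot> y) (cap_at c x y \<bullet> [\<chi>]) = whisker_left c (transpose x y \<chi>)"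
    unfolding transpose_comp(2)[OF assms(1) p h(1) assms(4)] h(2)
    using act_whisker_left[OF assms(1) elt_hom_cell[OF assms(1)] assms(2,3), of "transpose x y \<chi>"]
      act_hom_cell[OF assms(1), of "transpose x y \<chi>"] e A assms(1)
    by simp
qed

section \<open>Relative adjunctions\<close>

text \<open>The typing of a relative adjunction, separated from the two inverse laws, which are
  turned into laws on elements in \<open>aflat_asharp\<close> and
  \<open>asharp_aflat\<close>.\<close>

definition radj_data :: "'t \<Rightarrow> ('t, 'c) radjunction \<Rightarrow> bool" where
  "radj_data j a \<longleftrightarrow> j \<in> Tight X \<and> ladj a \<in> Tight X \<and> radj a \<in> Tight X \<and>
     tdom X (ladj a) = tdom X j \<and> tdom X (radj a) = tcod X (ladj a) \<and> tcod X (radj a) = tcod X j \<and>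
     globular (sharp a) [hom (ladj a) (tid X (tcod X (ladj a)))] (hom j (radj a)) \<and>
     globular (flat a) [hom j (radj a)] (hom (ladj a) (tid X (tcod X (ladj a))))"

definition asharp :: "'t \<Rightarrow> ('t, 'c) radjunction \<Rightarrow> 't \<Rightarrow> 't \<Rightarrow> 'c \<Rightarrow> 'c" where
  "asharp j a = act (ladj a) (tid X (tcod X (ladj a))) (transpose j (radj a) (sharp a))"

definition aflat :: "'t \<Rightarrow> ('t, 'c) radjunction \<Rightarrow> 't \<Rightarrow> 't \<Rightarrow> 'c \<Rightarrow> 'c" where
  "aflat j a = act j (radj a) (transpose (ladj a) (tid X (tcod X (ladj a))) (flat a))"

lemma relative_adjunction_iff:
  "relative_adjunction j a \<longleftrightarrow> radj_data j a \<and>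
     flat a \<bullet> [sharp a] = cid X (hom (ladj a) (tid X (tcod X (ladj a)))) \<and>
     sharp a \<bullet> [flat a] = cid X (hom j (radj a))"
  by (auto simp: relative_adjunction_def radj_data_def tight_def Let_def)

context
  fixes j a l r C
  assumes a: "radj_data j a"
  defines "l \<equiv> ladj a" and "r \<equiv> radj a" and "C \<equiv> tcod X (ladj a)"
begin

lemma radj_tight: "j \<in> Tight X" "l \<in> Tight X" "r \<in> Tight X" "tdom X l = tdom X j" "tcod X l = C"
  "tdom X r = C" "tcod X r = tcod X j" "C \<in> Obj X"
  using a by (auto simp: radj_data_def l_def r_def C_def)

lemma radj_cospan: "cospan l (tid X C)" "cospan j r"
  using radj_tight by auto

lemma radj_glob: "globular (sharp a) [hom l (tid X C)] (hom j r)"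
  "globular (flat a) [hom j r] (hom l (tid X C))"
  using a by (auto simp: radj_data_def l_def r_def C_def)

lemma elt_sharp: "elt (transpose j r (sharp a)) j [hom l (tid X C)] r"
  and elt_flat: "elt (transpose l (tid X C) (flat a)) l [hom j r] (tid X C)"
  using elt_tr radj_cospan radj_glob by auto

lemma asharp_eq: "asharp j a = act l (tid X C) (transpose j r (sharp a))"
  and aflat_eq: "aflat j a = act j r (transpose l (tid X C) (flat a))"
  by (simp_all add: asharp_def aflat_def l_def r_def C_def)

lemma elt_asharp:
  assumes "elt \<alpha> (l \<cdot> x) ps y" "x \<in> Tight X" "tcod X x = tdom X j" "tcod X y = C"
  shows "elt (asharp j a x y \<alpha>) (j \<cdot> x) ps (r \<cdot> y)"
  unfolding asharp_eq by (rule elt_act[OF radj_cospan(1) elt_sharp])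
    (use assms radj_tight elt_frame[OF assms(1)] in auto)

lemma elt_aflat:
  assumes "elt \<beta> (j \<cdot> x) ps (r \<cdot> y)" "x \<in> Tight X" "tcod X x = tdom X j" "y \<in> Tight X"
    "tcod X y = C"
  shows "elt (aflat j a x y \<beta>) (l \<cdot> x) ps y"
  using elt_act[OF radj_cospan(2) elt_flat, of \<beta> x ps y] assms radj_tight unfolding aflat_eq by simp

lemma asharp_subst0:
  assumes "elt \<alpha> (l \<cdot> x) [] y" "x \<in> Tight X" "tcod X x = tdom X j" "tcod X y = C" "h \<in> Tight X"
    "tcod X h = tdom X x"
  shows "asharp j a x y \<alpha> \<lhd> h = asharp j a (x \<cdot> h) (y \<cdot> h) (\<alpha> \<lhd> h)"
  unfolding asharp_eq by (rule act_subst[OF radj_cospan(1) elt_sharp _ _ _ _ _ chain_Nil])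
    (use assms radj_tight elt_frame[OF assms(1)] in auto)

text \<open>The naturality \<open>act_star\<close>, in which the whiskering by the identity of
  \<open>C\<close> disappears.\<close>

lemma asharp_star:
  assumes "elt \<alpha> (l \<cdot> x) ps y" "elt \<delta> y qs z" "x \<in> Tight X" "tcod X x = tdom X j" "tcod X y = C"
  shows "asharp j a x y \<alpha> \<star> whisker_left r \<delta> = asharp j a x z (\<alpha> \<star> \<delta>)"
  using act_star[OF radj_cospan(1) elt_sharp, of \<alpha> x ps y \<delta> qs z] assms radj_tight
      elt_frame[OF assms(1)]
    whisker_left_tid[OF assms(2)] unfolding asharp_eq by simp

lemma aflat_star:
  assumes "elt \<beta> (j \<cdot> x) ps (r \<cdot> y)" "elt \<delta> y qs z" "x \<in> Tight X" "tcod X x = tdom X j"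
    "tcod X y = C"
  shows "aflat j a x y \<beta> \<star> \<delta> = aflat j a x z (\<beta> \<star> whisker_left r \<delta>)"
  using act_star[OF radj_cospan(2) elt_flat assms(1,2)] assms radj_tight elt_frame[OF assms(1)]
    whisker_left_tid[OF assms(2)] unfolding aflat_eq by simp

text \<open>Transposed, the equation for \<open>flat a \<bullet> [sharp a]\<close> says that \<flat>
  sends the transpose of \<sharp> to the generic element. Acting on \<alpha> with both sides gives
  the law, as generic elements act as identities.\<close>

lemma aflat_asharp:
  assumes "relative_adjunction j a"
    and "elt \<alpha> (l \<cdot> x) ps y" "x \<in> Tight X" "tcod X x = tdom X j" "tcod X y = C"
  shows "aflat j a x y (asharp j a x y \<alpha>) = \<alpha>"
proof -
  have "flat a \<bullet> [sharp a] = cid X (hom l (tid X C))"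
    using assms(1) by (simp add: relative_adjunction_iff l_def C_def)
  then have "act j r (transpose l (tid X C) (flat a)) (tid X (tdom X j)) (tid X (tdom X r))
      (transpose j r (sharp a)) = hom_cell l (tid X C)"
    using transpose_comp(2)[OF radj_cospan(2,1) radj_glob(2,1)] transpose_cid(2)[OF radj_cospan(1)]
        by simp
  moreover have "act l (tid X C) (act j r (transpose l (tid X C) (flat a)) (tid X (tdom X j))
      (tid X (tdom X r)) (transpose j r (sharp a))) x y \<alpha>
      = aflat j a x y (asharp j a x y \<alpha>)"
    using act_act[OF radj_cospan(2) elt_flat, of "transpose j r (sharp a)" "tid X (tdom X j)" l
        "tid X C" "tid X (tdom X r)" \<alpha> x ps y]
      radj_tight assms radj_cospan elt_sharp elt_frame[OF assms(2)]
    unfolding asharp_eq aflat_eq by simp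
  ultimately show ?thesis
    using act_hom_cell[OF radj_cospan(1), of \<alpha> x ps y] assms elt_frame[OF assms(2)] radj_tight
      by simp
qed

lemma asharp_aflat:
  assumes "relative_adjunction j a"
    and "elt \<beta> (j \<cdot> x) ps (r \<cdot> y)" "x \<in> Tight X" "tcod X x = tdom X j" "y \<in> Tight X" "tcod X y = C"
  shows "asharp j a x y (aflat j a x y \<beta>) = \<beta>"
proof -
  have "sharp a \<bullet> [flat a] = cid X (hom j r)"
    using assms(1) by (simp add: relative_adjunction_iff r_def)
  then have "act l (tid X C) (transpose j r (sharp a)) (tid X (tdom X j)) (tid X C)
      (transpose l (tid X C) (flat a)) = hom_cell j r"
    using transpose_comp(2)[OF radj_cospan radj_glob] transpose_cid(2)[OF radj_cospan(2)]
        radj_tight by simp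
  moreover have "act j r (act l (tid X C) (transpose j r (sharp a)) (tid X (tdom X j)) (tid X C)
      (transpose l (tid X C) (flat a))) x y \<beta>
      = asharp j a x y (aflat j a x y \<beta>)"
    using act_act[OF radj_cospan(1) elt_sharp, of "transpose l (tid X C) (flat a)"
        "tid X (tdom X j)" j r "tid X C" \<beta> x ps y]
      radj_tight assms radj_cospan elt_flat
    unfolding asharp_eq aflat_eq by simp
  ultimately show ?thesis
    using act_hom_cell[OF radj_cospan(2) assms(2)] assms radj_tight by simp
qed

lemma transpose_sharp_at:
  assumes "f \<in> Tight X" "g \<in> Tight X" "tcod X f = tdom X j" "tcod X g = C"
  shows "globular (sharp_at j a f g) [hom (l \<cdot> f) g] (hom (j \<cdot> f) (r \<cdot> g))"
    "transpose (j \<cdot> f) (r \<cdot> g) (sharp_at j a f g) = asharp j a f g (hom_cell (l \<cdot> f) g)"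
  using transpose_hom_restr[OF radj_cospan radj_glob(1), of f g] assms radj_tight
  by (simp_all add: sharp_at_def asharp_eq flip: l_def r_def C_def)

lemma transpose_flat_at:
  assumes "f \<in> Tight X" "g \<in> Tight X" "tcod X f = tdom X j" "tcod X g = C"
  shows "globular (flat_at j a f g) [hom (j \<cdot> f) (r \<cdot> g)] (hom (l \<cdot> f) g)"
    "transpose (l \<cdot> f) g (flat_at j a f g) = aflat j a f g (hom_cell (j \<cdot> f) (r \<cdot> g))"
  using transpose_hom_restr[OF radj_cospan(2,1) radj_glob(2), of f g] assms radj_tight
  by (simp_all add: flat_at_def aflat_eq flip: l_def r_def C_def)

lemma act_asharp:
  assumes "f \<in> Tight X" "g \<in> Tight X" "tcod X f = tdom X j" "tcod X g = C"
    and "cospan c d" "elt \<theta> (l \<cdot> f) [hom c d] g" "elt \<alpha> (c \<cdot> x) ps (d \<cdot> y)"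
    and "x \<in> Tight X" "y \<in> Tight X" "tcod X x = tdom X c" "tcod X y = tdom X d"
  shows "act c d (asharp j a f g \<theta>) x y \<alpha> = asharp j a (f \<cdot> x) (g \<cdot> y) (act c d \<theta> x y \<alpha>)"
  unfolding asharp_eq by (rule act_act[OF radj_cospan(1) elt_sharp]) (use assms radj_tight in auto)

lemma act_aflat:
  assumes "f \<in> Tight X" "g \<in> Tight X" "tcod X f = tdom X j" "tcod X g = C"
    and "cospan c d" "elt \<theta> (j \<cdot> f) [hom c d] (r \<cdot> g)" "elt \<alpha> (c \<cdot> x) ps (d \<cdot> y)"
    and "x \<in> Tight X" "y \<in> Tight X" "tcod X x = tdom X c" "tcod X y = tdom X d"
  shows "act c d (aflat j a f g \<theta>) x y \<alpha> = aflat j a (f \<cdot> x) (g \<cdot> y) (act c d \<theta> x y \<alpha>)"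
  unfolding aflat_eq by (rule act_act[OF radj_cospan(2) elt_flat]) (use assms radj_tight in auto)

text \<open>The unit becomes \<sharp> of the identity of \<ell>, because \<sharp> evaluated
  generically is applied to that identity. The extension operator becomes r\<flat> at the generic
  element.\<close>

lemma induced_rmonad_simps:
  shows "carrier (induced_rmonad j a) = r \<cdot> l"
    "globular (extension (induced_rmonad j a)) [hom j (r \<cdot> l)] (hom (r \<cdot> l) (r \<cdot> l))"
    "transpose (r \<cdot> l) (r \<cdot> l) (extension (induced_rmonad j a))
      = whisker_left r (aflat j a (tid X (tdom X j)) l (hom_cell j (r \<cdot> l)))"
    "runit (induced_rmonad j a) = asharp j a (tid X (tdom X j)) l (tcell_id l)"
proof -
  let ?B = "tdom X j"
  let ?i = "tid X ?B"
  have B: "?B \<in> Obj X" using radj_tight by auto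
  have ll: "cospan l l" and jrl: "cospan j (r \<cdot> l)" using radj_tight by auto
  have un: "l = ladj a" "r = radj a" by (simp_all add: l_def r_def)
  show "carrier (induced_rmonad j a) = r \<cdot> l" by (simp add: induced_rmonad_def Let_def un)
  have e: "extension (induced_rmonad j a) = cap_at r l l \<bullet> [flat_at j a ?i l]"
    by (simp add: induced_rmonad_def Let_def un)
  have f': "globular (flat_at j a ?i l) [hom j (r \<cdot> l)] (hom l l)"
    "transpose l l (flat_at j a ?i l) = aflat j a ?i l (hom_cell j (r \<cdot> l))"
    using transpose_flat_at[of ?i l] radj_tight B by auto
  have s': "globular (sharp_at j a ?i l) [hom l l] (hom j (r \<cdot> l))"
    "transpose j (r \<cdot> l) (sharp_at j a ?i l) = asharp j a ?i l (hom_cell l l)"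
    using transpose_sharp_at[of ?i l] radj_tight B by auto
  show "globular (extension (induced_rmonad j a)) [hom j (r \<cdot> l)] (hom (r \<cdot> l) (r \<cdot> l))"
    "transpose (r \<cdot> l) (r \<cdot> l) (extension (induced_rmonad j a)) = whisker_left r
      (aflat j a ?i l (hom_cell j (r \<cdot> l)))"
    unfolding e f'(2)[symmetric] using transpose_cap_at_comp[OF ll _ _ f'(1), of r] radj_tight
      by auto
  note c = transpose_cap[OF radj_tight(2)]
  have "runit (induced_rmonad j a) = hom_cell j (r \<cdot> l) \<bullet> [sharp_at j a ?i l \<bullet> [cap l]]"
    by (simp add: induced_rmonad_def Let_def un)
  \<comment> \<open>Units of monads are stored as elements, so the outer cartesian 2-cell in the
    definition is precisely a transposition.\<close>
  also have "\<dots> = transpose j (r \<cdot> l) (sharp_at j a ?i l \<bullet> [cap l])"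
    by (rule transpose_vert[OF jrl transpose_comp(1)[OF ll jrl s'(1) c(1)]])
  also have "\<dots> = act l l (asharp j a ?i l (hom_cell l l)) ?i ?i (tcell_id l)"
    using transpose_comp(2)[OF ll jrl s'(1) c(1)] s'(2) c(2) radj_tight by simp
  also have "\<dots> = asharp j a ?i l (tcell_id l)"
    using act_asharp[of ?i l l l "hom_cell l l" "tcell_id l" ?i "[]" ?i] radj_tight B ll
        elt_hom_cell[OF ll]
      elt_tcell_id[of l] act_hom_cell[OF ll, of "tcell_id l" ?i "[]" ?i] by simp
  finally show "runit (induced_rmonad j a) = asharp j a ?i l (tcell_id l)" .
qed

end

section \<open>Composition of relative adjunctions on elements\<close>

text \<open>The transpose of the composite \<sharp> is \<sharp>' applied to \<sharp> of a generic
  element. Evaluation at \<alpha> passes through \<sharp>' and then \<sharp>, and reaches the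
  generic element, where it leaves \<alpha>. For \<flat> the order is reversed.\<close>

lemma radj_comp_simps:
  assumes a: "radj_data j a" and a': "radj_data j' a'" and l': "l' \<in> Tight X" "tcod X l' = tdom X j"
    and ladj: "ladj a' = j \<cdot> l'"
  shows "ladj (radj_comp j l' j' a' a) = ladj a \<cdot> l'"
    "radj (radj_comp j l' j' a' a) = radj a' \<cdot> radj a"
    and "radj_data j' (radj_comp j l' j' a' a)"
    and "\<lbrakk>elt \<alpha> (ladj a \<cdot> (l' \<cdot> x)) ps y; x \<in> Tight X; tcod X x = tdom X j'; tcod X y = tcod X
      (ladj a)\<rbrakk> \<Longrightarrow>
      asharp j' (radj_comp j l' j' a' a) x y \<alpha> = asharp j' a' x (radj a \<cdot> y)
        (asharp j a (l' \<cdot> x) y \<alpha>)"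
    and "\<lbrakk>elt \<beta> (j' \<cdot> x) ps (radj a' \<cdot> (radj a \<cdot> y)); x \<in> Tight X; tcod X x = tdom X j'; y \<in> Tight
      X;
        tcod X y = tcod X (ladj a)\<rbrakk> \<Longrightarrow>
      aflat j' (radj_comp j l' j' a' a) x y \<beta> = aflat j a (l' \<cdot> x) y (aflat j' a' x (radj a \<cdot> y) \<beta>)"
proof -
  let ?l = "ladj a" and ?r = "radj a" and ?r' = "radj a'" and ?A = "tdom X j'" and ?C
    = "tcod X (ladj a)"
  let ?i = "tid X ?A" and ?i' = "tid X ?C" and ?c = "radj_comp j l' j' a' a"
  note t = radj_tight[OF a] and t' = radj_tight[OF a', unfolded ladj]
  have A: "?A \<in> Obj X" and C: "?C \<in> Obj X" using t t' by auto
  have dl': "tdom X l' = ?A" using t'(4) l' t by simp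
  show lr: "ladj ?c = ?l \<cdot> l'" "radj ?c = ?r' \<cdot> ?r" by (simp_all add: radj_comp_def Let_def)
  have cc: "tcod X (?l \<cdot> l') = ?C" using l' t by simp
  have p: "cospan (?l \<cdot> l') ?i'" "cospan (j \<cdot> l') ?r" "cospan j' (?r' \<cdot> ?r)"
    using t t' l' C by auto
  have sh: "sharp ?c = sharp_at j' a' ?i ?r \<bullet> [sharp_at j a l' ?i']"
    and fl: "flat ?c = flat_at j a l' ?i' \<bullet> [flat_at j' a' ?i ?r]"
    by (simp_all add: radj_comp_def Let_def)
  have s1: "globular (sharp_at j a l' ?i') [hom (?l \<cdot> l') ?i'] (hom (j \<cdot> l') ?r)"
    "transpose (j \<cdot> l') ?r (sharp_at j a l' ?i') = asharp j a l' ?i' (hom_cell (?l \<cdot> l') ?i')"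
    using transpose_sharp_at[OF a, of l' ?i'] t l' C by auto
  have f1: "globular (flat_at j a l' ?i') [hom (j \<cdot> l') ?r] (hom (?l \<cdot> l') ?i')"
    "transpose (?l \<cdot> l') ?i' (flat_at j a l' ?i') = aflat j a l' ?i' (hom_cell (j \<cdot> l') ?r)"
    using transpose_flat_at[OF a, of l' ?i'] t l' C by auto
  have s2: "globular (sharp_at j' a' ?i ?r) [hom (j \<cdot> l') ?r] (hom j' (?r' \<cdot> ?r))"
    "transpose j' (?r' \<cdot> ?r) (sharp_at j' a' ?i ?r) = asharp j' a' ?i ?r (hom_cell (j \<cdot> l') ?r)"
    using transpose_sharp_at[OF a', of ?i ?r] t t' l' A ladj by auto
  have f2: "globular (flat_at j' a' ?i ?r) [hom j' (?r' \<cdot> ?r)] (hom (j \<cdot> l') ?r)"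
    "transpose (j \<cdot> l') ?r (flat_at j' a' ?i ?r) = aflat j' a' ?i ?r (hom_cell j' (?r' \<cdot> ?r))"
    using transpose_flat_at[OF a', of ?i ?r] t t' l' A ladj by auto
  have gs: "globular (sharp ?c) [hom (?l \<cdot> l') ?i'] (hom j' (?r' \<cdot> ?r))"
    and gf: "globular (flat ?c) [hom j' (?r' \<cdot> ?r)] (hom (?l \<cdot> l') ?i')"
    using transpose_comp(1)[OF p(2,3) s2(1) s1(1)] transpose_comp(1)[OF p(2,1) f1(1) f2(1)]
        unfolding sh fl by auto
  show "radj_data j' ?c"
    using gs gf t t' l' by (auto simp: radj_data_def lr cc dl')
  show "asharp j' ?c x y \<alpha> = asharp j' a' x (?r \<cdot> y) (asharp j a (l' \<cdot> x) y \<alpha>)"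
    if \<alpha>: "elt \<alpha> (?l \<cdot> (l' \<cdot> x)) ps y" and x: "x \<in> Tight X" "tcod X x = ?A" and y: "tcod X y = ?C"
  proof -
    note y' = elt_frame[OF \<alpha>]
    let ?h = "hom_cell (?l \<cdot> l') ?i'"
    let ?\<theta> = "asharp j a l' ?i' ?h"
    have h: "elt ?h (?l \<cdot> l') [hom (?l \<cdot> l') ?i'] ?i'" by (rule elt_hom_cell[OF p(1)])
    have \<alpha>': "elt \<alpha> ((?l \<cdot> l') \<cdot> x) ps (?i' \<cdot> y)"
      using \<alpha> tcomp_assoc'[of x l' ?l] x y y' l' t dl' by simp
    have \<theta>: "elt ?\<theta> (j \<cdot> l') [hom (?l \<cdot> l') ?i'] ?r"
      using elt_asharp[OF a h] l' C t by simp
    note kk = elt_hom_cell[OF p(2)]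
    have "transpose j' (?r' \<cdot> ?r) (sharp ?c) = act (j \<cdot> l') ?r
        (asharp j' a' ?i ?r (hom_cell (j \<cdot> l') ?r))
        (tid X (tdom X (j \<cdot> l'))) (tid X (tdom X ?r)) ?\<theta>"
      using transpose_comp(2)[OF p(2,3) s2(1) s1(1)] unfolding sh s2(2) s1(2) .
    also have "\<dots> = asharp j' a' ?i ?r ?\<theta>"
      using act_asharp[OF a', of ?i ?r "j \<cdot> l'" ?r "hom_cell (j \<cdot> l') ?r" ?\<theta> ?i _ ?i'] \<theta> p(2) kk A
          C t t' l' dl' ladj
        act_hom_cell[OF p(2), of ?\<theta> ?i _ ?i'] by simp
    finally have 1: "transpose j' (?r' \<cdot> ?r) (sharp ?c) = asharp j' a' ?i ?r ?\<theta>" .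
    have "act (?l \<cdot> l') ?i' (asharp j' a' ?i ?r ?\<theta>) x y \<alpha> = asharp j' a' (?i \<cdot> x) (?r \<cdot> y)
        (act (?l \<cdot> l') ?i' ?\<theta> x y \<alpha>)"
      by (rule act_asharp[OF a', where ps = ps]) (use \<theta> \<alpha>' p(1) A C t t' l' dl' ladj x y y' in auto)
    also have "act (?l \<cdot> l') ?i' ?\<theta> x y \<alpha> = asharp j a (l' \<cdot> x) (?i' \<cdot> y)
        (act (?l \<cdot> l') ?i' ?h x y \<alpha>)"
      by (rule act_asharp[OF a, where ps = ps]) (use h \<alpha>' p(1) A C t t' l' dl' x y y' in auto)
    also have "act (?l \<cdot> l') ?i' ?h x y \<alpha> = \<alpha>"
      by (rule act_hom_cell[OF p(1) \<alpha>']) (use A C t t' l' dl' x y y' in auto)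
    finally show ?thesis unfolding asharp_def[of j' ?c] lr 1 cc using x y y' C by simp
  qed
  show "aflat j' ?c x y \<beta> = aflat j a (l' \<cdot> x) y (aflat j' a' x (?r \<cdot> y) \<beta>)"
    if \<beta>: "elt \<beta> (j' \<cdot> x) ps (?r' \<cdot> (?r \<cdot> y))" and x: "x \<in> Tight X" "tcod X x = ?A" and y:
      "y \<in> Tight X" "tcod X y = ?C"
  proof -
    let ?h = "hom_cell j' (?r' \<cdot> ?r)"
    let ?\<theta> = "aflat j' a' ?i ?r ?h"
    note h = elt_hom_cell[OF p(3)]
    have \<beta>': "elt \<beta> (j' \<cdot> x) ps ((?r' \<cdot> ?r) \<cdot> y)"
      using \<beta> tcomp_assoc'[of y ?r ?r'] x y l' t t' by simp
    have \<theta>: "elt ?\<theta> (j \<cdot> l') [hom j' (?r' \<cdot> ?r)] ?r"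
      using elt_aflat[OF a', of ?h ?i _ ?r] h l' A t t' ladj by simp
    note kk = elt_hom_cell[OF p(2)]
    have "transpose (?l \<cdot> l') ?i' (flat ?c) = act (j \<cdot> l') ?r
        (aflat j a l' ?i' (hom_cell (j \<cdot> l') ?r))
        (tid X (tdom X (j \<cdot> l'))) (tid X (tdom X ?r)) ?\<theta>"
      using transpose_comp(2)[OF p(2,1) f1(1) f2(1)] unfolding fl f1(2) f2(2) .
    also have "\<dots> = aflat j a l' ?i' ?\<theta>"
      using act_aflat[OF a, of l' ?i' "j \<cdot> l'" ?r "hom_cell (j \<cdot> l') ?r" ?\<theta> ?i _ ?i'] \<theta> p(2) kk A C
          t t' l' dl'
        act_hom_cell[OF p(2), of ?\<theta> ?i _ ?i'] by simp
    finally have 1: "transpose (?l \<cdot> l') ?i' (flat ?c) = aflat j a l' ?i' ?\<theta>" .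
    have "act j' (?r' \<cdot> ?r) (aflat j a l' ?i' ?\<theta>) x y \<beta> = aflat j a (l' \<cdot> x) (?i' \<cdot> y)
        (act j' (?r' \<cdot> ?r) ?\<theta> x y \<beta>)"
      by (rule act_aflat[OF a, where ps = ps]) (use \<theta> \<beta>' p(3) A C t t' l' dl' x y in auto)
    also have "act j' (?r' \<cdot> ?r) ?\<theta> x y \<beta> = aflat j' a' (?i \<cdot> x) (?r \<cdot> y)
        (act j' (?r' \<cdot> ?r) ?h x y \<beta>)"
      by (rule act_aflat[OF a', where ps = ps]) (use h \<beta>' p(3) A C t t' l' dl' ladj x y in auto)
    also have "act j' (?r' \<cdot> ?r) ?h x y \<beta> = \<beta>"
      by (rule act_hom_cell[OF p(3) \<beta>']) (use A C t t' l' dl' x y in auto)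
    finally show ?thesis unfolding aflat_def[of j' ?c] lr 1 cc using x y C by simp
  qed
qed

section \<open>Relative monads\<close>

text \<open>The typing of a relative monad without its laws; the frame of the unit already fixes the
  typing of the carrier.\<close>

definition rmonad_data :: "'t \<Rightarrow> ('t, 'c) rmonad \<Rightarrow> bool" where
  "rmonad_data j T \<longleftrightarrow> elt (runit T) j [] (carrier T) \<and>
     globular (extension T) [hom j (carrier T)] (hom (carrier T) (carrier T))"

definition ext :: "('t, 'c) rmonad \<Rightarrow> 'c" where
  "ext T = transpose (carrier T) (carrier T) (extension T)"

definition bind :: "'t \<Rightarrow> ('t, 'c) rmonad \<Rightarrow> 't \<Rightarrow> 't \<Rightarrow> 'c \<Rightarrow> 'c" where
  "bind j T = act j (carrier T) (ext T)"

text \<open>Equality of functors is equality of values, so monads must be compared as records. The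
  extension operator is recovered from \<open>ext\<close> by \<open>transpose_inj\<close>.\<close>

lemma rmonad_eqI:
  assumes "rmonad_data j T" "rmonad_data j T'" "carrier T = carrier T'" "runit T = runit T'"
    "ext T = ext T'"
  shows "T = T'"
proof -
  have "cospan (carrier T) (carrier T)" using elt_frame[of "runit T" j "[]" "carrier T"] assms(1)
      by (simp add: rmonad_data_def)
  then have "extension T = extension T'"
    using transpose_inj assms by (auto simp: rmonad_data_def ext_def)
  then show ?thesis using assms(3,4) by simp
qed

context
  fixes j T t
  assumes T: "rmonad_data j T"
  defines "t \<equiv> carrier T"
begin

lemma rmonad_tight: "j \<in> Tight X" "t \<in> Tight X" "tdom X t = tdom X j" "tcod X t = tcod X j"
  and rmonad_cospan: "cospan j t" "cospan t t"
  using T elt_frame[of "runit T" j "[]" t] elt_frame0[of "runit T" j t] by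
      (auto simp: rmonad_data_def t_def)

lemma elt_runit: "elt (runit T) j [] t"
  and globular_extension: "globular (extension T) [hom j t] (hom t t)"
  using T by (auto simp: rmonad_data_def t_def)

lemma elt_ext: "elt (ext T) t [hom j t] t"
  using elt_tr[OF rmonad_cospan(2) globular_extension] by (simp add: ext_def t_def)

lemma bind_eq: "bind j T = act j t (ext T)"
  by (simp add: bind_def t_def)

lemma elt_bind:
  assumes "elt \<alpha> (j \<cdot> x) ps (t \<cdot> y)" "x \<in> Tight X" "y \<in> Tight X" "tcod X x = tdom X j"
    "tcod X y = tdom X j"
  shows "elt (bind j T x y \<alpha>) (t \<cdot> x) ps (t \<cdot> y)"
  unfolding bind_eq by (rule elt_act[OF rmonad_cospan(1) elt_ext]) (use assms rmonad_tight in auto)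

lemma bind_generic: "bind j T (tid X (tdom X j)) (tid X (tdom X j)) (hom_cell j t) = ext T"
  using act_generic[OF rmonad_cospan(1) elt_ext] rmonad_tight by (simp add: bind_eq)

text \<open>Each of the three equations of globular 2-cells is transposed. The first and third
  become laws at the generic element \<open>hom_cell j t\<close>, and the second is the value of the
  operator at the unit.\<close>

lemma relative_monad_iff:
  "relative_monad j T \<longleftrightarrow>
    runit T \<star> ext T = hom_cell j t \<and>
    bind j T (tid X (tdom X j)) (tid X (tdom X j)) (runit T) = tcell_id t \<and>
    ext T \<star> ext T = bind j T (tid X (tdom X j)) (tid X (tdom X j)) (hom_cell j t \<star> ext T)"
proof -
  let ?i = "tid X (tdom X j)"
  note g = globular_extension and p = rmonad_cospan and tt = rmonad_tight
  note pre = transpose_hom_pre_comp[OF elt_runit p(2) g] and c = transpose_cid[OF p(1)] and cap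
      = transpose_cap[OF tt(1)]
  note post = transpose_hom_post_comp[OF elt_runit _ cap(1), simplified cap(2)]
  have jj: "cospan j j" using tt by simp
  note post = transpose_hom_post_comp[OF elt_runit jj cap(1), unfolded cap(2)
      star_one(1)[OF elt_runit]]
  note e2 = transpose_comp[OF p(1,2) g post(1), unfolded post(2), folded
      ext_def[of T, folded t_def]]
  note cup = transpose_cup_at[OF p(2) p(2) g g] and cup' = transpose_cup_at[OF p c(1) g]
  note e3 = transpose_comp[OF p(1,2) g cup'(1), unfolded cup'(2) c(2)]
  note ct = transpose_cap[OF tt(2)]
  have "hom_pre (runit T) t \<bullet> [extension T] = cid X (hom j t) \<longleftrightarrow> runit T \<star> ext T = hom_cell j t"
    using transpose_eq_iff[OF p(1) pre(1) c(1)] pre(2) c(2) by (simp add: ext_def t_def)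
  moreover have "extension T \<bullet> [hom_post j (runit T) \<bullet> [cap j]] = cap t \<longleftrightarrow> bind j T ?i ?i (runit T)
      = tcell_id t"
    using transpose_eq_iff[OF p(2) e2(1) ct(1)] e2(2) ct(2) tt(3) by (simp add: bind_eq)
  moreover have "cup_at t t t \<bullet> [extension T, extension T]
       = extension T \<bullet> [cup_at t j t \<bullet> [cid X (hom j t), extension T]] \<longleftrightarrow>
     ext T \<star> ext T = bind j T ?i ?i (hom_cell j t \<star> ext T)"
    using transpose_eq_iff[OF p(2) cup(1),
        of "extension T \<bullet> [cup_at t j t \<bullet> [cid X (hom j t), extension T]]"] e3 cup(2) tt(3)
    by (simp add: bind_eq ext_def flip: t_def)
  ultimately show ?thesis
    unfolding relative_monad_def t_def[symmetric] tcell_iff_elt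
    using g elt_runit tt by (simp add: tight_def)
qed

lemma bind_unit_left:
  assumes "relative_monad j T"
    and "elt \<alpha> (j \<cdot> x) ps (t \<cdot> y)" "x \<in> Tight X" "y \<in> Tight X" "tcod X x = tdom X j"
      "tcod X y = tdom X j"
  shows "(runit T \<lhd> x) \<star> bind j T x y \<alpha> = \<alpha>"
  using act_tcell_star[OF rmonad_cospan(1) elt_ext elt_runit assms(2-5)] rmonad_tight assms
    act_hom_cell[OF rmonad_cospan(1) assms(2-5)] relative_monad_iff by (simp add: bind_eq)

lemma bind_runit:
  assumes "relative_monad j T" "x \<in> Tight X" "tcod X x = tdom X j"
  shows "bind j T x x (runit T \<lhd> x) = tcell_id (t \<cdot> x)"
proof -
  let ?i = "tid X (tdom X j)"
  have i: "?i \<in> Tight X" "tdom X ?i = tdom X j" "tcod X ?i = tdom X j" using rmonad_tight by auto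
  have "bind j T ?i ?i (runit T) \<lhd> x = bind j T x x (runit T \<lhd> x)"
    using act_subst[OF rmonad_cospan(1) elt_ext _ i(1) i(1) _ _ chain_Nil[OF assms(2)],
        of "runit T"]
      elt_runit rmonad_tight assms i by (simp add: bind_eq)
  then show ?thesis
    using assms relative_monad_iff tcell_id_pre[of t x] rmonad_tight by simp
qed

text \<open>The third law in \<open>relative_monad_iff\<close> has two occurrences of D(j,t) in its
  stage. Substituting the lift of \<alpha> for one and that of \<beta> for the other yields the law
  for arbitrary elements.\<close>

lemma bind_star:
  assumes "relative_monad j T" "elt \<alpha> (j \<cdot> x) ps (t \<cdot> y)" "elt \<beta> (j \<cdot> y) qs (t \<cdot> z)"
    and "x \<in> Tight X" "y \<in> Tight X" "z \<in> Tight X" "tcod X x = tdom X j" "tcod X y = tdom X j"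
      "tcod X z = tdom X j"
  shows "bind j T x y \<alpha> \<star> bind j T y z \<beta> = bind j T x z (\<alpha> \<star> bind j T y z \<beta>)"
proof -
  let ?i = "tid X (tdom X j)" and ?h = "hom_cell j t"
  have i: "?i \<in> Tight X" "tdom X ?i = tdom X j" "tcod X ?i = tdom X j" using rmonad_tight by auto
  note t = rmonad_tight and p = rmonad_cospan(1)
  let ?l = "lift (lid (tcod X j)) j t x y \<alpha>" and ?m = "lift (lid (tcod X j)) j t y z \<beta>"
  have l: "chain x [?l] y [hom j t] ps" and m: "chain y [?m] z [hom j t] qs"
    by (rule chain_lift[OF p]; use assms t in simp)+
  have la: "ccomp X ?h x [?l] = \<alpha>"
    by (rule lift_props(2)[OF p]) (use assms t in auto)
  have h: "elt (?h \<star> ext T) (j \<cdot> ?i) [hom j t, hom j t] (t \<cdot> ?i)"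
    using elt_star[OF elt_hom_cell[OF p] elt_ext] t by simp
  have "bind j T x y \<alpha> \<star> bind j T y z \<beta> = ccomp X (ext T \<star> ext T) x [?l, ?m]"
    using star_subst[OF elt_ext elt_ext l m] assms t by (simp add: bind_eq act_def)
  also have "\<dots> = ccomp X (bind j T ?i ?i (?h \<star> ext T)) x [?l, ?m]"
    using assms(1) relative_monad_iff by simp
  also have "\<dots> = bind j T x z (ccomp X (?h \<star> ext T) x [?l, ?m])"
    using act_subst[OF p elt_ext h i(1,1) _ _ chain_append[OF l m, simplified]] assms t i by
        (simp add: bind_eq)
  also have "ccomp X (?h \<star> ext T) x [?l, ?m] = \<alpha> \<star> bind j T y z \<beta>"
    using star_subst[OF elt_hom_cell[OF p] elt_ext l m] assms la by (simp add: bind_eq act_def)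
  finally show ?thesis .
qed

end

section \<open>Morphisms of relative monads and their category\<close>

context
  fixes j T T' t t'
  assumes T: "rmonad_data j T" and T': "rmonad_data j T'"
  defines "t \<equiv> carrier T" and "t' \<equiv> carrier T'"
begin

lemma rmonad_morphism_iff:
  "rmonad_morphism j T T' \<tau> \<longleftrightarrow> elt \<tau> t [] t' \<and> runit T \<star> \<tau> = runit T' \<and>
    ext T \<star> \<tau> = \<tau> \<star> bind j T' (tid X (tdom X j)) (tid X (tdom X j)) (hom_cell j t \<star> \<tau>)"
proof (cases "elt \<tau> t [] t'")
  case \<tau>: True
  note tt = rmonad_tight[OF T] rmonad_tight[OF T'] and p = rmonad_cospan[OF T, folded t_def] and p'
      = rmonad_cospan[OF T', folded t'_def]
  note g = globular_extension[OF T, folded t_def] and g' = globular_extension[OF T', folded t'_def]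
  have tt': "cospan t t'" using p p' by simp
  note post = transpose_hom_post[OF \<tau> p(1)]
  note e = transpose_comp[OF p' g' post(1), unfolded post(2), folded ext_def[of T', folded t'_def]]
  note pre = transpose_hom_pre_comp[OF \<tau> p'(2) e(1), unfolded e(2)]
  note po = transpose_hom_post_comp[OF \<tau> p(2) g]
  show ?thesis
    unfolding rmonad_morphism_def tcell_iff_elt t_def[symmetric] t'_def[symmetric]
    using \<tau> transpose_eq_iff[OF tt' po(1) pre(1)] po(2) pre(2) tt by
        (simp add: bind_def ext_def t_def t'_def)
qed (auto simp: rmonad_morphism_def tcell_iff_elt t_def t'_def)

text \<open>The law in \<open>rmonad_morphism_iff\<close> is the case of a generic element; the lift
  of \<alpha> is substituted into it.\<close>

lemma bind_morphism:
  assumes "rmonad_morphism j T T' \<tau>"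
    and "elt \<alpha> (j \<cdot> x) ps (t \<cdot> y)" "x \<in> Tight X" "y \<in> Tight X" "tcod X x = tdom X j"
      "tcod X y = tdom X j"
  shows "bind j T x y \<alpha> \<star> (\<tau> \<lhd> y) = (\<tau> \<lhd> x) \<star> bind j T' x y (\<alpha> \<star> (\<tau> \<lhd> y))"
proof -
  let ?i = "tid X (tdom X j)" and ?h = "hom_cell j t"
  note tt = rmonad_tight[OF T, folded t_def] rmonad_tight[OF T', folded t'_def]
    and p = rmonad_cospan[OF T, folded t_def] and p' = rmonad_cospan[OF T', folded t'_def]
  note e = elt_ext[OF T, folded t_def] and e' = elt_ext[OF T', folded t'_def]
  have i: "?i \<in> Tight X" "tdom X ?i = tdom X j" "tcod X ?i = tdom X j" using tt by auto
  have \<tau>: "elt \<tau> t [] t'" and eq: "ext T \<star> \<tau> = \<tau> \<star> bind j T' ?i ?i (?h \<star> \<tau>)"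
    using assms(1) unfolding rmonad_morphism_iff by auto
  let ?l = "lift (lid (tcod X j)) j t x y \<alpha>"
  have l: "chain x [?l] y [hom j t] ps"
    by (rule chain_lift[OF p(1)]; use assms tt in simp)+
  have la: "ccomp X ?h x [?l] = \<alpha>"
    by (rule lift_props(2)[OF p(1)]) (use assms tt in auto)
  have h: "elt (?h \<star> \<tau>) (j \<cdot> ?i) [hom j t] (t' \<cdot> ?i)"
    using elt_star[OF elt_hom_cell[OF p(1)] \<tau>] tt by simp
  have b: "elt (bind j T' ?i ?i (?h \<star> \<tau>)) t' [hom j t] t'"
    using elt_bind[OF T', of "?h \<star> \<tau>" ?i _ ?i] h i tt by (simp add: t'_def)
  have "bind j T x y \<alpha> \<star> (\<tau> \<lhd> y) = ccomp X (ext T \<star> \<tau>) x [?l]"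
    using star_subst_left[OF e \<tau> l] assms tt by (simp add: bind_def act_def t_def)
  also have "\<dots> = ccomp X (\<tau> \<star> bind j T' ?i ?i (?h \<star> \<tau>)) x [?l]" using eq by simp
  also have "\<dots> = (\<tau> \<lhd> x) \<star> ccomp X (bind j T' ?i ?i (?h \<star> \<tau>)) x [?l]"
    using star_subst_right[OF \<tau> b l] assms tt by simp
  also have "ccomp X (bind j T' ?i ?i (?h \<star> \<tau>)) x [?l] = bind j T' x y (ccomp X (?h \<star> \<tau>) x [?l])"
    using act_subst[OF p'(1) e' h i(1,1) _ _ l] assms tt i by (simp add: bind_def t'_def)
  also have "ccomp X (?h \<star> \<tau>) x [?l] = \<alpha> \<star> (\<tau> \<lhd> y)"
    using star_subst_left[OF elt_hom_cell[OF p(1)] \<tau> l] assms la by simp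
  finally show ?thesis .
qed

end

lemma relative_monad_data: "relative_monad j T \<Longrightarrow> rmonad_data j T"
  by (simp add: relative_monad_def rmonad_data_def tcell_iff_elt)

lemma category_RMnd: "category (RMnd j)"
proof
  fix x assume "x \<in> Ob (RMnd j)"
  then have m: "relative_monad j x" by (simp add: RMnd_def)
  note x = relative_monad_data[OF m]
  note t = rmonad_tight[OF x] and p = rmonad_cospan[OF x]
  have "rmonad_morphism j x x (tcell_id (carrier x))"
    using rmonad_morphism_iff[OF x x] elt_tcell_id[OF t(2)] star_one[OF elt_ext[OF x]]
        star_one(2)[OF elt_runit[OF x]]
      star_one(2)[OF elt_hom_cell[OF p(1)]] bind_generic[OF x] by simp
  then show "Idn (RMnd j) x \<in> Hom (RMnd j) x x" by (simp add: RMnd_def)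
next
  fix x y z f g
  assume "x \<in> Ob (RMnd j)" "y \<in> Ob (RMnd j)" "z \<in> Ob (RMnd j)" "f \<in> Hom (RMnd j) x y"
    "g \<in> Hom (RMnd j) y z"
  then have x: "rmonad_data j x" and y: "rmonad_data j y" and z: "rmonad_data j z"
    and f': "rmonad_morphism j x y f" and g': "rmonad_morphism j y z g"
    using relative_monad_data by (auto simp: RMnd_def)
  let ?i = "tid X (tdom X j)" and ?h = "hom_cell j (carrier x)"
  note t = rmonad_tight[OF x] rmonad_tight[OF y] rmonad_tight[OF z] and p = rmonad_cospan[OF x]
  have f: "elt f (carrier x) [] (carrier y)" "runit x \<star> f = runit y"
      "ext x \<star> f = f \<star> bind j y ?i ?i (?h \<star> f)"
    using f' rmonad_morphism_iff[OF x y] by auto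
  have g: "elt g (carrier y) [] (carrier z)" "runit y \<star> g = runit z"
    using g' rmonad_morphism_iff[OF y z] by auto
  note h = elt_hom_cell[OF p(1)]
  have hf: "elt (?h \<star> f) (j \<cdot> ?i) [hom j (carrier x)] (carrier y \<cdot> ?i)"
    using elt_star[OF h f(1)] t by simp
  have b: "elt (bind j y ?i ?i (?h \<star> f)) (carrier y) [hom j (carrier x)] (carrier y)"
    using elt_bind[OF y hf] t by simp
  have hfg: "elt (?h \<star> f \<star> g) (j \<cdot> ?i) [hom j (carrier x)] (carrier z \<cdot> ?i)"
    using elt_star[OF elt_star[OF h f(1)] g(1)] t by simp
  have b': "elt (bind j z ?i ?i (?h \<star> f \<star> g)) (carrier z) [hom j (carrier x)] (carrier z)"
    using elt_bind[OF z hfg] t by simp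
  have gi: "g \<lhd> ?i = g" using tcell_tid_right[OF g(1)] t by simp
  have "ext x \<star> (f \<star> g) = f \<star> bind j y ?i ?i (?h \<star> f) \<star> g"
    using star_assoc[OF elt_ext[OF x] f(1) g(1)] f(3) by simp
  also have "\<dots> = f \<star> (bind j y ?i ?i (?h \<star> f) \<star> g)"
    using star_assoc[OF f(1) b g(1)] .
  \<comment> \<open>Here the law for \<open>g\<close> is needed at the element
    \<open>?h \<star> f\<close>, which is not generic; hence the use of
    \<open>bind_morphism\<close>.\<close>
  also have "\<dots> = f \<star> (g \<star> bind j z ?i ?i (?h \<star> f \<star> g))"
    using bind_morphism[OF y z g' hf] gi t by simp
  also have "\<dots> = f \<star> g \<star> bind j z ?i ?i (?h \<star> (f \<star> g))"
    using star_assoc[OF f(1) g(1) b'] star_assoc[OF h f(1) g(1)] by simp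
  finally have "rmonad_morphism j x z (f \<star> g)"
    using rmonad_morphism_iff[OF x z] elt_star[OF f(1) g(1)]
        star_assoc[OF elt_runit[OF x] f(1) g(1)] f(2) g(2)
    by simp
  then show "Cmp (RMnd j) x y z g f \<in> Hom (RMnd j) x z" by (simp add: RMnd_def)
next
  fix x y f assume "f \<in> Hom (RMnd j) x y"
  then have "elt f (carrier x) [] (carrier y)" by (simp add: RMnd_def rmonad_morphism_def
      tcell_iff_elt)
  then show "Cmp (RMnd j) x x y f (Idn (RMnd j) x) = f" "Cmp (RMnd j) x y y (Idn (RMnd j) y) f = f"
    using star_one by (simp_all add: RMnd_def)
next
  fix w x y z f g h assume "f \<in> Hom (RMnd j) w x" "g \<in> Hom (RMnd j) x y" "h \<in> Hom (RMnd j) y z"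
  then show "Cmp (RMnd j) w x z (Cmp (RMnd j) x y z h g) f = Cmp (RMnd j) w y z h
      (Cmp (RMnd j) w x y g f)"
    using star_assoc[of f "carrier w" "[]" "carrier x" g "[]" "carrier y" h "[]" "carrier z"]
    by (simp add: RMnd_def rmonad_morphism_def tcell_iff_elt)
qed

section \<open>Relative monads induced by relative adjunctions\<close>

lemma induced_rmonad_data:
  assumes "radj_data j a"
  shows "rmonad_data j (induced_rmonad j a)"
proof -
  note t = radj_tight[OF assms] and s = induced_rmonad_simps[OF assms]
  have "elt (asharp j a (tid X (tdom X j)) (ladj a) (tcell_id (ladj a))) j [] (radj a \<cdot> ladj a)"
    using elt_asharp[OF assms, of "tcell_id (ladj a)" "tid X (tdom X j)"] elt_tcell_id[of "ladj a"]
        t by simp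
  then show ?thesis using s by (simp add: rmonad_data_def)
qed

lemma ext_induced_rmonad:
  assumes "radj_data j a"
  shows "ext (induced_rmonad j a)
    = whisker_left (radj a) (aflat j a (tid X (tdom X j)) (ladj a) (hom_cell j (radj a \<cdot> ladj a)))"
  using induced_rmonad_simps[OF assms] by (simp add: ext_def)

text \<open>Evaluation at \<beta> passes through the whiskering by r and through \<flat>, and turns
  the generic element into \<beta>. Thus the operator is r\<flat> at every element.\<close>

lemma bind_induced_rmonad:
  assumes a: "radj_data j a" and \<beta>: "elt \<beta> (j \<cdot> x) ps (radj a \<cdot> (ladj a \<cdot> y))"
    and x: "x \<in> Tight X" "tcod X x = tdom X j" and y: "y \<in> Tight X" "tcod X y = tdom X j"
  shows "bind j (induced_rmonad j a) x y \<beta> = whisker_left (radj a) (aflat j a x (ladj a \<cdot> y) \<beta>)"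
proof -
  let ?r = "radj a" and ?l = "ladj a" and ?i = "tid X (tdom X j)"
  let ?c = "?r \<cdot> ?l"
  let ?h = "hom_cell j ?c"
  note t = radj_tight[OF a]
  have B: "tdom X j \<in> Obj X" using t by auto
  have p: "cospan j ?c" using t by simp
  note h = elt_hom_cell[OF p]
  have \<beta>': "elt \<beta> (j \<cdot> x) ps (?c \<cdot> y)" using \<beta> tcomp_assoc'[of y ?l ?r] t y by simp
  have f: "elt (aflat j a ?i ?l ?h) ?l [hom j ?c] ?l"
    using elt_aflat[OF a, of ?h ?i _ ?l] h t B by simp
  have "bind j (induced_rmonad j a) x y \<beta> = act j ?c (whisker_left ?r (aflat j a ?i ?l ?h)) x y \<beta>"
    using ext_induced_rmonad[OF a] induced_rmonad_simps(1)[OF a] by (simp add: bind_def)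
  also have "\<dots> = whisker_left ?r (act j ?c (aflat j a ?i ?l ?h) x y \<beta>)"
    by (rule act_whisker_left[OF p f _ _ \<beta>']) (use t x y in auto)
  also have "act j ?c (aflat j a ?i ?l ?h) x y \<beta> = aflat j a (?i \<cdot> x) (?l \<cdot> y) (act j ?c ?h x y \<beta>)"
    by (rule act_aflat[OF a, where ps = ps]) (use t x y B p h \<beta>' in auto)
  also have "act j ?c ?h x y \<beta> = \<beta>"
    by (rule act_hom_cell[OF p \<beta>']) (use t x y in auto)
  finally show ?thesis using x by simp
qed

section \<open>Transport along a relative adjunction\<close>

text \<open>The operator \<beta> \<mapsto> r'((\<flat>'\<beta>)\<dagger>) is encoded by its value at
  the generic element \<beta> = \<open>hom_cell j' c\<close>, turned back into a globular 2-cell by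
  \<open>hom_lift\<close>.\<close>

definition transport :: "'t \<Rightarrow> 't \<Rightarrow> 't \<Rightarrow> ('t, 'c) radjunction \<Rightarrow> ('t, 'c) rmonad \<Rightarrow> ('t, 'c) rmonad"
  where
  "transport j l' j' a' T =
     (let t = carrier T; c = radj a' \<cdot> t \<cdot> l'; i = tid X (tdom X j') in
      \<lparr>carrier = c,
       extension = hom_lift c c
         (whisker_left (radj a') (bind j T l' l' (aflat j' a' i (t \<cdot> l') (hom_cell j' c)))),
       runit = asharp j' a' i (t \<cdot> l') (runit T \<lhd> l')\<rparr>)"

definition transport_functor :: "'t \<Rightarrow> 't \<Rightarrow> 't \<Rightarrow> ('t, 'c) radjunction \<Rightarrow>
    (('t, 'c) rmonad, 'c, ('t, 'c) rmonad, 'c) functor_data" where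
  "transport_functor j l' j' a' = \<lparr>FOb = transport j l' j' a',
     FHom = (\<lambda>_ _ \<tau>. whisker_right (whisker_left (radj a') \<tau>) l')\<rparr>"

context
  fixes j l' j' a' r'
  assumes a': "relative_adjunction j' a'" and ladj_a': "ladj a' = j \<cdot> l'"
    and j: "j \<in> Tight X" and l': "l' \<in> Tight X" "tcod X l' = tdom X j"
  defines "r' \<equiv> radj a'"
begin

lemma transport_adj_data: "radj_data j' a'"
  using a' by (simp add: relative_adjunction_iff)

lemmas transport_tight = radj_tight[OF transport_adj_data, unfolded ladj_a', folded r'_def]

lemma transport_simps:
  "tdom X l' = tdom X j'" "j' \<in> Tight X" "r' \<in> Tight X" "tdom X r' = tcod X j"
    "tcod X r' = tcod X j'"
  using transport_tight j l' by auto

lemma transport_tid: "tid X (tdom X j') \<in> Tight X" "tdom X (tid X (tdom X j')) = tdom X j'"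
  "tcod X (tid X (tdom X j')) = tdom X j'" "j' \<cdot> tid X (tdom X j') = j'"
    "l' \<cdot> tid X (tdom X j') = l'"
  using transport_simps l' by auto

lemmas transport_facts = transport_simps j l' transport_tid

text \<open>The calculus of \<sharp>' at the identity of the domain of \<open>j'\<close>, where
  \<open>j' \<cdot> x\<close> is just \<open>j'\<close>. The laws to be verified are stated at this
  identity.\<close>

lemma transport_asharp:
  assumes "elt \<alpha> (j \<cdot> l') ps y"
  shows "elt (asharp j' a' (tid X (tdom X j')) y \<alpha>) j' ps (r' \<cdot> y)"
    "aflat j' a' (tid X (tdom X j')) y (asharp j' a' (tid X (tdom X j')) y \<alpha>) = \<alpha>"
    "elt \<delta> y qs z \<Longrightarrow> asharp j' a' (tid X (tdom X j')) y \<alpha> \<star> whisker_left r' \<delta>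
      = asharp j' a' (tid X (tdom X j')) z (\<alpha> \<star> \<delta>)"
proof -
  have e: "elt \<alpha> (ladj a' \<cdot> tid X (tdom X j')) ps y" and y: "tcod X y = tcod X (ladj a')"
    using assms transport_facts elt_frame[OF assms] by (simp_all add: ladj_a')
  show "elt (asharp j' a' (tid X (tdom X j')) y \<alpha>) j' ps (r' \<cdot> y)"
    using elt_asharp[OF transport_adj_data e _ _ y] transport_facts by (simp add: r'_def)
  show "aflat j' a' (tid X (tdom X j')) y (asharp j' a' (tid X (tdom X j')) y \<alpha>) = \<alpha>"
    using aflat_asharp[OF transport_adj_data a' e _ _ y] transport_facts by simp
  show "asharp j' a' (tid X (tdom X j')) y \<alpha> \<star> whisker_left r' \<delta>
      = asharp j' a' (tid X (tdom X j')) z (\<alpha> \<star> \<delta>)" if "elt \<delta> y qs z"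
    using asharp_star[OF transport_adj_data e that _ _ y] transport_facts by (simp add: r'_def)
qed

lemma transport_aflat:
  assumes "elt \<beta> j' ps (r' \<cdot> y)" "y \<in> Tight X" "tcod X y = tcod X j"
  shows "elt (aflat j' a' (tid X (tdom X j')) y \<beta>) (j \<cdot> l') ps y"
    "asharp j' a' (tid X (tdom X j')) y (aflat j' a' (tid X (tdom X j')) y \<beta>) = \<beta>"
    "elt \<delta> y qs z \<Longrightarrow> aflat j' a' (tid X (tdom X j')) y \<beta> \<star> \<delta>
      = aflat j' a' (tid X (tdom X j')) z (\<beta> \<star> whisker_left r' \<delta>)"
proof -
  have e: "elt \<beta> (j' \<cdot> tid X (tdom X j')) ps (radj a' \<cdot> y)" and y: "tcod X y = tcod X (ladj a')"
    using assms transport_facts by (simp_all add: ladj_a' flip: r'_def)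
  show "elt (aflat j' a' (tid X (tdom X j')) y \<beta>) (j \<cdot> l') ps y"
    using elt_aflat[OF transport_adj_data e _ _ assms(2) y] transport_facts by (simp add: ladj_a')
  show "asharp j' a' (tid X (tdom X j')) y (aflat j' a' (tid X (tdom X j')) y \<beta>) = \<beta>"
    using asharp_aflat[OF transport_adj_data a' e _ _ assms(2) y] transport_facts by simp
  show "aflat j' a' (tid X (tdom X j')) y \<beta> \<star> \<delta>
      = aflat j' a' (tid X (tdom X j')) z (\<beta> \<star> whisker_left r' \<delta>)" if "elt \<delta> y qs z"
    using aflat_star[OF transport_adj_data e that _ _ y] transport_facts by (simp add: r'_def)
qed

context
  fixes T t c
  assumes T: "rmonad_data j T"
  defines "t \<equiv> carrier T" and "c \<equiv> r' \<cdot> (t \<cdot> l')"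
begin

lemma transport_carrier_simps:
  "t \<in> Tight X" "tdom X t = tdom X j" "tcod X t = tcod X j" "cospan j' c" "c \<in> Tight X"
    "(r' \<cdot> t) \<cdot> l' = c"
  "tdom X c = tdom X j'" "tcod X c = tcod X j'"
  using rmonad_tight[OF T, folded t_def] transport_facts tcomp_assoc'[of l' t r'] by
      (auto simp: c_def)

lemma transport_flat_hom_cell:
  "elt (aflat j' a' (tid X (tdom X j')) (t \<cdot> l') (hom_cell j' c)) (j \<cdot> l') [hom j' c] (t \<cdot> l')"
  using transport_aflat(1)[OF elt_hom_cell[OF transport_carrier_simps(4), unfolded c_def]]
    transport_carrier_simps transport_facts by (simp add: c_def)

lemma transport_bind_flat:
  "elt (bind j T l' l' (aflat j' a' (tid X (tdom X j')) (t \<cdot> l') (hom_cell j' c))) (t \<cdot> l')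
    [hom j' c] (t \<cdot> l')"
  using elt_bind[OF T, folded t_def, OF transport_flat_hom_cell] transport_facts by simp

lemma transport_runit: "elt (runit T \<lhd> l') (j \<cdot> l') [] (t \<cdot> l')"
  using elt_subst0[OF elt_runit[OF T]] transport_facts by (simp add: t_def)

lemma transport_eqs:
  "carrier (transport j l' j' a' T) = c"
  "ext (transport j l' j' a' T)
    = whisker_left r' (bind j T l' l' (aflat j' a' (tid X (tdom X j')) (t \<cdot> l') (hom_cell j' c)))"
  "runit (transport j l' j' a' T) = asharp j' a' (tid X (tdom X j')) (t \<cdot> l') (runit T \<lhd> l')"
  "rmonad_data j' (transport j l' j' a' T)"
proof -
  let ?\<psi> = "whisker_left r' (bind j T l' l' (aflat j' a' (tid X (tdom X j')) (t \<cdot> l')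
    (hom_cell j' c)))"
  have e: "elt ?\<psi> c [hom j' c] c"
    using elt_whisker_left[OF transport_bind_flat, of r'] transport_facts transport_carrier_simps
        by (simp add: c_def)
  note l = transpose_hom_lift[OF e]
  show 1: "carrier (transport j l' j' a' T) = c"
    "runit (transport j l' j' a' T) = asharp j' a' (tid X (tdom X j')) (t \<cdot> l') (runit T \<lhd> l')"
    using transport_carrier_simps(6) by (simp_all add: transport_def Let_def flip: t_def r'_def)
  have x: "extension (transport j l' j' a' T) = hom_lift c c ?\<psi>"
    using transport_carrier_simps(6) by (simp add: transport_def Let_def flip: t_def r'_def)
  show "ext (transport j l' j' a' T) = ?\<psi>" unfolding ext_def 1 x by (rule l(2))
  show "rmonad_data j' (transport j l' j' a' T)"
    unfolding rmonad_data_def 1 x using l(1) transport_asharp(1)[OF transport_runit] by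
        (simp add: c_def)
qed

text \<open>\<open>transport\<close> prescribes the operator only at the generic element. Evaluation
  at \<beta> passes in turn through the whiskering by \<open>r'\<close>, the operator of
  \<open>T\<close> and \<flat>', so the same formula holds at \<beta>.\<close>

lemma bind_transport:
  assumes "elt \<beta> j' ps c"
  shows "bind j' (transport j l' j' a' T) (tid X (tdom X j')) (tid X (tdom X j')) \<beta>
    = whisker_left r' (bind j T l' l' (aflat j' a' (tid X (tdom X j')) (t \<cdot> l') \<beta>))"
proof -
  let ?i = "tid X (tdom X j')" and ?h = "hom_cell j' c"
  let ?\<gamma> = "aflat j' a' ?i (t \<cdot> l') ?h"
  note f = transport_facts and g = transport_carrier_simps
  note p = g(4) and h = elt_hom_cell[OF g(4)]
  have i: "c \<cdot> ?i = c" "(t \<cdot> l') \<cdot> ?i = t \<cdot> l'" "?i \<cdot> ?i = ?i" using f g by auto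
  have \<beta>: "elt \<beta> (j' \<cdot> ?i) ps (c \<cdot> ?i)" using assms f i by simp
  have "bind j' (transport j l' j' a' T) ?i ?i \<beta> = act j' c (whisker_left r' (bind j T l' l' ?\<gamma>))
      ?i ?i \<beta>"
    by (simp add: bind_def transport_eqs)
  also have "\<dots> = whisker_left r' (act j' c (bind j T l' l' ?\<gamma>) ?i ?i \<beta>)"
    by (rule act_whisker_left[OF p transport_bind_flat _ _ \<beta>]) (use f g in auto)
  also have "act j' c (bind j T l' l' ?\<gamma>) ?i ?i \<beta> = bind j T (l' \<cdot> ?i) (l' \<cdot> ?i)
      (act j' c ?\<gamma> ?i ?i \<beta>)"
    unfolding bind_def t_def[symmetric]
    by (rule act_act[OF rmonad_cospan(1)[OF T, folded t_def] elt_ext[OF T, folded t_def]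
        transport_flat_hom_cell _ _ _ _ p \<beta>])
      (use f g in auto)
  also have "act j' c ?\<gamma> ?i ?i \<beta> = aflat j' a' (?i \<cdot> ?i) ((t \<cdot> l') \<cdot> ?i) (act j' c ?h ?i ?i \<beta>)"
    by (rule act_aflat[OF transport_adj_data _ _ _ _ p _ \<beta>])
      (use f g h in \<open>auto simp: ladj_a' c_def simp flip: r'_def\<close>)
  also have "act j' c ?h ?i ?i \<beta> = \<beta>"
    by (rule act_hom_cell[OF p \<beta>]) (use f g in auto)
  finally show ?thesis unfolding i f .
qed

text \<open>Each law of \<open>T\<close> combines with one property of \<sharp>' and \<flat>': the
  first with \<sharp>'\<flat>' = 1, the second with \<flat>'\<sharp>' = 1, the third with naturality
  of \<flat>'. Naturality of \<sharp>' lets the first start.\<close>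

lemma relative_monad_transport:
  assumes m: "relative_monad j T"
  shows "relative_monad j' (transport j l' j' a' T)"
proof -
  let ?i = "tid X (tdom X j')" and ?h = "hom_cell j' c" and ?N = "transport j l' j' a' T"
  let ?\<gamma> = "aflat j' a' ?i (t \<cdot> l') ?h"
  let ?\<beta> = "bind j T l' l' ?\<gamma>"
  note f = transport_facts and g = transport_carrier_simps
  note \<gamma> = transport_flat_hom_cell and \<beta> = transport_bind_flat and \<eta> = transport_runit
  have tl: "t \<cdot> l' \<in> Tight X" "tcod X (t \<cdot> l') = tcod X j" using f g by auto
  have h: "elt ?h j' [hom j' c] (r' \<cdot> (t \<cdot> l'))" using elt_hom_cell[OF g(4)] by (simp add: c_def)
  have rk: "r' \<in> Tight X" "tdom X r' = tcod X (t \<cdot> l')" using f tl by auto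
  note flat = transport_aflat[OF h tl]
  note sharp = transport_asharp[OF \<eta>]
  have "runit ?N \<star> ext ?N = asharp j' a' ?i (t \<cdot> l') ((runit T \<lhd> l') \<star> ?\<beta>)"
    unfolding transport_eqs by (rule sharp(3)[OF \<beta>])
  also have "(runit T \<lhd> l') \<star> ?\<beta> = ?\<gamma>"
    by (rule bind_unit_left[OF T m]) (use \<gamma> f in \<open>auto simp: t_def\<close>)
  finally have 1: "runit ?N \<star> ext ?N = ?h" using flat(2) by simp
  have "bind j' ?N ?i ?i (runit ?N) = whisker_left r' (bind j T l' l' (runit T \<lhd> l'))"
    unfolding transport_eqs using bind_transport[OF sharp(1)[folded c_def]] sharp(2) by simp
  also have "\<dots> = whisker_left r' (tcell_id (t \<cdot> l'))"
    using bind_runit[OF T m] f by (simp add: t_def)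
  also have "\<dots> = tcell_id c" using whisker_left_tcell_id[OF tl(1) rk] by (simp add: c_def)
  finally have 2: "bind j' ?N ?i ?i (runit ?N) = tcell_id c" .
  have hb: "elt (?h \<star> whisker_left r' ?\<beta>) j' ([hom j' c] @ [hom j' c]) c"
    using elt_star[OF h elt_whisker_left[OF \<beta> rk]] by (simp add: c_def)
  have "ext ?N \<star> ext ?N = whisker_left r' (?\<beta> \<star> ?\<beta>)"
    unfolding transport_eqs by (rule whisker_left_star[OF \<beta> \<beta> rk, symmetric])
  also have "?\<beta> \<star> ?\<beta> = bind j T l' l' (?\<gamma> \<star> ?\<beta>)"
    by (rule bind_star[OF T m]) (use \<gamma> f in \<open>auto simp: t_def\<close>)
  \<comment> \<open>Naturality of \<flat>' in its second argument brings the composite back under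
    \<flat>', as \<open>bind_transport\<close> requires.\<close>
  also have "?\<gamma> \<star> ?\<beta> = aflat j' a' ?i (t \<cdot> l') (?h \<star> whisker_left r' ?\<beta>)"
    by (rule flat(3)[OF \<beta>])
  finally have 3: "ext ?N \<star> ext ?N = bind j' ?N ?i ?i (?h \<star> ext ?N)"
    unfolding bind_transport[OF hb] transport_eqs(2) .
  show ?thesis
    using relative_monad_iff[OF transport_eqs(4)] 1 2 3 by (simp add: transport_eqs(1))
qed

lemma transport_unit_morphism:
  assumes m: "relative_monad j T"
  shows "rmonad_morphism j' (induced_rmonad j' a') (transport j l' j' a' T)
    (whisker_right (whisker_left r' (runit T)) l')"
proof -
  let ?i = "tid X (tdom X j')" and ?N = "transport j l' j' a' T" and ?P = "induced_rmonad j' a'"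
  let ?d = "r' \<cdot> (j \<cdot> l')"
  let ?h = "hom_cell j' ?d" and ?\<eta> = "runit T \<lhd> l'"
  let ?\<gamma> = "aflat j' a' ?i (j \<cdot> l') ?h"
  note f = transport_facts and g = transport_carrier_simps
  note P = induced_rmonad_data[OF transport_adj_data]
  have cP: "carrier ?P = ?d" and eP: "ext ?P = whisker_left r' ?\<gamma>" and rP:
      "runit ?P = asharp j' a' ?i (j \<cdot> l') (tcell_id (j \<cdot> l'))"
    using induced_rmonad_simps[OF transport_adj_data] ext_induced_rmonad[OF transport_adj_data]
    by (simp_all add: ladj_a' flip: r'_def)
  note \<eta> = transport_runit
  have w: "whisker_right (whisker_left r' (runit T)) l' = whisker_left r' ?\<eta>"
    using whisker_left_pre[OF elt_runit[OF T], of r' l'] f by (simp add: whisker_right_def)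
  have jl: "j \<cdot> l' \<in> Tight X" "tcod X (j \<cdot> l') = tcod X j" using f by auto
  have rk: "r' \<in> Tight X" "tdom X r' = tcod X (j \<cdot> l')" using f jl by auto
  have p: "cospan j' ?d" using f by simp
  note h = elt_hom_cell[OF p]
  note flat = transport_aflat[OF h jl] and \<gamma> = transport_aflat(1)[OF h jl]
  note W = elt_whisker_left[OF \<eta> rk]
  have hw: "elt (?h \<star> whisker_left r' ?\<eta>) j' ([hom j' ?d] @ []) c"
    using elt_star[OF h W] by (simp add: c_def)
  have \<gamma>\<eta>: "elt (?\<gamma> \<star> ?\<eta>) (j \<cdot> l') [hom j' ?d] (t \<cdot> l')"
    using elt_star[OF \<gamma> \<eta>] by simp
  have b: "elt (bind j T l' l' (?\<gamma> \<star> ?\<eta>)) (t \<cdot> l') [hom j' ?d] (t \<cdot> l')"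
    using elt_bind[OF T, folded t_def, OF \<gamma>\<eta>] f by simp
  have "runit ?P \<star> whisker_left r' ?\<eta> = asharp j' a' ?i (t \<cdot> l') (tcell_id (j \<cdot> l') \<star> ?\<eta>)"
    unfolding rP by (rule transport_asharp(3)[OF elt_tcell_id[OF jl(1)] \<eta>])
  then have 1: "runit ?P \<star> whisker_left r' ?\<eta> = runit ?N"
    using star_one(1)[OF \<eta>] by (simp add: transport_eqs)
  have "ext ?P \<star> whisker_left r' ?\<eta> = whisker_left r' (?\<gamma> \<star> ?\<eta>)"
    unfolding eP by (rule whisker_left_star[OF \<gamma> \<eta> rk, symmetric])
  \<comment> \<open>The left unit law of \<open>T\<close>, read backwards at the element
    \<open>?\<gamma> \<star> ?\<eta>\<close>, creates the operator of \<open>T\<close> that the law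
    for morphisms demands.\<close>
  also have "?\<gamma> \<star> ?\<eta> = ?\<eta> \<star> bind j T l' l' (?\<gamma> \<star> ?\<eta>)"
    by (rule bind_unit_left[OF T m, symmetric]) (use \<gamma>\<eta> f in \<open>auto simp: t_def\<close>)
  also have "whisker_left r' \<dots> = whisker_left r' ?\<eta> \<star> whisker_left r' (bind j T l' l' (?\<gamma> \<star> ?\<eta>))"
    by (rule whisker_left_star[OF \<eta> b rk])
  also have "whisker_left r' (bind j T l' l' (?\<gamma> \<star> ?\<eta>)) = bind j' ?N ?i ?i
      (?h \<star> whisker_left r' ?\<eta>)"
    unfolding bind_transport[OF hw] flat(3)[OF \<eta>] ..
  finally show ?thesis
    unfolding rmonad_morphism_iff[OF P transport_eqs(4)] w using 1 W by
        (simp add: cP transport_eqs(1) c_def)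
qed

lemma transport_whisker:
  assumes "elt \<tau> t [] t'"
  shows "whisker_right (whisker_left r' \<tau>) l' = whisker_left r' (\<tau> \<lhd> l')"
    "elt (\<tau> \<lhd> l') (t \<cdot> l') [] (t' \<cdot> l')"
  using whisker_left_pre[OF assms, of r' l'] elt_subst0[OF assms, of l'] transport_facts
      transport_carrier_simps
  by (simp_all add: whisker_right_def)

end

text \<open>The law for \<tau> is applied at \<flat>' of the generic element; naturality of \<flat>'
  then moves the whiskered \<tau> inside. Compatibility with units is naturality of
  \<sharp>'.\<close>

lemma transport_morphism:
  assumes "relative_monad j T" "relative_monad j T'" and \<tau>: "rmonad_morphism j T T' \<tau>"
  shows "rmonad_morphism j' (transport j l' j' a' T) (transport j l' j' a' T')
    (whisker_right (whisker_left r' \<tau>) l')"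
proof -
  note T = relative_monad_data[OF assms(1)] and T' = relative_monad_data[OF assms(2)]
  let ?t = "carrier T" and ?t' = "carrier T'"
  let ?i = "tid X (tdom X j')" and ?N = "transport j l' j' a' T" and ?N' = "transport j l' j' a' T'"
  let ?c = "r' \<cdot> (?t \<cdot> l')" and ?c' = "r' \<cdot> (?t' \<cdot> l')"
  let ?h = "hom_cell j' ?c" and ?\<sigma> = "\<tau> \<lhd> l'"
  let ?\<gamma> = "aflat j' a' ?i (?t \<cdot> l') ?h"
  let ?\<beta> = "bind j T l' l' ?\<gamma>"
  note f = transport_facts and g = transport_carrier_simps[OF T] and g'
      = transport_carrier_simps[OF T']
  have e\<tau>: "elt \<tau> ?t [] ?t'" and u\<tau>: "runit T \<star> \<tau> = runit T'"
    using \<tau> rmonad_morphism_iff[OF T T'] by auto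
  note w = transport_whisker(1)[OF T e\<tau>] and \<sigma> = transport_whisker(2)[OF T e\<tau>]
  note \<gamma> = transport_flat_hom_cell[OF T] and \<beta> = transport_bind_flat[OF T] and \<eta>
      = transport_runit[OF T]
  have tl: "?t \<cdot> l' \<in> Tight X" "tcod X (?t \<cdot> l') = tcod X j" using f g by auto
  have rk: "r' \<in> Tight X" "tdom X r' = tcod X (?t \<cdot> l')" using f tl by auto
  have rk': "tdom X r' = tcod X (?t' \<cdot> l')" using f g' by auto
  note h = elt_hom_cell[OF g(4)]
  note flat = transport_aflat[OF h tl]
  note W = elt_whisker_left[OF \<sigma> rk]
  have hw: "elt (?h \<star> whisker_left r' ?\<sigma>) j' ([hom j' ?c] @ []) ?c'"
    using elt_star[OF h W] .
  have \<gamma>\<sigma>: "elt (?\<gamma> \<star> ?\<sigma>) (j \<cdot> l') [hom j' ?c] (?t' \<cdot> l')"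
    using elt_star[OF \<gamma> \<sigma>] by simp
  have b: "elt (bind j T' l' l' (?\<gamma> \<star> ?\<sigma>)) (?t' \<cdot> l') [hom j' ?c] (?t' \<cdot> l')"
    using elt_bind[OF T' \<gamma>\<sigma>] f by simp
  have "runit ?N \<star> whisker_left r' ?\<sigma> = asharp j' a' ?i (?t' \<cdot> l') ((runit T \<lhd> l') \<star> ?\<sigma>)"
    unfolding transport_eqs[OF T] by (rule transport_asharp(3)[OF \<eta> \<sigma>])
  also have "(runit T \<lhd> l') \<star> ?\<sigma> = runit T' \<lhd> l'"
    using star_subst0[OF elt_runit[OF T] e\<tau>, of l'] f u\<tau> by simp
  finally have 1: "runit ?N \<star> whisker_left r' ?\<sigma> = runit ?N'" by (simp add: transport_eqs[OF T'])
  have "ext ?N \<star> whisker_left r' ?\<sigma> = whisker_left r' (?\<beta> \<star> ?\<sigma>)"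
    unfolding transport_eqs[OF T] by (rule whisker_left_star[OF \<beta> \<sigma> rk, symmetric])
  also have "?\<beta> \<star> ?\<sigma> = ?\<sigma> \<star> bind j T' l' l' (?\<gamma> \<star> ?\<sigma>)"
    by (rule bind_morphism[OF T T' \<tau> \<gamma>]) (use f in auto)
  also have "whisker_left r' \<dots> = whisker_left r' ?\<sigma> \<star> whisker_left r' (bind j T' l' l' (?\<gamma> \<star> ?\<sigma>))"
    by (rule whisker_left_star[OF \<sigma> b rk])
  also have "whisker_left r' (bind j T' l' l' (?\<gamma> \<star> ?\<sigma>)) = bind j' ?N' ?i ?i
      (?h \<star> whisker_left r' ?\<sigma>)"
    unfolding bind_transport[OF T' hw] flat(3)[OF \<sigma>] ..
  finally show ?thesis
    unfolding rmonad_morphism_iff[OF transport_eqs(4)[OF T] transport_eqs(4)[OF T']] w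
    using 1 W by (simp add: transport_eqs(1)[OF T] transport_eqs(1)[OF T'])
qed

lemma category_functor_transport:
  "category_functor (RMnd j) (RMnd j') (transport_functor j l' j' a')"
proof (intro category_functor.intro category_RMnd category_functor_axioms.intro)
  fix T assume "T \<in> Ob (RMnd j)"
  then have m: "relative_monad j T" by (simp add: RMnd_def)
  note T = relative_monad_data[OF m]
  note f = transport_facts and g = transport_carrier_simps[OF T]
  show "FOb (transport_functor j l' j' a') T \<in> Ob (RMnd j')"
    using relative_monad_transport[OF T m] by (simp add: RMnd_def transport_functor_def)
  have "whisker_right (whisker_left r' (tcell_id (carrier T))) l' = tcell_id
      (r' \<cdot> (carrier T \<cdot> l'))"
    using transport_whisker(1)[OF T elt_tcell_id[OF g(1)]] f g tcell_id_pre[of "carrier T" l']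
      whisker_left_tcell_id[of "carrier T \<cdot> l'" r'] by simp
  then show "FHom (transport_functor j l' j' a') T T (Idn (RMnd j) T) = Idn (RMnd j')
      (FOb (transport_functor j l' j' a') T)"
    by (simp add: RMnd_def transport_functor_def transport_eqs(1)[OF T] flip: r'_def)
next
  fix T T' \<tau> assume "T \<in> Ob (RMnd j)" "T' \<in> Ob (RMnd j)" "\<tau> \<in> Hom (RMnd j) T T'"
  then show "FHom (transport_functor j l' j' a') T T' \<tau>
      \<in> Hom (RMnd j') (FOb (transport_functor j l' j' a') T) (FOb (transport_functor j l' j' a')
        T')"
    using transport_morphism[of T T' \<tau>] by (simp add: RMnd_def transport_functor_def r'_def)
next
  fix T T' T'' \<tau> \<tau>'
  assume "T \<in> Ob (RMnd j)" "T' \<in> Ob (RMnd j)" "T'' \<in> Ob (RMnd j)" "\<tau> \<in> Hom (RMnd j) T T'"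
    "\<tau>' \<in> Hom (RMnd j) T' T''"
  then have T: "rmonad_data j T" and T': "rmonad_data j T'" and e:
      "elt \<tau> (carrier T) [] (carrier T')"
    and e': "elt \<tau>' (carrier T') [] (carrier T'')"
    using relative_monad_data by (auto simp: RMnd_def rmonad_morphism_def tcell_iff_elt)
  note w = transport_whisker[OF T e] and w' = transport_whisker[OF T' e'] and w''
      = transport_whisker[OF T elt_star[OF e e', simplified]]
  note f = transport_facts and g = transport_carrier_simps[OF T]
  have "whisker_right (whisker_left r' (\<tau> \<star> \<tau>')) l'
      = whisker_right (whisker_left r' \<tau>) l' \<star> whisker_right (whisker_left r' \<tau>') l'"
    unfolding w(1) w'(1) w''(1) using whisker_left_star[OF w(2) w'(2), of r']
        star_subst0[OF e e', of l'] f g by simp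
  then show "FHom (transport_functor j l' j' a') T T'' (Cmp (RMnd j) T T' T'' \<tau>' \<tau>)
    = Cmp (RMnd j') (FOb (transport_functor j l' j' a') T) (FOb (transport_functor j l' j' a') T')
       (FOb (transport_functor j l' j' a') T'')
        (FHom (transport_functor j l' j' a') T' T'' \<tau>') (FHom (transport_functor j l' j' a') T T'
        \<tau>)"
    by (simp add: RMnd_def transport_functor_def r'_def)
qed

section \<open>Compatibility with the functors from relative adjunctions to relative monads\<close>

text \<open>For an induced monad the operator is r\<flat>, so the transported one is
  r'r\<flat>\<flat>', and \<flat>\<flat>' is the \<flat> of the composite adjunction. On units,
  restricting \<sharp>(1) along \<ell>' gives \<sharp> of the identity of \<ell>\<ell>', and
  \<sharp>'\<sharp> is the composite \<sharp>.\<close>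

lemma transport_induced_rmonad:
  assumes a: "radj_data j a"
  shows "transport j l' j' a' (induced_rmonad j a) = induced_rmonad j' (radj_comp j l' j' a' a)"
proof -
  let ?l = "ladj a" and ?r = "radj a" and ?c = "radj_comp j l' j' a' a" and ?P
    = "induced_rmonad j a"
  let ?i = "tid X (tdom X j')" and ?iB = "tid X (tdom X j)"
  note t = radj_tight[OF a] and s = induced_rmonad_simps[OF a]
  note f = transport_facts
  note P = induced_rmonad_data[OF a]
  note c = radj_comp_simps[OF a transport_adj_data l' ladj_a', folded r'_def]
  note cc = c(3)
  note sc = induced_rmonad_simps[OF cc, unfolded c(1,2)]
  note te = transport_eqs[OF P, unfolded s(1)]
  have as: "(?r \<cdot> ?l) \<cdot> l' = ?r \<cdot> (?l \<cdot> l')" "(r' \<cdot> ?r) \<cdot> (?l \<cdot> l') = r' \<cdot> (?r \<cdot> (?l \<cdot> l'))"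
    using tcomp_assoc'[of l' ?l ?r] tcomp_assoc'[of "?l \<cdot> l'" ?r r'] t f by auto
  have ll: "?l \<cdot> l' \<in> Tight X" "tcod X (?l \<cdot> l') = tcod X ?l" "tdom X (?l \<cdot> l') = tdom X j'"
    "?l \<cdot> (l' \<cdot> ?i) = ?l \<cdot> l'" using t f by auto
  have B: "?iB \<in> Tight X" "tdom X ?iB = tdom X j" "tcod X ?iB = tdom X j" "?iB \<cdot> l' = l'"
      "?l \<cdot> ?iB = ?l"
    using t f by auto
  show ?thesis
  proof (rule rmonad_eqI[OF te(4) induced_rmonad_data[OF cc]])
    show "carrier (transport j l' j' a' ?P) = carrier (induced_rmonad j' ?c)"
      unfolding te sc as ..
    have "asharp j a ?iB ?l (tcell_id ?l) \<lhd> l' = asharp j a (?iB \<cdot> l') (?l \<cdot> l') (tcell_id ?l \<lhd> l')"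
      by (rule asharp_subst0[OF a]) (use elt_tcell_id[of ?l] t f B in auto)
    also have "\<dots> = asharp j a l' (?l \<cdot> l') (tcell_id (?l \<cdot> l'))"
      using tcell_id_pre[of ?l l'] t f B by simp
    finally show "runit (transport j l' j' a' ?P) = runit (induced_rmonad j' ?c)"
      unfolding te sc s as using c(4)[of "tcell_id (?l \<cdot> l')" ?i "[]" "?l \<cdot> l'"]
          elt_tcell_id[OF ll(1)] ll f by simp
    let ?d = "r' \<cdot> (?r \<cdot> (?l \<cdot> l'))"
    let ?h = "hom_cell j' ?d"
    have p: "cospan j' ?d" using t f ll by simp
    note h = elt_hom_cell[OF p]
    let ?\<gamma> = "aflat j' a' ?i (?r \<cdot> (?l \<cdot> l')) ?h"
    have \<gamma>: "elt ?\<gamma> (j \<cdot> l') [hom j' ?d] (?r \<cdot> (?l \<cdot> l'))"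
      using transport_aflat(1)[OF h] t f ll by simp
    have fl: "elt (aflat j a l' (?l \<cdot> l') ?\<gamma>) (?l \<cdot> l') [hom j' ?d] (?l \<cdot> l')"
      using elt_aflat[OF a \<gamma>] f ll by simp
    have "ext (transport j l' j' a' ?P) = whisker_left r' (bind j ?P l' l' ?\<gamma>)"
      unfolding te as ..
    also have "bind j ?P l' l' ?\<gamma> = whisker_left ?r (aflat j a l' (?l \<cdot> l') ?\<gamma>)"
      by (rule bind_induced_rmonad[OF a \<gamma>]) (use f in auto)
    also have "whisker_left r' \<dots> = whisker_left (r' \<cdot> ?r) (aflat j a l' (?l \<cdot> l') ?\<gamma>)"
      by (rule whisker_left_tcomp[OF fl, symmetric]) (use t f ll in auto)
    also have "aflat j a l' (?l \<cdot> l') ?\<gamma> = aflat j' ?c ?i (?l \<cdot> l') ?h"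
      using c(5)[of ?h ?i "[hom j' ?d]" "?l \<cdot> l'"] h f ll by simp
    finally show "ext (transport j l' j' a' ?P) = ext (induced_rmonad j' ?c)"
      unfolding ext_induced_rmonad[OF cc] c(1,2) as .
  qed
qed

text \<open>Objects are covered by \<open>transport_induced_rmonad\<close>. On morphisms both
  functors whisker \<alpha> by the same tight-cells in a different order, so functoriality of left
  whiskering and its exchange with right whiskering suffice.\<close>

lemma transport_Lambda_L:
  "functors_equal (op_category (RAdj_L j)) (functor_comp (transport_functor j l' j' a')
    (Lambda_L j))
    (functor_comp (Lambda_L j') (op_functor (radj_comp_L j l' j' a')))"
proof -
  have "whisker_right (whisker_left r' (whisker_left (radj a) \<alpha>)) l'
      = whisker_left (r' \<cdot> radj a) (whisker_right \<alpha> l')"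
    if a: "relative_adjunction j a" and m: "left_morphism j b a (c, \<alpha>)" for a b c \<alpha>
  proof -
    have ad: "radj_data j a" using a by (simp add: relative_adjunction_iff)
    note t = radj_tight[OF ad] and f = transport_facts
    have \<alpha>: "elt \<alpha> (ladj a) [] (c \<cdot> ladj b)" using m by (simp add: left_morphism_def tcell_iff_elt)
    have w: "elt (whisker_left (radj a) \<alpha>) (radj a \<cdot> ladj a) [] (radj a \<cdot> (c \<cdot> ladj b))"
      using elt_whisker_left[OF \<alpha>] t by simp
    show ?thesis
      using whisker_left_tcomp[OF elt_subst0[OF \<alpha>, of l'], of "radj a" r']
          whisker_left_pre[OF \<alpha>, of "radj a" l']
        whisker_left_pre[OF w, of r' l'] t f by (simp add: whisker_right_def)
  qed
  then show ?thesis
    using transport_induced_rmonad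
    by (auto simp: functors_equal_def op_category_def RAdj_L_def functor_comp_def
        transport_functor_def Lambda_L_def
        op_functor_def radj_comp_L_def radj_comp_def Let_def relative_adjunction_iff r'_def)
qed

text \<open>As for left-morphisms, except that \<rho> is whiskered twice on the right, by \<ell> and
  then \<ell>', and these combine into one whiskering by \<ell>\<ell>'.\<close>

lemma transport_Lambda_R:
  "functors_equal (RAdj_R j) (functor_comp (transport_functor j l' j' a') (Lambda_R j))
    (functor_comp (Lambda_R j') (radj_comp_R j l' j' a'))"
proof -
  have "whisker_right (whisker_left r' (whisker_right \<rho> (ladj a))) l'
      = whisker_right (whisker_left r' \<rho>) (ladj a \<cdot> l')"
    if a: "relative_adjunction j a" and m: "right_morphism j a b (c, \<rho>)" for a b c \<rho>
  proof -
    have ad: "radj_data j a" using a by (simp add: relative_adjunction_iff)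
    note t = radj_tight[OF ad] and f = transport_facts
    have \<rho>: "elt \<rho> (radj a) [] (radj b \<cdot> c)" using m by (simp add: right_morphism_def tcell_iff_elt)
    have w: "elt (whisker_left r' \<rho>) (r' \<cdot> radj a) [] (r' \<cdot> (radj b \<cdot> c))"
      using elt_whisker_left[OF \<rho>, of r'] t f by simp
    show ?thesis
      using whisker_left_pre[OF \<rho>, of r' "ladj a"] pre_tight_pre[OF w, of "ladj a" l'] t f
      by (simp add: whisker_right_def)
  qed
  then show ?thesis
    using transport_induced_rmonad
    by (auto simp: functors_equal_def RAdj_R_def functor_comp_def transport_functor_def Lambda_R_def
        radj_comp_R_def radj_comp_def Let_def relative_adjunction_iff r'_def)
qed

end

end

theorem corollary5p40:
  fixes X :: "('o, 't, 'l, 'c) vdc_data" (structure)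
    and A B D E :: 'o and j l' j' r' :: 't and a' :: "('t, 'c) radjunction"
  assumes "virtual_equipment X"
    and "tight X j B D" and "tight X l' A B" and "tight X j' A E" and "tight X r' D E"
    and "virtual_equipment.relative_adjunction X j' a'" and "ladj a' = j \<cdot> l'" and "radj a' = r'"
  shows "\<exists>F :: (('t, 'c) rmonad, 'c, ('t, 'c) rmonad, 'c) functor_data.
    (\<forall>T. virtual_equipment.relative_monad X j T \<longrightarrow>
       virtual_equipment.relative_monad X j' (FOb F T) \<and>
       carrier (FOb F T) = r' \<cdot> carrier T \<cdot> l' \<and>
       virtual_equipment.rmonad_morphism X j' (virtual_equipment.induced_rmonad X j' a') (FOb F T)
         (virtual_equipment.whisker_right X (virtual_equipment.whisker_left X r' (runit T)) l')) \<and>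
    category_functor (virtual_equipment.RMnd X j) (virtual_equipment.RMnd X j') F \<and>
    functors_equal (op_category (virtual_equipment.RAdj_L X j))
      (functor_comp F (virtual_equipment.Lambda_L X j))
      (functor_comp (virtual_equipment.Lambda_L X j')
        (op_functor (virtual_equipment.radj_comp_L X j l' j' a'))) \<and>
    functors_equal (virtual_equipment.RAdj_R X j)
      (functor_comp F (virtual_equipment.Lambda_R X j))
      (functor_comp (virtual_equipment.Lambda_R X j')
        (virtual_equipment.radj_comp_R X j l' j' a'))"
proof -
  interpret virtual_equipment X by fact
  have j: "j \<in> Tight X" "l' \<in> Tight X" "tcod X l' = tdom X j"
    using assms(2,3) by (auto simp: tight_def)
  note t = assms(6,7) j
  let ?F = "transport_functor j l' j' a'"
  have F: "FOb ?F = transport j l' j' a'" by (simp add: transport_functor_def)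
  have "relative_monad j' (FOb ?F T) \<and> carrier (FOb ?F T) = r' \<cdot> carrier T \<cdot> l' \<and>
      rmonad_morphism j' (induced_rmonad j' a') (FOb ?F T) (whisker_right (whisker_left r' (runit T)) l')"
    if m: "relative_monad j T" for T
    using relative_monad_transport[OF t relative_monad_data[OF m] m]
      transport_unit_morphism[OF t relative_monad_data[OF m] m] assms(8)
    by (simp add: F transport_def Let_def)
  then show ?thesis
    using category_functor_transport[OF t] transport_Lambda_L[OF t] transport_Lambda_R[OF t] by blast
qed

end
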